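(* Let $\mu_{1},\mu_{2}\in\mathscr{P}_{\mathbb{T}^{2}}^{\times}$ and let $\Omega_{r}=(D_r\cup\Delta_r)\times(D_r\cup\Delta_r)$ be a common domain of definition for the transforms $\Sigma_{\mu_{1}}$, $\Sigma_{\mu_{2}}$, and $\Sigma_{\mu_{1}\boxtimes\boxtimes\mu_{2}}$. Then \[ \Sigma_{\mu_{1}\boxtimes\boxtimes\mu_{2}}(z,w)=\Sigma_{\mu_{1}}(z,w)\,\Sigma_{\mu_{2}}(z,w),\qquad(z,w)\in\Omega_{r}. \]
   Context: Notation. $\mathbb{T}$ is the unit circle, $\mathbb{D}$ the open unit disk, $\mathbb{T}^2=\mathbb{T}\times\mathbb{T}$; $\mathscr{P}_{\mathbb{T}}$, $\mathscr{P}_{\mathbb{T}^2}$ are the sets of Borel probability measures on $\mathbb{T}$, $\mathbb{T}^2$. For $r\in(0,1]$, $D_r=\{z\in\mathbb{C}:|z|<r\}$ and $\Delta_r=\{z\in\mathbb{C}:|z|>1/r\}$. For $\mu\in\mathscr{P}_{\mathbb{T}^2}$, $\mu^{(j)}=\mu\circ\pi_j^{-1}$ ($j=1,2$) are its marginals, where $\pi_1(s,t)=s$, $\pi_2(s,t)=t$; $m(\nu)=\int_{\mathbb{T}}x\,d\nu(x)$ for $\nu\in\mathscr{P}_{\mathbb{T}}$ and $m_{1,1}(\mu)=\int_{\mathbb{T}^2}st\,d\mu(s,t)$. $\mathscr{P}_{\mathbb{T}}^{\times}=\{\nu\in\mathscr{P}_{\mathbb{T}}:m(\nu)\neq0\}$,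 and $\mathscr{P}_{\mathbb{T}^2}^{\times}$ is the set of $\mu\in\mathscr{P}_{\mathbb{T}^2}$ with $m(\mu^{(1)})\ne0$, $m(\mu^{(2)})\neq0$ and $m_{1,1}(\mu)\neq0$. Transforms. $\psi_\nu(z)=\int_{\mathbb{T}}\frac{zx}{1-zx}\,d\nu(x)$ and $\eta_\nu=\psi_\nu/(1+\psi_\nu)$ on $\mathbb{C}\setminus\mathbb{T}$ for $\nu\in\mathscr{P}_{\mathbb{T}}$. For $\nu\in\mathscr{P}_{\mathbb{T}}^{\times}$ and $r$ small, $\eta_\nu^{-1}$ denotes the holomorphic inverse of $\eta_\nu$ on $D_r\cup\Delta_r$, mapping $D_r$ into $\mathbb{D}$ with $\eta_\nu^{-1}(0)=0$ and $\Delta_r$ into $\Delta_1$ with a simple pole at $\infty$. For $\mu\in\mathscr{P}_{\mathbb{T}^2}$ and $(z,w)\in(\mathbb{C}\setminus\mathbb{T})^2$, \[ \psi_\mu(z,w)=\int_{\mathbb{T}^2}\frac{zs}{1-zs}\frac{wt}{1-wt}\,d\mu(s,t),\qquad H_\mu(z,w)=\int_{\mathbb{T}^2}\frac{1}{(1-zs)(1-wt)}\,d\mu(s,t). \] The bi-free partial $\Sigma$-transform of $\mu\in\mathscr{P}_{\mathbb{T}^2}^{\times}$ is \[ \Sigma_\mu(z,w)=\frac{\psi_\mu\big(\eta_{\mu^{(1)}}^{-1}(z),\eta_{\mu^{(2)}}^{-1}(w)\big)}{zw\,H_\mu\big(\eta_{\mu^{(1)}}^{-1}(z),\eta_{\mu^{(2)}}^{-1}(w)\big)},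 \] extended holomorphically to points with $z=0$ or $w=0$. A domain of definition of $\Sigma_\mu$ is a product set $\Omega_r=(D_r\cup\Delta_r)\times(D_r\cup\Delta_r)$ with $r\in(0,1)$ so small that $\eta_{\mu^{(1)}}^{-1},\eta_{\mu^{(2)}}^{-1}$ are defined on $D_r\cup\Delta_r$ and $\Sigma_\mu$ is well-defined and holomorphic on $\Omega_r$ (such $r$ exists for each $\mu\in\mathscr{P}_{\mathbb{T}^2}^{\times}$). Bi-free convolution. Given $\mu_1,\mu_2\in\mathscr{P}_{\mathbb{T}^2}$ let $H_i=L^2(\mu_i)$, $\xi_i$ the constant function $1$, $H_i^\circ=H_i\ominus\mathbb{C}\xi_i$, and let $H=\mathbb{C}\xi\oplus\bigoplus_{n\ge1}\bigoplus_{i_1\ne i_2\ne\cdots\ne i_n}H_{i_1}^\circ\otimes\cdots\otimes H_{i_n}^\circ$ be the Hilbert space free product, with $\varphi_\xi(\cdot)=\langle\cdot\,\xi,\xi\rangle$ on $B(H)$. Let $H(\ell,i)\subset H$ (resp. $H(r,i)\subset H$) be spanned by $\xi$ and the summands with $i_1\ne i$ (resp. $i_n\neq i$), and let $V_i:H_i\otimes H(\ell,i)\to H$, $W_i:H(r,i)\otimes H_i\to H$ be the natural unitaries (concatenation of tensors, with $\xi_i$ and $\xi$ acting as the empty word). Let $S_i,T_i$ be multiplication by $s$ and by $t$ on $L^2(\mu_i)$, and put $u_i=V_i(S_i\otimes I)V_i^{-1}$, $v_i=W_i(I\otimes T_i)W_i^{-1}$. Each $u_i$ commutes with each $v_{i'}$,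 $(u_1,v_1)$ and $(u_2,v_2)$ are bi-free in $(B(H),\varphi_\xi)$, and $(u_i,v_i)$ has distribution $\mu_i$. The bi-free convolution $\mu_1\boxtimes\boxtimes\mu_2\in\mathscr{P}_{\mathbb{T}^2}$ is the distribution of the commuting unitary pair $(u_1u_2,v_1v_2)$, i.e. $\int s^pt^q\,d(\mu_1\boxtimes\boxtimes\mu_2)=\varphi_\xi((u_1u_2)^p(v_1v_2)^q)$ for $p,q\in\mathbb{Z}$. If $\mu_1,\mu_2\in\mathscr{P}_{\mathbb{T}^2}^{\times}$ then $\mu_1\boxtimes\boxtimes\mu_2\in\mathscr{P}_{\mathbb{T}^2}^{\times}$. *)

theory Defs
  imports "HOL-Probability.Probability" "HOL-Complex_Analysis.Complex_Analysis"
begin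

section \<open>Probability measures on the circle and on the torus\<close>

definition circle_borel :: "complex measure" where
  "circle_borel = restrict_space borel (sphere 0 1)"

definition torus_borel :: "(complex \<times> complex) measure" where
  "torus_borel = restrict_space borel (sphere 0 1 \<times> sphere 0 1)"

definition torus_probs :: "(complex \<times> complex) measure set" where
  "torus_probs = {\<mu>. prob_space \<mu> \<and> sets \<mu> = sets torus_borel}"

definition marginal1 :: "(complex \<times> complex) measure \<Rightarrow> complex measure" where
  "marginal1 \<mu> = distr \<mu> circle_borel fst"

definition marginal2 :: "(complex \<times> complex) measure \<Rightarrow> complex measure" where
  "marginal2 \<mu> = distr \<mu> circle_borel snd"

definition mean :: "complex measure \<Rightarrow> complex" where
  "mean \<nu> = (LINT x|\<nu>. x)"

definition mean11 :: "(complex \<times> complex) measure \<Rightarrow> complex" where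
  "mean11 \<mu> = (LINT x|\<mu>. fst x * snd x)"

definition torus_probs_nz :: "(complex \<times> complex) measure set" where
  "torus_probs_nz =
     {\<mu> \<in> torus_probs. mean (marginal1 \<mu>) \<noteq> 0 \<and> mean (marginal2 \<mu>) \<noteq> 0 \<and> mean11 \<mu> \<noteq> 0}"


section \<open>The transforms\<close>

definition psi1 :: "complex measure \<Rightarrow> complex \<Rightarrow> complex" where
  "psi1 \<nu> z = (LINT x|\<nu>. z * x / (1 - z * x))"

text \<open>Outside the closed disk, \<open>1 + psi1 \<nu> z\<close> may vanish; \<open>eta\<close> then has the junk value 0
  in place of a pole.\<close>

definition eta :: "complex measure \<Rightarrow> complex \<Rightarrow> complex" where
  "eta \<nu> z = psi1 \<nu> z / (1 + psi1 \<nu> z)"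

definition psi2 :: "(complex \<times> complex) measure \<Rightarrow> complex \<Rightarrow> complex \<Rightarrow> complex" where
  "psi2 \<mu> z w =
     (LINT x|\<mu>. (z * fst x / (1 - z * fst x)) * (w * snd x / (1 - w * snd x)))"

definition H2 :: "(complex \<times> complex) measure \<Rightarrow> complex \<Rightarrow> complex \<Rightarrow> complex" where
  "H2 \<mu> z w = (LINT x|\<mu>. 1 / ((1 - z * fst x) * (1 - w * snd x)))"

definition Delta :: "real \<Rightarrow> complex set" where
  "Delta r = {z. norm z > 1 / r}"

definition DDelta :: "real \<Rightarrow> complex set" where
  "DDelta r = ball 0 r \<union> Delta r"

text \<open>The last two conjuncts say that \<open>g\<close> has a simple pole at infinity.\<close>

definition is_eta_inverse :: "complex measure \<Rightarrow> real \<Rightarrow> (complex \<Rightarrow> complex) \<Rightarrow> bool" where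
  "is_eta_inverse \<nu> r g \<longleftrightarrow>
     g holomorphic_on DDelta r \<and>
     g ` ball 0 r \<subseteq> ball 0 1 \<and> g 0 = 0 \<and> g ` Delta r \<subseteq> Delta 1 \<and>
     (\<forall>z\<in>DDelta r. eta \<nu> (g z) = z) \<and>
     is_pole (\<lambda>\<zeta>. g (1 / \<zeta>)) 0 \<and> zorder (\<lambda>\<zeta>. g (1 / \<zeta>)) 0 = -1"

text \<open>By the identity theorem, two inverses in the sense of \<open>is_eta_inverse\<close> agree wherever both
  are defined, so the value at \<open>z\<close> does not depend on the radius.\<close>

definition eta_inv :: "complex measure \<Rightarrow> complex \<Rightarrow> complex" where
  "eta_inv \<nu> z =
     (THE y. \<exists>r g. 0 < r \<and> r \<le> 1 \<and> is_eta_inverse \<nu> r g \<and> z \<in> DDelta r \<and> y = g z)"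

definition bifree_Sigma_raw ::
  "(complex \<times> complex) measure \<Rightarrow> complex \<times> complex \<Rightarrow> complex" where
  "bifree_Sigma_raw \<mu> = (\<lambda>(z, w).
     psi2 \<mu> (eta_inv (marginal1 \<mu>) z) (eta_inv (marginal2 \<mu>) w) /
     (z * w * H2 \<mu> (eta_inv (marginal1 \<mu>) z) (eta_inv (marginal2 \<mu>) w)))"

text \<open>On the axes the holomorphic extension is the limit of the quotient taken along points off
  the axes.\<close>

definition bifree_Sigma ::
  "(complex \<times> complex) measure \<Rightarrow> complex \<times> complex \<Rightarrow> complex" where
  "bifree_Sigma \<mu> p =
     (if fst p \<noteq> 0 \<and> snd p \<noteq> 0 then bifree_Sigma_raw \<mu> p
      else Lim (at p within {q. fst q \<noteq> 0 \<and> snd q \<noteq> 0}) (bifree_Sigma_raw \<mu>))"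

text \<open>Holomorphy in two variables, on an open set: complex differentiability at every point.\<close>

definition holomorphic2_on ::
  "(complex \<times> complex \<Rightarrow> complex) \<Rightarrow> (complex \<times> complex) set \<Rightarrow> bool" where
  "holomorphic2_on f S \<longleftrightarrow>
     (\<forall>p\<in>S. \<exists>a b. (f has_derivative (\<lambda>h. a * fst h + b * snd h)) (at p))"

definition Omega :: "real \<Rightarrow> (complex \<times> complex) set" where
  "Omega r = DDelta r \<times> DDelta r"

definition Sigma_domain :: "(complex \<times> complex) measure \<Rightarrow> real \<Rightarrow> bool" where
  "Sigma_domain \<mu> r \<longleftrightarrow>
     0 < r \<and> r < 1 \<and>
     (\<exists>g. is_eta_inverse (marginal1 \<mu>) r g) \<and>
     (\<exists>g. is_eta_inverse (marginal2 \<mu>) r g) \<and>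
     (\<forall>(z, w) \<in> Omega r. z \<noteq> 0 \<and> w \<noteq> 0 \<longrightarrow>
        H2 \<mu> (eta_inv (marginal1 \<mu>) z) (eta_inv (marginal2 \<mu>) w) \<noteq> 0) \<and>
     holomorphic2_on (bifree_Sigma \<mu>) (Omega r)"


section \<open>The Hilbert space free product and bi-free convolution\<close>

text \<open>
  Let \<open>M i\<close> be a family of probability measures on the torus, \<open>H\<^sub>i = L\<^sup>2(M i)\<close> and \<open>H\<^sub>i\<^sup>o\<close> the
  subspace of mean-zero functions. Since \<open>L\<^sup>2(M i) \<otimes> L\<^sup>2(M j)\<close> is \<open>L\<^sup>2\<close> of the product measure,
  the summand of the free product indexed by a word \<open>w = [i\<^sub>1, ..., i\<^sub>n]\<close> with distinct neighbours
  is realized as the space of square integrable functions of \<open>(x\<^sub>1, ..., x\<^sub>n)\<close> for the product of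
  the \<open>M i\<^sub>k\<close> that have mean zero in each variable separately. A vector \<open>f\<close> of the free product
  is the family of its components, written as one function on lists: its component at \<open>w\<close> is
  \<open>f [(i\<^sub>1, x\<^sub>1), ..., (i\<^sub>n, x\<^sub>n)]\<close>, and \<open>f\<close> vanishes on lists having two equal neighbouring
  indices. The value at the empty list is the component in \<open>\<complex>\<xi>\<close>.
\<close>

type_synonym 'i fpvec = "('i \<times> complex \<times> complex) list \<Rightarrow> complex"

definition vacuum :: "'i fpvec" where
  "vacuum xs = (if xs = [] then 1 else 0)"

definition fp_inner ::
  "('i \<Rightarrow> (complex \<times> complex) measure) \<Rightarrow> 'i fpvec \<Rightarrow> 'i fpvec \<Rightarrow> complex" where
  "fp_inner M f g =
     (\<Sum>\<^sub>\<infinity>w\<in>{w. distinct_adj w}.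
        LINT x|Pi\<^sub>M {..<length w} (\<lambda>k. M (w ! k)).
          f (zip w (map x [0..<length w])) * cnj (g (zip w (map x [0..<length w]))))"

text \<open>
  Elements of \<open>H\<^sub>i \<otimes> H(\<ell>,i)\<close> are functions \<open>g x ys\<close> of a point \<open>x\<close> of the torus and a list \<open>ys\<close>
  whose first index is not \<open>i\<close>. Splitting \<open>g\<close> in the variable \<open>x\<close> into its mean and its mean-zero
  part, \<open>V\<^sub>i g\<close> has the mean as its value at \<open>ys\<close> and the mean-zero part as its value at
  \<open>(i, x) # ys\<close>; so \<open>V\<^sub>i\<close> and its inverse are the following maps.
\<close>

definition left_V ::
  "('i \<Rightarrow> (complex \<times> complex) measure) \<Rightarrow> 'i \<Rightarrow> (complex \<times> complex \<Rightarrow> 'i fpvec) \<Rightarrow> 'i fpvec" where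
  "left_V M i g zs =
     (if zs \<noteq> [] \<and> fst (hd zs) = i
      then g (snd (hd zs)) (tl zs) - (LINT y|M i. g y (tl zs))
      else (LINT y|M i. g y zs))"

definition left_V_inv :: "'i \<Rightarrow> 'i fpvec \<Rightarrow> complex \<times> complex \<Rightarrow> 'i fpvec" where
  "left_V_inv i f x ys =
     (if ys \<noteq> [] \<and> fst (hd ys) = i then 0 else f ((i, x) # ys) + f ys)"

text \<open>The right-hand versions \<open>W\<^sub>i\<close>: the lists \<open>ys\<close> are those whose last index is not \<open>i\<close>.\<close>

definition right_W ::
  "('i \<Rightarrow> (complex \<times> complex) measure) \<Rightarrow> 'i \<Rightarrow> (complex \<times> complex \<Rightarrow> 'i fpvec) \<Rightarrow> 'i fpvec" where
  "right_W M i g zs =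
     (if zs \<noteq> [] \<and> fst (last zs) = i
      then g (snd (last zs)) (butlast zs) - (LINT y|M i. g y (butlast zs))
      else (LINT y|M i. g y zs))"

definition right_W_inv :: "'i \<Rightarrow> 'i fpvec \<Rightarrow> complex \<times> complex \<Rightarrow> 'i fpvec" where
  "right_W_inv i f x ys =
     (if ys \<noteq> [] \<and> fst (last ys) = i then 0 else f (ys @ [(i, x)]) + f ys)"

text \<open>\<open>V\<^sub>i (A \<otimes> I) V\<^sub>i\<^sup>-\<^sup>1\<close> and \<open>W\<^sub>i (I \<otimes> A) W\<^sub>i\<^sup>-\<^sup>1\<close> for \<open>A\<close> the multiplication by \<open>a\<close> on \<open>L\<^sup>2(M i)\<close>.\<close>

definition left_op ::
  "('i \<Rightarrow> (complex \<times> complex) measure) \<Rightarrow> 'i \<Rightarrow> (complex \<times> complex \<Rightarrow> complex) \<Rightarrow>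
   'i fpvec \<Rightarrow> 'i fpvec" where
  "left_op M i a f = left_V M i (\<lambda>x ys. a x * left_V_inv i f x ys)"

definition right_op ::
  "('i \<Rightarrow> (complex \<times> complex) measure) \<Rightarrow> 'i \<Rightarrow> (complex \<times> complex \<Rightarrow> complex) \<Rightarrow>
   'i fpvec \<Rightarrow> 'i fpvec" where
  "right_op M i a f = right_W M i (\<lambda>x ys. a x * right_W_inv i f x ys)"

text \<open>Integer powers of an invertible operator \<open>T\<close> with inverse \<open>T'\<close>.\<close>

definition op_powi :: "('a \<Rightarrow> 'a) \<Rightarrow> ('a \<Rightarrow> 'a) \<Rightarrow> int \<Rightarrow> 'a \<Rightarrow> 'a" where
  "op_powi T T' p = (if p \<ge> 0 then T ^^ nat p else T' ^^ nat (- p))"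

text \<open>\<open>True\<close> is the index of the first measure. The unitaries \<open>u\<^sub>1u\<^sub>2\<close> and \<open>v\<^sub>1v\<^sub>2\<close> have the inverses
  \<open>u\<^sub>2\<^sup>-\<^sup>1u\<^sub>1\<^sup>-\<^sup>1\<close> and \<open>v\<^sub>2\<^sup>-\<^sup>1v\<^sub>1\<^sup>-\<^sup>1\<close>, where \<open>u\<^sub>i\<^sup>-\<^sup>1\<close> and \<open>v\<^sub>i\<^sup>-\<^sup>1\<close> come from multiplication by \<open>1/s\<close>
  and \<open>1/t\<close>.\<close>

definition bifree_moment ::
  "(complex \<times> complex) measure \<Rightarrow> (complex \<times> complex) measure \<Rightarrow> int \<Rightarrow> int \<Rightarrow> complex" where
  "bifree_moment \<mu>1 \<mu>2 p q =
     (let M = case_bool \<mu>1 \<mu>2;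
          U = left_op M True fst \<circ> left_op M False fst;
          U' = left_op M False (\<lambda>x. inverse (fst x)) \<circ> left_op M True (\<lambda>x. inverse (fst x));
          V = right_op M True snd \<circ> right_op M False snd;
          V' = right_op M False (\<lambda>x. inverse (snd x)) \<circ> right_op M True (\<lambda>x. inverse (snd x))
      in fp_inner M (op_powi U U' p (op_powi V V' q vacuum)) vacuum)"

text \<open>\<open>\<mu>\<close> is the bi-free multiplicative convolution of \<open>\<mu>1\<close> and \<open>\<mu>2\<close>. A measure on the torus is
  determined by its moments, so there is at most one such \<open>\<mu>\<close>; that there is one is the spectral
  theorem for the commuting unitaries \<open>u\<^sub>1u\<^sub>2\<close> and \<open>v\<^sub>1v\<^sub>2\<close>.\<close>

definition is_bifree_convolution ::
  "(complex \<times> complex) measure \<Rightarrow> (complex \<times> complex) measure \<Rightarrow>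
   (complex \<times> complex) measure \<Rightarrow> bool" where
  "is_bifree_convolution \<mu>1 \<mu>2 \<mu> \<longleftrightarrow>
     \<mu> \<in> torus_probs \<and>
     (\<forall>p q :: int. (LINT x|\<mu>. fst x powi p * snd x powi q) = bifree_moment \<mu>1 \<mu>2 p q)"


subsection \<open>Action on elementary tensors\<close>

text \<open>\<open>tensor hs\<close> is \<open>h\<^sub>1 \<otimes> ... \<otimes> h\<^sub>n\<close> for \<open>hs = [(i\<^sub>1, h\<^sub>1), ..., (i\<^sub>n, h\<^sub>n)]\<close>.\<close>

fun tensor :: "('i \<times> (complex \<times> complex \<Rightarrow> complex)) list \<Rightarrow> 'i fpvec" where
  "tensor [] [] = 1"
| "tensor ((i, h) # hs) ((j, x) # xs) = (if i = j then h x * tensor hs xs else 0)"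
| "tensor _ _ = 0"

lemma tensor_Nil: "tensor [] = vacuum"
proof
  fix xs :: "('i \<times> complex \<times> complex) list"
  show "tensor [] xs = vacuum xs" by (cases xs) (auto simp: vacuum_def)
qed

lemma tensor_nonzero_indices:
  assumes "tensor hs ys \<noteq> 0"
  shows "map fst ys = map fst hs"
  using assms by (induction hs ys rule: tensor.induct) (auto split: if_splits)

lemma fp_inner_vacuum: "fp_inner M f vacuum = f []"
proof -
  have "fp_inner M f vacuum = (\<Sum>\<^sub>\<infinity>w\<in>{[]}.
        LINT x|Pi\<^sub>M {..<length w} (\<lambda>k. M (w ! k)).
          f (zip w (map x [0..<length w])) * cnj (vacuum (zip w (map x [0..<length w]))))"
    unfolding fp_inner_def
  proof (rule infsum_cong_neutral)
    fix w :: "'a list"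
    assume "w \<in> {w. distinct_adj w} - {[]}"
    then have "zip w (map x [0..<length w]) \<noteq> []" for x :: "nat \<Rightarrow> complex \<times> complex"
      by (cases w) (auto simp: upt_rec)
    then show "(LINT x|Pi\<^sub>M {..<length w} (\<lambda>k. M (w ! k)).
          f (zip w (map x [0..<length w])) * cnj (vacuum (zip w (map x [0..<length w])))) = 0"
      by (simp add: vacuum_def)
  qed auto
  also have "\<dots> = (LINT x|Pi\<^sub>M {} (\<lambda>k. M ([] ! k)). f [])"
    by (simp add: vacuum_def)
  also have "\<dots> = f []"
    by (simp add: PiM_empty lebesgue_integral_count_space_finite)
  finally show ?thesis .
qed

context
  fixes M :: "'i \<Rightarrow> (complex \<times> complex) measure" and i :: 'i
    and a :: "complex \<times> complex \<Rightarrow> complex" and hs :: "('i \<times> (complex \<times> complex \<Rightarrow> complex)) list"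
begin

lemma left_op_tensor_other:
  assumes "hs \<noteq> [] \<Longrightarrow> fst (hd hs) \<noteq> i"
  shows "left_op M i a (tensor hs) =
    (\<lambda>zs. (LINT y|M i. a y) * tensor hs zs + tensor ((i, \<lambda>x. a x - (LINT y|M i. a y)) # hs) zs)"
proof
  fix zs
  have inv: "left_V_inv i (tensor hs) x ys = tensor hs ys" for x ys
  proof -
    have "tensor hs ((i, x) # ys) = 0"
      using tensor_nonzero_indices[of hs "(i, x) # ys"] assms by (cases hs) auto
    moreover have "tensor hs ys = 0" if "ys \<noteq> []" "fst (hd ys) = i"
      using tensor_nonzero_indices[of hs ys] assms that by (cases hs; cases ys) auto
    ultimately show ?thesis by (auto simp: left_V_inv_def)
  qed
  have "tensor hs zs = 0" if "zs \<noteq> []" "fst (hd zs) = i"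
    using tensor_nonzero_indices[of hs zs] assms that by (cases hs; cases zs) auto
  then show "left_op M i a (tensor hs) zs =
     (LINT y|M i. a y) * tensor hs zs + tensor ((i, \<lambda>x. a x - (LINT y|M i. a y)) # hs) zs"
    by (cases zs) (auto simp: left_op_def left_V_def inv algebra_simps)
qed

lemma left_op_tensor_same:
  assumes "hs \<noteq> [] \<Longrightarrow> fst (hd hs) \<noteq> i"
  shows "left_op M i a (tensor ((i, h) # hs)) =
    (\<lambda>zs. (LINT y|M i. a y * h y) * tensor hs zs
        + tensor ((i, \<lambda>x. a x * h x - (LINT y|M i. a y * h y)) # hs) zs)"
proof
  fix zs
  have z: "tensor hs ys = 0" if "ys \<noteq> []" "fst (hd ys) = i" for ys
    using tensor_nonzero_indices[of hs ys] assms that by (cases hs; cases ys) auto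
  have inv: "left_V_inv i (tensor ((i, h) # hs)) x ys = h x * tensor hs ys" for x ys
    using z by (cases ys) (auto simp: left_V_inv_def)
  show "left_op M i a (tensor ((i, h) # hs)) zs =
     (LINT y|M i. a y * h y) * tensor hs zs
        + tensor ((i, \<lambda>x. a x * h x - (LINT y|M i. a y * h y)) # hs) zs"
    using z[of zs]
    by (cases zs) (auto simp: left_op_def left_V_def inv mult.assoc[symmetric] left_diff_distrib)
qed

lemma tensor_snoc:
  "tensor (gs @ [(i, h)]) (ys @ [(j, x)]) = (if i = j then tensor gs ys * h x else 0)"
proof (induction gs ys rule: tensor.induct)
  case ("3_1" v va)
  then show ?case by (cases v; cases va) auto
next
  case ("3_2" v va)
  then show ?case by (cases v; cases va) auto
qed auto

lemma right_op_tensor_other: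
  assumes "hs \<noteq> [] \<Longrightarrow> fst (last hs) \<noteq> i"
  shows "right_op M i a (tensor hs) =
    (\<lambda>zs. (LINT y|M i. a y) * tensor hs zs + tensor (hs @ [(i, \<lambda>x. a x - (LINT y|M i. a y))]) zs)"
proof
  fix zs
  have z: "tensor hs ys = 0" if "ys \<noteq> []" "fst (last ys) = i" for ys
    using tensor_nonzero_indices[of hs ys] assms that
    by (metis last_map map_is_Nil_conv)
  have inv: "right_W_inv i (tensor hs) x ys = tensor hs ys" for x ys
    using z[of ys] z[of "ys @ [(i, x)]"] by (auto simp: right_W_inv_def)
  show "right_op M i a (tensor hs) zs =
     (LINT y|M i. a y) * tensor hs zs + tensor (hs @ [(i, \<lambda>x. a x - (LINT y|M i. a y))]) zs"
  proof (cases zs rule: rev_cases)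
    case Nil
    then show ?thesis
      using tensor_nonzero_indices[of "hs @ [(i, \<lambda>x. a x - (LINT y|M i. a y))]" "[]"]
      by (auto simp: right_op_def right_W_def inv)
  next
    case (snoc ys p)
    then show ?thesis
      using z[of zs] by (cases p) (auto simp: right_op_def right_W_def inv tensor_snoc algebra_simps)
  qed
qed

lemma right_op_tensor_same:
  assumes "hs \<noteq> [] \<Longrightarrow> fst (last hs) \<noteq> i"
  shows "right_op M i a (tensor (hs @ [(i, h)])) =
    (\<lambda>zs. (LINT y|M i. a y * h y) * tensor hs zs
        + tensor (hs @ [(i, \<lambda>x. a x * h x - (LINT y|M i. a y * h y))]) zs)"
proof
  fix zs
  have z: "tensor hs ys = 0" if "ys \<noteq> []" "fst (last ys) = i" for ys
    using tensor_nonzero_indices[of hs ys] assms that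
    by (metis last_map map_is_Nil_conv)
  have n: "tensor (hs @ [(i, k)]) ys = 0" if "\<not> (ys \<noteq> [] \<and> fst (last ys) = i)" for ys k
    using that tensor_nonzero_indices[of "hs @ [(i, k)]" ys]
    by (cases ys rule: rev_cases) auto
  have inv: "right_W_inv i (tensor (hs @ [(i, h)])) x ys = h x * tensor hs ys" for x ys
    using z[of ys] n[of ys h] by (auto simp: right_W_inv_def tensor_snoc)
  have I: "(LINT y|M i. a y * (h y * c)) = (LINT y|M i. a y * h y) * c" for c
    by (simp flip: mult.assoc)
  show "right_op M i a (tensor (hs @ [(i, h)])) zs =
     (LINT y|M i. a y * h y) * tensor hs zs
        + tensor (hs @ [(i, \<lambda>x. a x * h x - (LINT y|M i. a y * h y))]) zs"
  proof (cases zs rule: rev_cases)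
    case Nil
    then show ?thesis
      using n[of "[]"] by (simp add: right_op_def right_W_def inv I)
  next
    case (snoc ys p)
    obtain j x where p: "p = (j, x)" by (cases p)
    show ?thesis
      using z[of zs] n[of zs]
      by (simp add: right_op_def right_W_def inv I snoc p tensor_snoc algebra_simps)
  qed
qed

end

end

theory Submission
  imports Defs
begin

text \<open>
  Write \<open>u\<^sub>1u\<^sub>2\<close> and \<open>v\<^sub>1v\<^sub>2\<close> for the left and right unitaries. If \<open>\<zeta>\<close> is the common value of
  the functions \<open>eta\<close> of the first marginals at \<open>a\<^sub>1\<close> and \<open>a\<^sub>2\<close>, then at \<open>z = a\<^sub>1a\<^sub>2/\<zeta>\<close> the vector
  \<open>(1 - z u\<^sub>1u\<^sub>2)\<^sup>-\<^sup>1 \<xi>\<close> is explicit: up to a constant, its component at an alternating word is a power of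
  \<open>1/\<zeta>\<close> times a product of the centered functions \<open>g\<^sub>i = (1 - \<zeta>)/(1 - a\<^sub>i s) - 1\<close>, one for each letter.
  The same holds for \<open>(1 - w v\<^sub>1v\<^sub>2)\<^sup>-\<^sup>1 \<xi>\<close>, with parameters \<open>\<omega>\<close>, \<open>b\<^sub>i\<close> and functions \<open>f\<^sub>i\<close>. Pairing the two
  vectors gives a geometric series over alternating words, which sums to
  \<open>(1 + m\<^sub>1)(1 + m\<^sub>2)/(1 - m\<^sub>1m\<^sub>2/(\<zeta>\<omega>))\<close> with \<open>m\<^sub>i = \<integral> g\<^sub>i f\<^sub>i d\<mu>\<^sub>i\<close>. This is a closed formula for
  \<open>(1 - \<zeta>)(1 - \<omega>) H2 \<mu> z w\<close>, while \<open>1 + m\<^sub>i = (1 - \<zeta>)(1 - \<omega>) H2 \<mu>\<^sub>i a\<^sub>i b\<^sub>i\<close>. Since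
  \<open>\<zeta>\<omega> \<Sigma>\<^sub>i = (m\<^sub>i + \<zeta>\<omega>)/(1 + m\<^sub>i)\<close>, multiplicativity is an algebraic identity. The formulas are the same
  in the regions near zero and near infinity; there the series converge, and the identity theorem, applied to
  one variable at a time, extends the result to the whole domain.
\<close>

section \<open>Left and right operators on Lipschitz vectors\<close>

text \<open>Pairing with the vacuum is evaluation at the empty list, so all estimates can be made
  pointwise, in the sup norm over lists of torus points. The price is that one left or right
  operator has the bound 4 there instead of 1, hence \<open>U\<close>, \<open>V\<close> and their
  inverses the bound 16; this is why \<open>z\<close> has to have modulus below 1/16 or above 16.
  The explicit vector comes from one identity: multiplication by the coordinate turns
  \<open>1 + g i\<close> into \<open>(\<zeta> + g i) / c i\<close>. An operator applied to a vector
  that depends on one letter through \<open>1 + g i\<close> stays in the family, except that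
  constant parts pick up \<open>\<zeta>\<close>. The powers of \<open>1 / \<zeta>\<close> compensate
  this everywhere but at the empty word, and that defect is the source term of the resolvent
  equation. The equation and a growth bound over all integer powers determine the integrals, so
  small and large \<open>z\<close> are treated alike. Reflection in the circle,
  \<open>y \<mapsto> 1 / cnj y\<close>, carries the estimates from zero to infinity.\<close>

lemma (in prob_space) norm_integral_le:
  fixes h :: "'a \<Rightarrow> complex"
  assumes "\<And>x. x \<in> space M \<Longrightarrow> norm (h x) \<le> C" "C \<ge> 0"
  shows "norm (LINT x|M. h x) \<le> C"
proof (cases "integrable M h")
  case True
  have "norm (LINT x|M. h x) \<le> (LINT x|M. norm (h x))" by (rule integral_norm_bound)
  also have "\<dots> \<le> C"
    using True assms by (intro integral_le_const) auto
  finally show ?thesis .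
next
  case False
  then show ?thesis using assms by (simp add: not_integrable_integral_eq)
qed

section \<open>Bounded Lipschitz vectors and unimodular multipliers\<close>

definition torus :: "(complex \<times> complex) set" where
  "torus = sphere 0 1 \<times> sphere 0 1"

lemma compact_torus: "compact torus"
  by (simp add: torus_def compact_Times)

lemma torus_norm: "x \<in> torus \<Longrightarrow> norm (fst x) = 1 \<and> norm (snd x) = 1"
  by (auto simp: torus_def)

definition on_torus :: "('i \<times> complex \<times> complex) list \<Rightarrow> bool" where
  "on_torus xs \<longleftrightarrow> (\<forall>p\<in>set xs. snd p \<in> torus)"

lemma on_torus_simps [simp]:
  "on_torus []" "on_torus (p # xs) \<longleftrightarrow> snd p \<in> torus \<and> on_torus xs"
  "on_torus (xs @ ys) \<longleftrightarrow> on_torus xs \<and> on_torus ys" "on_torus (rev xs) \<longleftrightarrow> on_torus xs"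
  by (auto simp: on_torus_def)

definition starts_with :: "'i \<Rightarrow> ('i \<times> 'b) list \<Rightarrow> bool" where
  "starts_with i ys \<longleftrightarrow> ys \<noteq> [] \<and> fst (hd ys) = i"

lemma starts_with_simps [simp]:
  "\<not> starts_with i []" "starts_with i (p # ys) \<longleftrightarrow> fst p = i"
  by (auto simp: starts_with_def)

text \<open>Only indices matter, so a dummy point can replace a variable of integration when cases
  are distinguished outside the integral.\<close>

lemma starts_with_append_Cons: "starts_with i (us @ (k, x) # vs) \<longleftrightarrow> starts_with i (us @ [(k, y)])"
  by (cases us) auto

definition fbounded :: "'i fpvec \<Rightarrow> real \<Rightarrow> bool" where
  "fbounded f C \<longleftrightarrow> (\<forall>xs. on_torus xs \<longrightarrow> norm (f xs) \<le> C)"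

text \<open>One constant serves every position in lists of every length. Such bounds pass through
  integrals in the other variables and yield joint continuity, which is what Fubini asks
  for.\<close>

definition flipschitz :: "'i fpvec \<Rightarrow> real \<Rightarrow> bool" where
  "flipschitz f K \<longleftrightarrow>
     (\<forall>us i vs. on_torus us \<longrightarrow> on_torus vs \<longrightarrow> K-lipschitz_on torus (\<lambda>x. f (us @ (i, x) # vs)))"

definition regular :: "'i fpvec \<Rightarrow> bool" where
  "regular f \<longleftrightarrow> (\<exists>C. fbounded f C) \<and> (\<exists>K. flipschitz f K)"

text \<open>Values at lists with points off the torus are junk, so vectors are only compared on the torus.\<close>

definition fequiv :: "'i fpvec \<Rightarrow> 'i fpvec \<Rightarrow> bool"  (infix "\<doteq>" 50) where
  "f \<doteq> g \<longleftrightarrow> (\<forall>xs. on_torus xs \<longrightarrow> f xs = g xs)"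

text \<open>Covers the four multipliers of \<open>bifree_moment\<close>: the two coordinates and
  their inverses.\<close>

definition unimodular :: "(complex \<times> complex \<Rightarrow> complex) \<Rightarrow> bool" where
  "unimodular a \<longleftrightarrow> 1-lipschitz_on torus a \<and> (\<forall>x\<in>torus. norm (a x) = 1)"

lemma flipschitzD:
  "flipschitz f K \<Longrightarrow> on_torus us \<Longrightarrow> on_torus vs \<Longrightarrow> K-lipschitz_on torus (\<lambda>x. f (us @ (i, x) # vs))"
  by (simp add: flipschitz_def)

lemma fboundedD: "fbounded f C \<Longrightarrow> on_torus xs \<Longrightarrow> norm (f xs) \<le> C"
  by (simp add: fbounded_def)

lemma fbounded_nonneg: "fbounded f C \<Longrightarrow> C \<ge> 0"
  unfolding fbounded_def by (drule spec[of _ "[]"]) (auto intro: order_trans[OF norm_ge_zero])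

lemma flipschitz_nonneg: "flipschitz f K \<Longrightarrow> K \<ge> 0"
  using flipschitzD[of f K "[]" "[]"] by (auto dest: lipschitz_on_nonneg)

lemma flipschitz_Cons:
  assumes "flipschitz f K" "x \<in> torus"
  shows "flipschitz (\<lambda>ys. f ((i, x) # ys)) K"
  using flipschitzD[OF assms(1), of "(i, x) # _"] assms(2) by (simp add: flipschitz_def)

lemma fbounded_Cons: "fbounded f C \<Longrightarrow> x \<in> torus \<Longrightarrow> fbounded (\<lambda>ys. f ((i, x) # ys)) C"
  by (auto simp: fbounded_def)

lemma regularI: "fbounded f C \<Longrightarrow> flipschitz f K \<Longrightarrow> regular f"
  by (auto simp: regular_def)

lemma regularE:
  assumes "regular f"
  obtains C K where "fbounded f C" "flipschitz f K"
  using assms by (auto simp: regular_def)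

lemma regular_Cons: "regular f \<Longrightarrow> x \<in> torus \<Longrightarrow> regular (\<lambda>ys. f ((i, x) # ys))"
  by (erule regularE, rule regularI) (rule fbounded_Cons flipschitz_Cons, assumption+)+

lemma flipschitz_head:
  "flipschitz f K \<Longrightarrow> on_torus ys \<Longrightarrow> K-lipschitz_on torus (\<lambda>x. f ((i, x) # ys))"
  using flipschitzD[of f K "[]"] by simp

lemma regular_continuous:
  "regular f \<Longrightarrow> on_torus ys \<Longrightarrow> continuous_on torus (\<lambda>x. f ((i, x) # ys))"
  by (erule regularE) (rule lipschitz_on_continuous_on, rule flipschitz_head)

lemma unimodular_continuous: "unimodular a \<Longrightarrow> continuous_on torus a"
  unfolding unimodular_def by (auto intro: lipschitz_on_continuous_on)

lemma unimodular_fst: "unimodular fst"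
  unfolding unimodular_def
  by (intro conjI lipschitz_onI ballI) (simp_all add: dist_fst_le torus_norm)

lemma unimodular_snd: "unimodular snd"
  unfolding unimodular_def
  by (intro conjI lipschitz_onI ballI) (simp_all add: dist_snd_le torus_norm)

lemma inverse_dist_unit:
  fixes a b :: complex
  assumes "norm a = 1" "norm b = 1"
  shows "dist (inverse a) (inverse b) = dist a b"
proof -
  have "a \<noteq> 0" "b \<noteq> 0" using assms by auto
  then have "inverse a - inverse b = (b - a) * inverse a * inverse b" by (simp add: field_simps)
  then show ?thesis using assms by (simp add: dist_norm norm_mult norm_inverse norm_minus_commute)
qed

lemma unimodular_inverse: "unimodular a \<Longrightarrow> unimodular (\<lambda>x. inverse (a x))"
  unfolding unimodular_def
  by (auto intro!: lipschitz_onI simp: inverse_dist_unit norm_inverse dest: lipschitz_onD)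

lemma lipschitz_on_times:
  fixes f g :: "'a::metric_space \<Rightarrow> 'b::real_normed_algebra"
  assumes f: "K-lipschitz_on S f" "\<And>x. x \<in> S \<Longrightarrow> norm (f x) \<le> A"
    and g: "L-lipschitz_on S g" "\<And>x. x \<in> S \<Longrightarrow> norm (g x) \<le> B"
    and nonneg: "A \<ge> 0" "B \<ge> 0"
  shows "(A * L + K * B)-lipschitz_on S (\<lambda>x. f x * g x)"
proof (rule lipschitz_onI)
  fix x y assume x: "x \<in> S" and y: "y \<in> S"
  have "f x * g x - f y * g y = f x * (g x - g y) + (f x - f y) * g y" by (simp add: algebra_simps)
  then have "dist (f x * g x) (f y * g y) \<le> norm (f x) * dist (g x) (g y) + dist (f x) (f y) * norm (g y)"
    unfolding dist_norm by (metis norm_triangle_mono norm_mult_ineq)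
  also have "\<dots> \<le> A * (L * dist x y) + (K * dist x y) * B"
    using lipschitz_onD[OF f(1) x y] lipschitz_onD[OF g(1) x y] f(2)[OF x] g(2)[OF y] nonneg
      lipschitz_on_nonneg[OF f(1)] by (intro add_mono mult_mono) auto
  finally show "dist (f x * g x) (f y * g y) \<le> (A * L + K * B) * dist x y"
    by (simp add: algebra_simps)
qed (use nonneg lipschitz_on_nonneg[OF f(1)] lipschitz_on_nonneg[OF g(1)] in auto)

lemma lipschitz_on_const_times:
  fixes f :: "'a::metric_space \<Rightarrow> complex"
  assumes "K-lipschitz_on S f"
  shows "(norm c * K)-lipschitz_on S (\<lambda>x. c * f x)"
proof (rule lipschitz_onI)
  fix x y assume "x \<in> S" "y \<in> S"
  then have "norm c * dist (f x) (f y) \<le> norm c * (K * dist x y)"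
    using assms by (intro mult_left_mono lipschitz_onD) auto
  then show "dist (c * f x) (c * f y) \<le> norm c * K * dist x y"
    by (simp add: dist_norm mult.assoc flip: norm_mult right_diff_distrib)
qed (use lipschitz_on_nonneg[OF assms] in auto)

lemma unimodularD:
  assumes "unimodular a"
  shows "1-lipschitz_on torus a" "x \<in> torus \<Longrightarrow> norm (a x) = 1"
  using assms by (auto simp: unimodular_def)

section \<open>Integration over a family of torus measures\<close>

locale torus_family =
  fixes M :: "'i \<Rightarrow> (complex \<times> complex) measure"
  assumes torus_probs: "M i \<in> torus_probs"
begin

lemma prob_space_M: "prob_space (M i)"
  using torus_probs[of i] by (simp add: torus_probs_def)

lemma sets_M: "sets (M i) = sets (restrict_space borel torus)"
  using torus_probs[of i] by (simp add: torus_probs_def torus_borel_def torus_def)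

lemma space_M: "space (M i) = torus"
  using sets_eq_imp_space_eq[OF sets_M[of i]] by (simp add: space_restrict_space)

lemma measurable_continuous: "continuous_on torus h \<Longrightarrow> h \<in> borel_measurable (M i)"
  using borel_measurable_continuous_on_restrict[of torus h] measurable_cong_sets[OF sets_M[of i] refl]
  by blast

lemma integrable_continuous:
  fixes h :: "complex \<times> complex \<Rightarrow> complex"
  assumes "continuous_on torus h"
  shows "integrable (M i) h"
proof -
  interpret prob_space "M i" by (rule prob_space_M)
  have "bounded (h ` torus)"
    using assms compact_torus by (intro compact_imp_bounded compact_continuous_image)
  then obtain C where "\<And>x. x \<in> torus \<Longrightarrow> norm (h x) \<le> C" by (auto simp: bounded_iff)
  then show ?thesis
    using measurable_continuous[OF assms] by (intro integrable_const_bound[of _ C]) (auto simp: space_M)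
qed

lemma norm_integral_le:
  fixes h :: "complex \<times> complex \<Rightarrow> complex"
  assumes "\<And>x. x \<in> torus \<Longrightarrow> norm (h x) \<le> C" "C \<ge> 0"
  shows "norm (LINT x|M i. h x) \<le> C"
  using assms by (intro prob_space.norm_integral_le[OF prob_space_M]) (auto simp: space_M)

lemma norm_integral_diff_le:
  fixes h k :: "complex \<times> complex \<Rightarrow> complex"
  assumes "continuous_on torus h" "continuous_on torus k"
    and "\<And>x. x \<in> torus \<Longrightarrow> norm (h x - k x) \<le> C" "C \<ge> 0"
  shows "norm ((LINT x|M i. h x) - (LINT x|M i. k x)) \<le> C"
  using norm_integral_le[of "\<lambda>x. h x - k x" C i] assms
  by (simp add: Bochner_Integration.integral_diff integrable_continuous)

lemma integral_cong_torus:
  fixes h k :: "complex \<times> complex \<Rightarrow> complex"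
  shows "(\<And>x. x \<in> torus \<Longrightarrow> h x = k x) \<Longrightarrow> (LINT x|M i. h x) = (LINT x|M i. k x)"
  by (rule Bochner_Integration.integral_cong) (auto simp: space_M)

lemma integral_const [simp]: "(LINT x|M i. c) = (c :: complex)"
  using prob_space.prob_space[OF prob_space_M[of i]] by simp

lemma measure_space_M [simp]: "measure (M i) (space (M i)) = 1"
  using prob_space_M by (rule prob_space.prob_space)

lemma measurable_pair_continuous:
  fixes h :: "(complex \<times> complex) \<times> (complex \<times> complex) \<Rightarrow> complex"
  assumes "continuous_on (torus \<times> torus) h"
  shows "h \<in> borel_measurable (M i \<Otimes>\<^sub>M M j)"
proof -
  have id: "(\<lambda>x. x) \<in> borel_measurable (M k)" for k
    by (intro measurable_continuous continuous_on_id)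
  have "(\<lambda>p. (fst p, snd p)) \<in> M i \<Otimes>\<^sub>M M j \<rightarrow>\<^sub>M borel \<Otimes>\<^sub>M borel"
    using measurable_compose[OF measurable_fst id] measurable_compose[OF measurable_snd id]
    by (intro measurable_Pair) auto
  then have "(\<lambda>p. p) \<in> M i \<Otimes>\<^sub>M M j \<rightarrow>\<^sub>M restrict_space borel (torus \<times> torus)"
    by (intro measurable_restrict_space2) (auto simp: space_pair_measure space_M borel_prod)
  from measurable_compose[OF this borel_measurable_continuous_on_restrict[OF assms]]
  show ?thesis .
qed

text \<open>Lipschitz bounds in each variable, uniform in the other one, make \<open>P\<close>
  jointly Lipschitz on a compact set, hence measurable, bounded and integrable for the product
  measure.\<close>

lemma fubini_lipschitz:
  fixes P :: "complex \<times> complex \<Rightarrow> complex \<times> complex \<Rightarrow> complex"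
  assumes 1: "\<And>y. y \<in> torus \<Longrightarrow> K-lipschitz_on torus (\<lambda>x. P x y)"
    and 2: "\<And>x. x \<in> torus \<Longrightarrow> K'-lipschitz_on torus (P x)"
  shows "(LINT x|M i. LINT y|M j. P x y) = (LINT y|M j. LINT x|M i. P x y)"
proof -
  interpret i: prob_space "M i" by (rule prob_space_M)
  interpret j: prob_space "M j" by (rule prob_space_M)
  interpret pair_prob_space "M i" "M j" ..
  have K: "K \<ge> 0" "K' \<ge> 0"
  proof -
    have "(1, 1) \<in> torus" by (simp add: torus_def)
    then show "K \<ge> 0" "K' \<ge> 0" using 1 2 lipschitz_on_nonneg by blast+
  qed
  have "(K + K')-lipschitz_on (torus \<times> torus) (case_prod P)"
  proof (rule lipschitz_onI)
    fix p q assume "p \<in> torus \<times> torus" "q \<in> torus \<times> torus"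
    then obtain x y x' y' where [simp]: "p = (x, y)" "q = (x', y')"
      and T: "x \<in> torus" "y \<in> torus" "x' \<in> torus" "y' \<in> torus" by auto
    have "dist (P x y) (P x' y') \<le> dist (P x y) (P x' y) + dist (P x' y) (P x' y')"
      by (rule dist_triangle)
    also have "\<dots> \<le> K * dist x x' + K' * dist y y'"
      using lipschitz_onD[OF 1] lipschitz_onD[OF 2] T by (intro add_mono) auto
    also have "\<dots> \<le> K * dist p q + K' * dist p q"
      using K dist_fst_le[of p q] dist_snd_le[of p q] by (intro add_mono mult_left_mono) auto
    finally show "dist (case_prod P p) (case_prod P q) \<le> (K + K') * dist p q"
      by (simp add: algebra_simps)
  qed (use K in auto)
  then have c: "continuous_on (torus \<times> torus) (case_prod P)" by (rule lipschitz_on_continuous_on)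
  then have m: "case_prod P \<in> borel_measurable (M i \<Otimes>\<^sub>M M j)" by (rule measurable_pair_continuous)
  have "bounded (case_prod P ` (torus \<times> torus))"
    using c compact_torus by (intro compact_imp_bounded compact_continuous_image compact_Times)
  then obtain C where C: "\<And>p. p \<in> torus \<times> torus \<Longrightarrow> norm (case_prod P p) \<le> C"
    unfolding bounded_iff by blast
  have "integrable (M i \<Otimes>\<^sub>M M j) (case_prod P)"
    using m C by (intro P.integrable_const_bound[of _ C]) (auto simp: space_pair_measure space_M)
  from Fubini_integral[OF this] show ?thesis by simp
qed

section \<open>Nice vectors and their invariance under left operators\<close>

definition centered :: "'i fpvec \<Rightarrow> bool" where
  "centered f \<longleftrightarrow>
     (\<forall>us i vs. on_torus us \<longrightarrow> on_torus vs \<longrightarrow> (LINT x|M i. f (us @ (i, x) # vs)) = 0)"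

text \<open>Centering and vanishing on repeated indices are the conditions on components of a free
  product vector; the uniform bounds in \<open>regular\<close> take the place of square summability
  over words.\<close>

definition nice :: "'i fpvec \<Rightarrow> bool" where
  "nice f \<longleftrightarrow> regular f \<and> centered f \<and>
     (\<forall>xs. on_torus xs \<longrightarrow> \<not> distinct_adj (map fst xs) \<longrightarrow> f xs = 0)"

text \<open>The mean that \<open>left_V\<close> splits off: it is the value of
  \<open>left_op\<close> at words not starting with \<open>i\<close> and is subtracted after a
  leading \<open>i\<close>. The value 0 comes from the corresponding case of
  \<open>left_V_inv\<close>.\<close>

definition avg :: "'i \<Rightarrow> (complex \<times> complex \<Rightarrow> complex) \<Rightarrow> 'i fpvec \<Rightarrow> 'i fpvec" where
  "avg i a f ys =
     (if starts_with i ys then 0 else (LINT y|M i. a y * (f ((i, y) # ys) + f ys)))"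

lemma left_op_avg: "\<not> starts_with i ys \<Longrightarrow> left_op M i a f ys = avg i a f ys"
  by (auto simp: left_op_def left_V_def left_V_inv_def avg_def starts_with_def)

lemma left_op_Cons:
  "left_op M i a f ((i, x) # ys) =
     (if starts_with i ys then 0 else a x * (f ((i, x) # ys) + f ys)) - avg i a f ys"
  by (auto simp: left_op_def left_V_def left_V_inv_def avg_def starts_with_def)

lemma avg_continuous:
  assumes "unimodular a" "regular f" "on_torus ys"
  shows "continuous_on torus (\<lambda>y. a y * (f ((i, y) # ys) + f ys))"
  using assms by (intro continuous_intros unimodular_continuous regular_continuous)

lemma avg_bounded:
  assumes a: "unimodular a" and f: "fbounded f C"
  shows "fbounded (avg i a f) (2 * C)"
proof -
  have C: "C \<ge> 0" using f by (rule fbounded_nonneg)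
  have "norm (avg i a f ys) \<le> 2 * C" if "on_torus ys" for ys
  proof (cases "starts_with i ys")
    case True
    then show ?thesis using C by (simp add: avg_def)
  next
    case False
    have "norm (a y * (f ((i, y) # ys) + f ys)) \<le> 2 * C" if "y \<in> torus" for y
    proof -
      have "norm (f ((i, y) # ys) + f ys) \<le> C + C"
        using f that \<open>on_torus ys\<close> by (intro norm_triangle_mono fboundedD[OF f]) auto
      then show ?thesis using a that by (simp add: unimodular_def norm_mult)
    qed
    then show ?thesis using False C by (auto simp: avg_def intro!: norm_integral_le)
  qed
  then show ?thesis by (simp add: fbounded_def)
qed

lemma avg_flipschitz:
  assumes a: "unimodular a" and f: "regular f" "flipschitz f K"
  shows "flipschitz (avg i a f) (2 * K)"
  unfolding flipschitz_def
proof (intro allI impI lipschitz_onI)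
  fix us vs :: "('i \<times> complex \<times> complex) list" and k x y
  assume us: "on_torus us" and vs: "on_torus vs" and x: "x \<in> torus" and y: "y \<in> torus"
  let ?l = "\<lambda>x. us @ (k, x) # vs"
  have K: "K \<ge> 0" using f(2) by (rule flipschitz_nonneg)
  show "dist (avg i a f (?l x)) (avg i a f (?l y)) \<le> 2 * K * dist x y"
  proof (cases "starts_with i (?l x)")
    case True
    then have "starts_with i (?l y)" using starts_with_append_Cons by metis
    then show ?thesis using True K by (simp add: avg_def)
  next
    case False
    then have "\<not> starts_with i (?l y)" using starts_with_append_Cons by metis
    then have eq: "dist (avg i a f (?l x)) (avg i a f (?l y)) =
        norm ((LINT t|M i. a t * (f ((i, t) # ?l x) + f (?l x))) -
              (LINT t|M i. a t * (f ((i, t) # ?l y) + f (?l y))))"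
      using False by (simp add: avg_def dist_norm)
    have "norm (a t * (f ((i, t) # ?l x) + f (?l x)) - a t * (f ((i, t) # ?l y) + f (?l y)))
        \<le> 2 * K * dist x y" if t: "t \<in> torus" for t
    proof -
      have "K-lipschitz_on torus (\<lambda>x. f (((i, t) # us) @ (k, x) # vs))"
        using us vs t by (intro flipschitzD f(2)) auto
      from lipschitz_onD[OF this x y]
      have 1: "norm (f ((i, t) # ?l x) - f ((i, t) # ?l y)) \<le> K * dist x y" by (simp add: dist_norm)
      have "K-lipschitz_on torus (\<lambda>x. f (us @ (k, x) # vs))"
        using us vs by (intro flipschitzD f(2))
      from lipschitz_onD[OF this x y]
      have 2: "norm (f (?l x) - f (?l y)) \<le> K * dist x y" by (simp add: dist_norm)
      have "norm (a t * (f ((i, t) # ?l x) + f (?l x)) - a t * (f ((i, t) # ?l y) + f (?l y)))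
         = norm (a t) * norm ((f ((i, t) # ?l x) - f ((i, t) # ?l y)) + (f (?l x) - f (?l y)))"
        by (simp add: algebra_simps flip: norm_mult)
      also have "\<dots> \<le> 1 * (K * dist x y + K * dist x y)"
        using 1 2 a t unfolding unimodular_def by (intro mult_mono norm_triangle_mono) auto
      finally show ?thesis by simp
    qed
    then show ?thesis
      unfolding eq using K x y us vs by (intro norm_integral_diff_le avg_continuous a f(1)) auto
  qed
qed (use flipschitz_nonneg[OF f(2)] in auto)

lemma avg_regular: "unimodular a \<Longrightarrow> regular f \<Longrightarrow> regular (avg i a f)"
  by (erule regularE, rule regularI) (auto intro: avg_bounded avg_flipschitz regularI)

text \<open>At a word with leading \<open>i\<close> the result is a sum of two values of
  \<open>f\<close>, times a unimodular factor, minus an average of such sums; each part is at most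
  \<open>2 * C\<close>. Two such operators make up \<open>U\<close>, which gives the constant 16
  later on.\<close>

lemma left_op_bounded:
  assumes a: "unimodular a" and f: "fbounded f C"
  shows "fbounded (left_op M i a f) (4 * C)"
  unfolding fbounded_def
proof (intro allI impI)
  fix xs :: "('i \<times> complex \<times> complex) list" assume xs: "on_torus xs"
  have C: "C \<ge> 0" using f by (rule fbounded_nonneg)
  have avg: "norm (avg i a f ys) \<le> 2 * C" if "on_torus ys" for ys
    using avg_bounded[OF a f, of i] that by (simp add: fbounded_def)
  show "norm (left_op M i a f xs) \<le> 4 * C"
  proof (cases "starts_with i xs")
    case False
    then show ?thesis using avg[OF xs] C by (simp add: left_op_avg)
  next
    case True
    then obtain x ys where xs_eq: "xs = (i, x) # ys"
      by (cases xs) auto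
    have "norm (f ((i, x) # ys) + f ys) \<le> C + C"
      using f xs unfolding xs_eq by (intro norm_triangle_mono fboundedD[OF f]) auto
    then have "norm (a x * (f ((i, x) # ys) + f ys)) \<le> 2 * C"
      using a xs by (simp add: unimodular_def norm_mult xs_eq)
    then have "norm (if starts_with i ys then 0 else a x * (f ((i, x) # ys) + f ys)) \<le> 2 * C"
      using C by simp
    moreover have "norm (avg i a f ys) \<le> 2 * C" using avg xs xs_eq by simp
    ultimately show ?thesis unfolding xs_eq left_op_Cons
      by (intro order_trans[OF norm_triangle_ineq4]) linarith
  qed
qed

text \<open>The summand \<open>2 * C\<close> is the variation of the multiplier \<open>a\<close>,
  which occurs only when the varied letter is the leading \<open>i\<close>.\<close>

lemma left_op_flipschitz:
  assumes a: "unimodular a" and f: "regular f" "fbounded f C" "flipschitz f K"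
  shows "flipschitz (left_op M i a f) (2 * C + 4 * K)"
  unfolding flipschitz_def
proof (intro allI impI)
  fix us vs :: "('i \<times> complex \<times> complex) list" and k
  assume us: "on_torus us" and vs: "on_torus vs"
  have C: "C \<ge> 0" using f(2) by (rule fbounded_nonneg)
  have K: "K \<ge> 0" using f(3) by (rule flipschitz_nonneg)
  have avgL: "(2 * K)-lipschitz_on torus (\<lambda>x. avg i a f (us @ (k, x) # vs))" if "on_torus us" for us
    using vs that by (intro flipschitzD avg_flipschitz a f)
  have fL: "K-lipschitz_on torus (\<lambda>x. f (us @ (k, x) # vs))" if "on_torus us" for us
    using vs that by (intro flipschitzD f)
  \<comment> \<open>The varied letter stands behind a leading \<open>i\<close>, is itself the
    leading \<open>i\<close>, or belongs to a word that does not start with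
    \<open>i\<close>.\<close>
  consider "starts_with i us" | "us = []" "k = i" | "\<not> starts_with i (us @ [(k, 0)])"
    by (cases us) auto
  then show "(2 * C + 4 * K)-lipschitz_on torus (\<lambda>x. left_op M i a f (us @ (k, x) # vs))"
  proof cases
    case 1
    then obtain y us' where us_eq: "us = (i, y) # us'" by (cases us) auto
    have T: "y \<in> torus" "on_torus us'" using us by (auto simp: us_eq)
    let ?s = "starts_with i (us' @ [(k, 0)])"
    have sw: "starts_with i (us' @ (k, x) # vs) = ?s" for x by (rule starts_with_append_Cons)
    have L: "K-lipschitz_on torus (\<lambda>x. f ((i, y) # us' @ (k, x) # vs))"
      "K-lipschitz_on torus (\<lambda>x. f (us' @ (k, x) # vs))"
      using fL[of us] fL[of us'] us T by (auto simp: us_eq)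
    have "((if ?s then 0 else norm (a y) * (K + K)) + 2 * K)-lipschitz_on torus
      (\<lambda>x. (if ?s then 0 else a y * (f ((i, y) # us' @ (k, x) # vs) + f (us' @ (k, x) # vs)))
           - avg i a f (us' @ (k, x) # vs))"
    proof (rule lipschitz_on_diff[OF _ avgL[OF T(2)]], cases ?s)
      case False
      then show "(if ?s then 0 else norm (a y) * (K + K))-lipschitz_on torus
        (\<lambda>x. if ?s then 0 else a y * (f ((i, y) # us' @ (k, x) # vs) + f (us' @ (k, x) # vs)))"
        unfolding if_not_P[OF False] by (intro lipschitz_on_const_times lipschitz_on_add L)
    qed (simp add: lipschitz_on_constant)
    then have "(2 * C + 4 * K)-lipschitz_on torus
      (\<lambda>x. (if ?s then 0 else a y * (f ((i, y) # us' @ (k, x) # vs) + f (us' @ (k, x) # vs)))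
           - avg i a f (us' @ (k, x) # vs))"
      by (rule lipschitz_on_mono) (use C K unimodularD(2)[OF a T(1)] in auto)
    then show ?thesis
      by (simp add: us_eq left_op_Cons sw)
  next
    case 2
    have "norm (f ((i, x) # vs) + f vs) \<le> C + C" if "x \<in> torus" for x
      using vs that by (intro norm_triangle_mono fboundedD[OF f(2)]) auto
    then have "(1 * (K + 0) + 1 * (C + C))-lipschitz_on torus (\<lambda>x. a x * (f ((i, x) # vs) + f vs))"
      using C unimodularD[OF a]
      by (intro lipschitz_on_times lipschitz_on_add flipschitz_head[OF f(3) vs] lipschitz_on_constant) auto
    then have "(1 * (K + 0) + 1 * (C + C) + 0)-lipschitz_on torus
        (\<lambda>x. a x * (f ((i, x) # vs) + f vs) - avg i a f vs)"
      by (rule lipschitz_on_diff) (rule lipschitz_on_constant)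
    then have L: "(2 * C + 4 * K)-lipschitz_on torus (\<lambda>x. a x * (f ((i, x) # vs) + f vs) - avg i a f vs)"
      by (rule lipschitz_on_mono) (use C K in auto)
    have "(2 * C + 4 * K)-lipschitz_on torus (\<lambda>x. 0 - avg i a f vs)"
      by (rule lipschitz_on_mono[OF lipschitz_on_constant]) (use C K in auto)
    with L show ?thesis
      by (cases "starts_with i vs") (simp_all add: 2 left_op_Cons)
  next
    case 3
    then have "\<not> starts_with i (us @ (k, x) # vs)" for x by (metis starts_with_append_Cons)
    then show ?thesis
      using lipschitz_on_mono[OF avgL[OF us]] C K by (simp add: left_op_avg)
  qed
qed

lemma left_op_regular: "unimodular a \<Longrightarrow> regular f \<Longrightarrow> regular (left_op M i a f)"
  by (erule regularE, rule regularI) (auto intro: left_op_bounded left_op_flipschitz regularI)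

text \<open>By Fubini the integral in the letter \<open>k\<close> moves inside the average, where it
  annihilates both summands because \<open>f\<close> is centered.\<close>

lemma centered_avg:
  assumes a: "unimodular a" and f: "nice f" and us: "on_torus us" "on_torus vs"
  shows "(LINT x|M k. avg i a f (us @ (k, x) # vs)) = 0"
proof (cases "starts_with i (us @ [(k, 0)])")
  case True
  then have "starts_with i (us @ (k, x) # vs)" for x using starts_with_append_Cons by metis
  then show ?thesis by (simp add: avg_def)
next
  case False
  then have ns: "\<not> starts_with i (us @ (k, x) # vs)" for x using starts_with_append_Cons by metis
  obtain C K where C: "fbounded f C" and K: "flipschitz f K"
    using f unfolding nice_def by (auto elim: regularE)
  have cent: "(LINT x|M k. f (us' @ (k, x) # vs)) = 0" if "on_torus us'" for us'
    using f us that by (simp add: nice_def centered_def)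
  let ?P = "\<lambda>x t. a t * (f (((i, t) # us) @ (k, x) # vs) + f (us @ (k, x) # vs))"
  have "(LINT x|M k. avg i a f (us @ (k, x) # vs)) = (LINT x|M k. LINT t|M i. ?P x t)"
    using ns by (simp add: avg_def)
  also have "\<dots> = (LINT t|M i. LINT x|M k. ?P x t)"
  proof (rule fubini_lipschitz[where K = "1 * (K + K)" and K' = "1 * (K + 0) + 1 * (C + C)"])
    fix t assume t: "t \<in> torus"
    then have "(norm (a t) * (K + K))-lipschitz_on torus (\<lambda>x. ?P x t)"
      using us by (intro lipschitz_on_const_times lipschitz_on_add flipschitzD[OF K]) auto
    then show "(1 * (K + K))-lipschitz_on torus (\<lambda>x. ?P x t)"
      using unimodularD(2)[OF a t] by simp
  next
    fix x assume x: "x \<in> torus"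
    show "(1 * (K + 0) + 1 * (C + C))-lipschitz_on torus (?P x)"
      using unimodularD[OF a] fbounded_nonneg[OF C] us x
      unfolding append_Cons
      by (intro lipschitz_on_times lipschitz_on_add flipschitz_head[OF K] lipschitz_on_constant
          norm_triangle_mono fboundedD[OF C]) auto
  qed
  also have "\<dots> = (LINT t|M i. 0)"
  proof (rule integral_cong_torus)
    fix t assume t: "t \<in> torus"
    have "continuous_on torus (\<lambda>x. f (us' @ (k, x) # vs))" if "on_torus us'" for us'
      using lipschitz_on_continuous_on[OF flipschitzD[OF K that us(2)]] .
    then show "(LINT x|M k. ?P x t) = 0"
      using cent[of us] cent[of "(i, t) # us"] us t
      by (simp add: Bochner_Integration.integral_add integrable_continuous del: append_Cons)
  qed
  finally show ?thesis by simp
qed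

lemma centered_left_op:
  assumes a: "unimodular a" and f: "nice f"
  shows "centered (left_op M i a f)"
  unfolding centered_def
proof (intro allI impI)
  fix us vs :: "('i \<times> complex \<times> complex) list" and k
  assume us: "on_torus us" "on_torus vs"
  have r: "regular f" using f by (simp add: nice_def)
  have cont: "continuous_on torus (\<lambda>x. h (us @ (k, x) # vs))" if "regular h" "on_torus us" for h us
    using that us(2) by (auto elim!: regularE intro: lipschitz_on_continuous_on flipschitzD)
  have cent: "(LINT x|M k. f (us @ (k, x) # vs)) = 0" if "on_torus us" for us
    using f us that by (simp add: nice_def centered_def)
  consider "starts_with i us" | "us = []" "k = i" | "\<not> starts_with i (us @ [(k, 0)])"
    by (cases us) auto
  then show "(LINT x|M k. left_op M i a f (us @ (k, x) # vs)) = 0"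
  proof cases
    case 1
    then obtain y us' where us_eq: "us = (i, y) # us'" by (cases us) auto
    have T: "y \<in> torus" "on_torus us'" using us by (auto simp: us_eq)
    have c: "continuous_on torus (\<lambda>x. f ((i, y) # us' @ (k, x) # vs))"
      "(LINT x|M k. f ((i, y) # us' @ (k, x) # vs)) = 0"
      using cont[of f us] cent[of us] r us by (simp_all add: us_eq)
    let ?s = "starts_with i (us' @ [(k, 0)])"
    have sw: "starts_with i (us' @ (k, x) # vs) = ?s" for x by (rule starts_with_append_Cons)
    show ?thesis
      using c cent[OF T(2)] cont[OF r T(2)] cont[OF avg_regular[OF a r] T(2)]
        centered_avg[OF a f T(2) us(2)]
      by (cases ?s) (simp_all add: us_eq left_op_Cons sw Bochner_Integration.integral_add
          Bochner_Integration.integral_diff integrable_continuous continuous_intros)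
  next
    case 2
    have "(LINT x|M i. a x * (f ((i, x) # vs) + f vs) - avg i a f vs) = 0" if "\<not> starts_with i vs"
      using that avg_continuous[OF a r us(2)]
      by (simp add: avg_def Bochner_Integration.integral_diff integrable_continuous)
    then show ?thesis
      by (cases "starts_with i vs") (simp_all add: 2 left_op_Cons, simp add: avg_def)
  next
    case 3
    then have "\<not> starts_with i (us @ (k, x) # vs)" for x by (metis starts_with_append_Cons)
    then show ?thesis using centered_avg[OF a f us] by (simp add: left_op_avg)
  qed
qed

lemma nice_zero: "nice f \<Longrightarrow> on_torus xs \<Longrightarrow> \<not> distinct_adj (map fst xs) \<Longrightarrow> f xs = 0"
  by (simp add: nice_def)

lemma nice_regular: "nice f \<Longrightarrow> regular f"
  by (simp add: nice_def)

lemma nice_left_op: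
  assumes a: "unimodular a" and f: "nice f"
  shows "nice (left_op M i a f)"
  unfolding nice_def
proof (intro conjI allI impI)
  fix xs :: "('i \<times> complex \<times> complex) list"
  assume xs: "on_torus xs" and n: "\<not> distinct_adj (map fst xs)"
  have avg0: "avg i a f ys = 0" if "on_torus ys" "\<not> distinct_adj (map fst ys)" for ys
  proof -
    have "\<not> distinct_adj (map fst ((i, y) # ys))" for y using that by (cases ys) auto
    then have "(LINT y|M i. a y * (f ((i, y) # ys) + f ys)) = (LINT y|M i. 0)"
      using that by (intro integral_cong_torus) (simp add: nice_zero[OF f])
    then show ?thesis by (simp add: avg_def)
  qed
  show "left_op M i a f xs = 0"
  proof (cases "starts_with i xs")
    case False
    then show ?thesis using avg0[OF xs n] by (simp add: left_op_avg)
  next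
    case True
    then obtain x ys where xs_eq: "xs = (i, x) # ys" by (cases xs) auto
    show ?thesis
    proof (cases "starts_with i ys")
      case True
      then show ?thesis by (simp add: xs_eq left_op_Cons avg_def)
    next
      case False
      then have "\<not> distinct_adj (map fst ys)" using n by (cases ys) (auto simp: xs_eq)
      then show ?thesis
        using xs n avg0[of ys] False nice_zero[OF f xs n] nice_zero[OF f, of ys]
        by (simp add: xs_eq left_op_Cons)
    qed
  qed
qed (use assms in \<open>auto intro: left_op_regular centered_left_op nice_regular\<close>)

lemma avg_cong:
  assumes "f \<doteq> g" "on_torus ys"
  shows "avg i a f ys = avg i a g ys"
proof -
  have "(LINT y|M i. a y * (f ((i, y) # ys) + f ys)) = (LINT y|M i. a y * (g ((i, y) # ys) + g ys))"
    using assms by (intro integral_cong_torus) (simp add: fequiv_def)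
  then show ?thesis by (simp add: avg_def)
qed

lemma left_op_cong:
  assumes "f \<doteq> g"
  shows "left_op M i a f \<doteq> left_op M i a g"
  unfolding fequiv_def
proof (intro allI impI)
  fix xs :: "('i \<times> complex \<times> complex) list" assume xs: "on_torus xs"
  show "left_op M i a f xs = left_op M i a g xs"
  proof (cases "starts_with i xs")
    case False
    then show ?thesis using avg_cong[OF assms xs] by (simp add: left_op_avg)
  next
    case True
    then obtain x ys where "xs = (i, x) # ys" by (cases xs) auto
    then show ?thesis using xs assms avg_cong[OF assms, of ys] by (simp add: left_op_Cons fequiv_def)
  qed
qed

lemma avg_linear:
  assumes "unimodular a" "regular f" "regular g" "on_torus ys"
  shows "avg i a (\<lambda>xs. c * f xs + d * g xs) ys = c * avg i a f ys + d * avg i a g ys"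
proof -
  have "(LINT y|M i. a y * ((c * f ((i, y) # ys) + d * g ((i, y) # ys)) + (c * f ys + d * g ys))) =
    (LINT y|M i. c * (a y * (f ((i, y) # ys) + f ys)) + d * (a y * (g ((i, y) # ys) + g ys)))"
    by (simp add: algebra_simps)
  also have "\<dots> = c * (LINT y|M i. a y * (f ((i, y) # ys) + f ys)) +
      d * (LINT y|M i. a y * (g ((i, y) # ys) + g ys))"
    using avg_continuous[OF assms(1,2,4), of i] avg_continuous[OF assms(1,3,4), of i]
    by (simp add: Bochner_Integration.integral_add integrable_continuous continuous_intros)
  finally show ?thesis by (simp add: avg_def)
qed

lemma left_op_linear:
  assumes "unimodular a" "regular f" "regular g"
  shows "left_op M i a (\<lambda>xs. c * f xs + d * g xs) \<doteq>
    (\<lambda>xs. c * left_op M i a f xs + d * left_op M i a g xs)"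
  unfolding fequiv_def
proof (intro allI impI)
  fix xs :: "('i \<times> complex \<times> complex) list" assume xs: "on_torus xs"
  show "left_op M i a (\<lambda>xs. c * f xs + d * g xs) xs = c * left_op M i a f xs + d * left_op M i a g xs"
  proof (cases "starts_with i xs")
    case False
    then show ?thesis using avg_linear[OF assms xs] by (simp add: left_op_avg)
  next
    case True
    then obtain x ys where "xs = (i, x) # ys" by (cases xs) auto
    then show ?thesis using xs avg_linear[OF assms, of ys] by (simp add: left_op_Cons algebra_simps)
  qed
qed

text \<open>The operator multiplies the sum of the values at \<open>(i, x) # ys\<close> and
  \<open>ys\<close> by \<open>a x\<close>, and \<open>b x\<close> undoes this. Centering of
  \<open>f\<close> then separates the two values again; at words with two leading letters
  \<open>i\<close> both sides are 0 because \<open>f\<close> is nice.\<close>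

lemma left_op_inverse:
  assumes f: "nice f" and ab: "\<And>x. x \<in> torus \<Longrightarrow> b x * a x = 1"
  shows "left_op M i b (left_op M i a f) \<doteq> f"
  unfolding fequiv_def
proof (intro allI impI)
  fix xs :: "('i \<times> complex \<times> complex) list" assume xs: "on_torus xs"
  let ?h = "left_op M i a f"
  have h: "?h ((i, x) # ys) + ?h ys = a x * (f ((i, x) # ys) + f ys)" if "\<not> starts_with i ys" for x ys
    using that by (simp add: left_op_Cons left_op_avg)
  have b: "b x * (?h ((i, x) # ys) + ?h ys) = f ((i, x) # ys) + f ys"
    if "\<not> starts_with i ys" "x \<in> torus" for x ys
    unfolding h[OF that(1)] by (simp add: ab[OF that(2)] flip: mult.assoc)
  have avg: "avg i b ?h ys = (if starts_with i ys then 0 else f ys)" if ys: "on_torus ys" for ys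
  proof (cases "starts_with i ys")
    case False
    have "avg i b ?h ys = (LINT y|M i. f ((i, y) # ys) + f ys)"
      using False b by (simp add: avg_def cong: integral_cong_torus)
    also have "\<dots> = (LINT y|M i. f ([] @ (i, y) # ys)) + f ys"
      using regular_continuous[OF nice_regular[OF f] ys]
      by (simp add: Bochner_Integration.integral_add integrable_continuous)
    also have "(LINT y|M i. f ([] @ (i, y) # ys)) = 0"
      using f ys unfolding nice_def centered_def by (metis on_torus_simps(1))
    finally show ?thesis using False by simp
  qed (simp add: avg_def)
  show "left_op M i b ?h xs = f xs"
  proof (cases "starts_with i xs")
    case False
    then show ?thesis using avg[OF xs] by (simp add: left_op_avg)
  next
    case True
    then obtain x ys where xs_eq: "xs = (i, x) # ys" by (cases xs) auto
    have "f xs = 0" if "starts_with i ys"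
      using that xs by (intro nice_zero[OF f]) (cases ys; auto simp: xs_eq)+
    then show ?thesis using b[of ys x] avg[of ys] xs by (auto simp: xs_eq left_op_Cons[of i b])
  qed
qed

section \<open>Operators on nice vectors: products, reversal of words, integer powers\<close>

definition good_op :: "real \<Rightarrow> ('i fpvec \<Rightarrow> 'i fpvec) \<Rightarrow> bool" where
  "good_op K T \<longleftrightarrow> K \<ge> 0 \<and>
     (\<forall>f. nice f \<longrightarrow> nice (T f)) \<and>
     (\<forall>f g. f \<doteq> g \<longrightarrow> T f \<doteq> T g) \<and>
     (\<forall>f g c d. nice f \<longrightarrow> nice g \<longrightarrow> T (\<lambda>xs. c * f xs + d * g xs) \<doteq> (\<lambda>xs. c * T f xs + d * T g xs)) \<and>
     (\<forall>f C. fbounded f C \<longrightarrow> fbounded (T f) (K * C))"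

lemma good_opD:
  assumes "good_op K T"
  shows "nice f \<Longrightarrow> nice (T f)" "f \<doteq> g \<Longrightarrow> T f \<doteq> T g"
    "nice f \<Longrightarrow> nice g \<Longrightarrow> T (\<lambda>xs. c * f xs + d * g xs) \<doteq> (\<lambda>xs. c * T f xs + d * T g xs)"
    "fbounded f C \<Longrightarrow> fbounded (T f) (K * C)" "K \<ge> 0"
  using assms unfolding good_op_def by blast+

lemma fequiv_trans [trans]: "f \<doteq> g \<Longrightarrow> g \<doteq> h \<Longrightarrow> f \<doteq> h"
  by (simp add: fequiv_def)

lemma fequiv_refl [simp]: "f \<doteq> f"
  by (simp add: fequiv_def)

lemma fequiv_rev: "f \<doteq> g \<Longrightarrow> (\<lambda>xs. f (rev xs)) \<doteq> (\<lambda>xs. g (rev xs))"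
  by (simp add: fequiv_def)

lemma good_op_id: "good_op 1 (\<lambda>f. f)"
  by (auto simp: good_op_def)

lemma good_op_comp:
  assumes S: "good_op K S" and T: "good_op L T"
  shows "good_op (K * L) (S \<circ> T)"
  unfolding good_op_def o_apply
proof (intro conjI allI impI)
  fix f g :: "'i fpvec" and c d assume f: "nice f" "nice g"
  have "S (T (\<lambda>xs. c * f xs + d * g xs)) \<doteq> S (\<lambda>xs. c * T f xs + d * T g xs)"
    by (intro good_opD(2)[OF S] good_opD(3)[OF T] f)
  also have "\<dots> \<doteq> (\<lambda>xs. c * S (T f) xs + d * S (T g) xs)"
    by (intro good_opD(3)[OF S] good_opD(1)[OF T] f)
  finally show "S (T (\<lambda>xs. c * f xs + d * g xs)) \<doteq> (\<lambda>xs. c * S (T f) xs + d * S (T g) xs)" .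
next
  fix f :: "'i fpvec" and C assume "fbounded f C"
  then have "fbounded (S (T f)) (K * (L * C))" by (intro good_opD(4)[OF S] good_opD(4)[OF T])
  then show "fbounded (S (T f)) (K * L * C)" by (simp add: mult.assoc)
qed (auto simp: good_opD(5)[OF S] good_opD(5)[OF T] intro: good_opD[OF S] good_opD[OF T])

lemma good_op_left: "unimodular a \<Longrightarrow> good_op 4 (left_op M i a)"
  unfolding good_op_def
  by (auto intro: nice_left_op left_op_cong left_op_linear left_op_bounded nice_regular)

text \<open>Reversing words exchanges \<open>V\<^sub>i\<close> and \<open>W\<^sub>i\<close>, so the
  facts about right operators are transported from left ones.\<close>

lemma right_op_rev: "right_op M i a f (rev zs) = left_op M i a (\<lambda>xs. f (rev xs)) zs"
proof -
  have inv: "right_W_inv i f x (rev ys) = left_V_inv i (\<lambda>xs. f (rev xs)) x ys" for x ys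
    by (simp add: right_W_inv_def left_V_inv_def last_rev)
  then show ?thesis
    using inv[of _ "[]"]
    by (simp add: right_op_def left_op_def right_W_def left_V_def last_rev butlast_rev)
qed

lemma right_op_eq: "right_op M i a f = (\<lambda>xs. left_op M i a (\<lambda>xs. f (rev xs)) (rev xs))"
  using right_op_rev[of i a f "rev _"] by auto

lemma fbounded_rev: "fbounded f C \<Longrightarrow> fbounded (\<lambda>xs. f (rev xs)) C"
  by (simp add: fbounded_def)

lemma nice_rev:
  assumes "nice f"
  shows "nice (\<lambda>xs. f (rev xs))"
  unfolding nice_def
proof (intro conjI allI impI)
  obtain C K where C: "fbounded f C" and K: "flipschitz f K"
    using nice_regular[OF assms] by (rule regularE)
  have "flipschitz (\<lambda>xs. f (rev xs)) K"
    unfolding flipschitz_def using flipschitzD[OF K, of "rev _" "rev _"] by simp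
  with C show "regular (\<lambda>xs. f (rev xs))" by (intro regularI fbounded_rev)
  show "centered (\<lambda>xs. f (rev xs))"
    using assms by (simp add: nice_def centered_def)
next
  fix xs :: "('i \<times> complex \<times> complex) list" assume "on_torus xs" "\<not> distinct_adj (map fst xs)"
  then show "f (rev xs) = 0" by (intro nice_zero[OF assms]) (auto simp: rev_map[symmetric])
qed

lemma good_op_right:
  assumes "unimodular a"
  shows "good_op 4 (right_op M i a)"
  unfolding good_op_def right_op_eq
proof (intro conjI allI impI)
  note G = good_op_left[OF assms, of i]
  show "nice (\<lambda>xs. left_op M i a (\<lambda>xs. f (rev xs)) (rev xs))" if "nice f" for f
    by (intro nice_rev good_opD(1)[OF G] that)
  show "(\<lambda>xs. left_op M i a (\<lambda>xs. f (rev xs)) (rev xs)) \<doteq> (\<lambda>xs. left_op M i a (\<lambda>xs. g (rev xs)) (rev xs))"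
    if "f \<doteq> g" for f g
    by (intro fequiv_rev good_opD(2)[OF G] that)
  show "fbounded (\<lambda>xs. left_op M i a (\<lambda>xs. f (rev xs)) (rev xs)) (4 * C)" if "fbounded f C" for f C
    by (intro fbounded_rev good_opD(4)[OF G] that)
  show "(\<lambda>xs. left_op M i a (\<lambda>xs. c * f (rev xs) + d * g (rev xs)) (rev xs)) \<doteq>
      (\<lambda>xs. c * left_op M i a (\<lambda>xs. f (rev xs)) (rev xs) + d * left_op M i a (\<lambda>xs. g (rev xs)) (rev xs))"
    if "nice f" "nice g" for f g c d
    by (rule fequiv_rev[OF good_opD(3)[OF G nice_rev[OF that(1)] nice_rev[OF that(2)]]])
qed simp

definition inverse_ops :: "('i fpvec \<Rightarrow> 'i fpvec) \<Rightarrow> ('i fpvec \<Rightarrow> 'i fpvec) \<Rightarrow> bool" where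
  "inverse_ops S T \<longleftrightarrow> (\<forall>f. nice f \<longrightarrow> S (T f) \<doteq> f \<and> T (S f) \<doteq> f)"

lemma inverse_opsD:
  assumes "inverse_ops S T" "nice f"
  shows "S (T f) \<doteq> f" "T (S f) \<doteq> f"
  using assms by (auto simp: inverse_ops_def)

lemma inverse_ops_left:
  assumes "unimodular a"
  shows "inverse_ops (left_op M i a) (left_op M i (\<lambda>x. inverse (a x)))"
proof -
  have "a x \<noteq> 0" if "x \<in> torus" for x using unimodularD(2)[OF assms that] by auto
  then show ?thesis
    by (auto simp: inverse_ops_def intro!: left_op_inverse)
qed

lemma inverse_ops_right:
  assumes "unimodular a"
  shows "inverse_ops (right_op M i a) (right_op M i (\<lambda>x. inverse (a x)))"
  unfolding inverse_ops_def right_op_eq rev_rev_ident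
  using fequiv_rev[OF inverse_opsD(1)[OF inverse_ops_left[OF assms] nice_rev], of _ i]
    fequiv_rev[OF inverse_opsD(2)[OF inverse_ops_left[OF assms] nice_rev], of _ i]
  by simp

lemma inverse_ops_comp:
  assumes good: "good_op K S" "good_op K S'" "good_op K T" "good_op K T'"
    and inv: "inverse_ops S S'" "inverse_ops T T'"
  shows "inverse_ops (S \<circ> T) (T' \<circ> S')"
  unfolding inverse_ops_def o_apply
proof (intro allI impI conjI)
  fix f assume f: "nice f"
  have "S (T (T' (S' f))) \<doteq> S (S' f)"
    by (intro good_opD(2)[OF good(1)] inverse_opsD(1)[OF inv(2)] good_opD(1)[OF good(2)] f)
  also have "\<dots> \<doteq> f" by (rule inverse_opsD(1)[OF inv(1) f])
  finally show "S (T (T' (S' f))) \<doteq> f" .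
  have "T' (S' (S (T f))) \<doteq> T' (T f)"
    by (intro good_opD(2)[OF good(4)] inverse_opsD(2)[OF inv(1)] good_opD(1)[OF good(3)] f)
  also have "\<dots> \<doteq> f" by (rule inverse_opsD(2)[OF inv(2) f])
  finally show "T' (S' (S (T f))) \<doteq> f" .
qed

lemma good_op_funpow: "good_op K T \<Longrightarrow> good_op (K ^ n) (T ^^ n)"
proof (induction n)
  case 0
  then show ?case using good_op_id by (simp add: id_def)
next
  case (Suc n)
  then show ?case unfolding funpow.simps power_Suc by (intro good_op_comp)
qed

lemma good_op_powi:
  "good_op K T \<Longrightarrow> good_op K T' \<Longrightarrow> good_op (K ^ nat \<bar>k\<bar>) (op_powi T T' k)"
  by (auto simp: op_powi_def intro: good_op_funpow)

lemma op_powi_add1: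
  assumes good: "good_op K T" "good_op K T'" and inv: "inverse_ops T T'" and f: "nice f"
  shows "T (op_powi T T' k f) \<doteq> op_powi T T' (k + 1) f"
    "op_powi T T' k (T f) \<doteq> op_powi T T' (k + 1) f"
proof -
  consider n where "k = int n" | n where "k = - int (Suc n)"
    by (metis int_cases)
  then have "T (op_powi T T' k f) \<doteq> op_powi T T' (k + 1) f \<and>
      op_powi T T' k (T f) \<doteq> op_powi T T' (k + 1) f"
  proof cases
    case 1
    then have "nat (k + 1) = Suc n" by simp
    with 1 show ?thesis by (simp add: op_powi_def funpow_swap1)
  next
    case (2 n)
    have "op_powi T T' (k + 1) f = (T' ^^ n) f" by (auto simp: op_powi_def 2)
    moreover have "op_powi T T' k = T' ^^ Suc n" by (simp add: op_powi_def 2 nat_add_distrib del: of_nat_Suc)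
    moreover have "T (T' ((T' ^^ n) f)) \<doteq> (T' ^^ n) f"
      by (intro inverse_opsD(1)[OF inv] good_opD(1)[OF good_op_funpow[OF good(2)]] f)
    moreover have "(T' ^^ n) (T' (T f)) \<doteq> (T' ^^ n) f"
      by (intro inverse_opsD(2)[OF inv] good_opD(2)[OF good_op_funpow[OF good(2)]] f)
    ultimately show ?thesis by (simp add: funpow_swap1)
  qed
  then show "T (op_powi T T' k f) \<doteq> op_powi T T' (k + 1) f"
    "op_powi T T' k (T f) \<doteq> op_powi T T' (k + 1) f" by auto
qed

lemma nice_vacuum: "nice vacuum"
  unfolding nice_def
proof (intro conjI allI impI)
  show "regular (vacuum :: 'i fpvec)"
    by (rule regularI[of _ 1 0]) (auto simp: fbounded_def vacuum_def flipschitz_def intro: lipschitz_onI)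
qed (auto simp: vacuum_def centered_def)

end

section \<open>Resolvent vectors and resolvent functionals\<close>

text \<open>The coordinate \<open>a\<close> is \<open>fst\<close> on the left side and
  \<open>snd\<close> on the right side. The integral condition says that \<open>eta\<close> of the
  corresponding marginals takes the value \<open>\<zeta>\<close> at \<open>c i\<close>. Smallness is
  asked of the product of the two bounds, relative to \<open>\<zeta>\<close>, because each pair of
  letters brings one factor \<open>1 / \<zeta>\<close>; in this form it also holds near infinity,
  where the functions \<open>g i\<close> need not both be small.\<close>

locale resolvent = torus_family M
  for M :: "bool \<Rightarrow> (complex \<times> complex) measure" +
  fixes a :: "complex \<times> complex \<Rightarrow> complex" and \<zeta> :: complex and c :: "bool \<Rightarrow> complex"
    and \<phi> :: "bool \<Rightarrow> real"
  assumes unimodular_a: "unimodular a"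
    and zeta_nz: "\<zeta> \<noteq> 0" and c_nz: "c i \<noteq> 0" and norm_c: "norm (c i) \<noteq> 1"
    and integral_resolvent: "(LINT x|M i. (1 - \<zeta>) / (1 - c i * a x)) = 1"
    and phi_bound: "x \<in> torus \<Longrightarrow> norm ((1 - \<zeta>) / (1 - c i * a x) - 1) \<le> \<phi> i"
    and phi_small: "\<phi> True * \<phi> False \<le> norm \<zeta> / 4"
begin

definition g :: "bool \<Rightarrow> complex \<times> complex \<Rightarrow> complex" where
  "g i x = (1 - \<zeta>) / (1 - c i * a x) - 1"

lemma denominator_nz: "x \<in> torus \<Longrightarrow> 1 - c i * a x \<noteq> 0"
  using norm_c[of i] unimodularD(2)[OF unimodular_a, of x]
  by (metis eq_iff_diff_eq_0 mult.right_neutral norm_mult norm_one)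

text \<open>Because \<open>c a / (1 - c a)\<close> equals \<open>1 / (1 - c a) - 1\<close>, the
  product is a combination of \<open>1\<close> and \<open>g i\<close>, in which mean and centered
  part can be read off.\<close>

lemma times_one_plus_g: "x \<in> torus \<Longrightarrow> a x * (1 + g i x) = (\<zeta> + g i x) / c i"
  using denominator_nz[of x i] c_nz[of i] by (simp add: g_def field_simps)

lemma g_bound: "x \<in> torus \<Longrightarrow> norm (g i x) \<le> \<phi> i"
  using phi_bound by (simp add: g_def)

lemma phi_nonneg: "\<phi> i \<ge> 0"
proof -
  have "(1, 1) \<in> torus" by (simp add: torus_def)
  from g_bound[OF this, of i] show ?thesis by (rule order_trans[OF norm_ge_zero])
qed

lemma g_lipschitz: "\<exists>K. K-lipschitz_on torus (g i)"
proof -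
  let ?d = "\<bar>1 - norm (c i)\<bar>"
  have d: "?d > 0" using norm_c[of i] by simp
  have lower: "norm (1 - c i * a x) \<ge> ?d" if "x \<in> torus" for x
    using norm_triangle_ineq3[of 1 "c i * a x"] unimodularD(2)[OF unimodular_a that]
    by (simp add: norm_mult)
  have "(norm ((1 - \<zeta>) * c i) / ?d\<^sup>2)-lipschitz_on torus (g i)"
  proof (rule lipschitz_onI)
    fix x y assume x: "x \<in> torus" and y: "y \<in> torus"
    have "g i x - g i y = (1 - \<zeta>) * c i * (a x - a y) / ((1 - c i * a x) * (1 - c i * a y))"
      using denominator_nz[OF x, of i] denominator_nz[OF y, of i] by (simp add: g_def field_simps)
    then have "dist (g i x) (g i y) =
        norm ((1 - \<zeta>) * c i) * dist (a x) (a y) / (norm (1 - c i * a x) * norm (1 - c i * a y))"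
      by (simp add: dist_norm norm_mult norm_divide)
    also have "\<dots> \<le> norm ((1 - \<zeta>) * c i) * dist x y / (?d * ?d)"
      using lipschitz_onD[OF unimodularD(1)[OF unimodular_a] x y] lower[OF x] lower[OF y] d
      by (intro frac_le mult_left_mono mult_mono mult_pos_pos d) auto
    finally show "dist (g i x) (g i y) \<le> norm ((1 - \<zeta>) * c i) / ?d\<^sup>2 * dist x y"
      by (simp add: power2_eq_square)
  qed auto
  then show ?thesis by blast
qed

lemma g_continuous: "continuous_on torus (g i)"
  using g_lipschitz lipschitz_on_continuous_on by blast

lemma integral_g: "(LINT x|M i. g i x) = 0"
proof -
  have "continuous_on torus (\<lambda>x. (1 - \<zeta>) / (1 - c i * a x))"
    using denominator_nz unimodular_continuous[OF unimodular_a]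
    by (intro continuous_intros) auto
  then show ?thesis
    unfolding g_def
    by (simp add: Bochner_Integration.integral_diff integrable_continuous integral_resolvent)
qed

lemma integral_a_one_plus_g: "(LINT x|M i. a x * (1 + g i x)) = \<zeta> / c i"
proof -
  have "(LINT x|M i. a x * (1 + g i x)) = (LINT x|M i. \<zeta> / c i + g i x / c i)"
    by (intro integral_cong_torus) (simp add: times_one_plus_g add_divide_distrib)
  also have "\<dots> = \<zeta> / c i"
    using g_continuous by (simp add: Bochner_Integration.integral_add integrable_continuous integral_g)
  finally show ?thesis .
qed

section \<open>The resolvent vector of the product of right operators\<close>

definition link :: "bool \<Rightarrow> (bool \<times> complex \<times> complex) list \<Rightarrow> complex" where
  "link i ys = (if ys = [] then 1 else if fst (hd ys) = i then 0 else if i then 1 else 1 / \<zeta>)"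

primrec rvec :: "bool fpvec" where
  "rvec [] = 1"
| "rvec (p # ys) = g (fst p) (snd p) * link (fst p) ys * rvec ys"

text \<open>An alternating word carries one factor \<open>1 / \<zeta>\<close> for each
  \<open>False\<close> directly followed by \<open>True\<close>. Built from the front, the factor is
  attached to \<open>False\<close>; built from the end, where right operators act, it is attached to
  \<open>True\<close>.\<close>

lemma rvec_snoc:
  "rvec (ys @ [(i, x)]) =
     (if ys = [] then 1 else if fst (last ys) = i then 0 else if i then 1 / \<zeta> else 1) * g i x * rvec ys"
proof (induction ys)
  case (Cons p ys)
  show ?case
  proof (cases ys)
    case Nil
    then show ?thesis by (auto simp: link_def)
  next
    case (Cons q zs)
    then have "link (fst p) (ys @ [(i, x)]) = link (fst p) ys" by (simp add: link_def)
    then show ?thesis using Cons.IH Cons by simp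
  qed
qed (simp add: link_def)

text \<open>A bound that survives prefixing a letter, see \<open>bnd_step\<close>. Constants alone
  would not do: a single \<open>False\<close> may expand by
  \<open>\<phi> False / norm \<zeta>\<close>, and only a pair of letters contracts, by 1/4. The term
  \<open>2 * \<phi> False / norm \<zeta>\<close> absorbs that expansion within the remaining
  3/4.\<close>

definition bnd :: "bool \<Rightarrow> real" where
  "bnd i = (let b = 1 + \<phi> False + 2 * \<phi> False / norm \<zeta> in if i then 1 + \<phi> True * b else b)"

lemma bnd_ge: "bnd i \<ge> 1" "bnd i \<ge> \<phi> i"
proof -
  let ?b = "1 + \<phi> False + 2 * \<phi> False / norm \<zeta>"
  have b: "?b \<ge> 1" "?b \<ge> \<phi> False" using phi_nonneg[of False] by auto
  have "\<phi> True * 1 \<le> \<phi> True * ?b" using b phi_nonneg by (intro mult_left_mono) auto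
  then show "bnd i \<ge> 1" "bnd i \<ge> \<phi> i"
    using b phi_nonneg[of True] by (cases i; simp add: bnd_def)+
qed

lemma bnd_step:
  assumes x: "x \<in> torus" and q: "norm q \<le> B * bnd (\<not> i)" and B: "B \<ge> 0"
  shows "norm (g i x * (if i then 1 else 1 / \<zeta>) * q) \<le> B * bnd i"
proof -
  let ?b = "1 + \<phi> False + 2 * \<phi> False / norm \<zeta>"
  have z: "norm \<zeta> > 0" using zeta_nz by simp
  have w: "\<phi> i * (if i then 1 else 1 / norm \<zeta>) * bnd (\<not> i) \<le> bnd i"
  proof (cases i)
    case False
    have "\<phi> False / norm \<zeta> * (\<phi> True * ?b) = (\<phi> True * \<phi> False) / norm \<zeta> * ?b" by simp
    also have "\<dots> \<le> 1 / 4 * ?b"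
      using phi_small z phi_nonneg by (intro mult_right_mono) (auto simp: divide_le_eq)
    finally have "\<phi> False / norm \<zeta> * (1 + \<phi> True * ?b) \<le> \<phi> False / norm \<zeta> + 1 / 4 * ?b"
      by (simp add: distrib_left)
    also have "\<dots> \<le> ?b" using phi_nonneg[of False] z by (simp add: field_simps)
    finally show ?thesis using False by (simp add: bnd_def Let_def)
  qed (simp add: bnd_def Let_def)
  have "norm (g i x * (if i then 1 else 1 / \<zeta>) * q) =
      norm (g i x) * (if i then 1 else 1 / norm \<zeta>) * norm q"
    by (simp add: norm_mult norm_divide)
  also have "\<dots> \<le> \<phi> i * (if i then 1 else 1 / norm \<zeta>) * (B * bnd (\<not> i))"
    using g_bound[OF x] q phi_nonneg by (intro mult_mono) auto
  also have "\<dots> \<le> B * bnd i" using mult_left_mono[OF w B] by (simp add: algebra_simps)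
  finally show ?thesis .
qed

lemma rvec_bound: "on_torus xs \<Longrightarrow> norm (rvec xs) \<le> (if xs = [] then 1 else bnd (fst (hd xs)))"
proof (induction xs)
  case (Cons p ys)
  obtain i x where p: "p = (i, x)" by (cases p)
  have x: "x \<in> torus" using Cons.prems p by simp
  show ?case
  proof (cases "ys = [] \<or> fst (hd ys) = i")
    case True
    then show ?thesis using g_bound[OF x, of i] bnd_ge[of i] by (auto simp: p link_def)
  next
    case False
    then have "fst (hd ys) = (\<not> i)" by auto
    then show ?thesis
      using False Cons bnd_step[OF x, of "rvec ys" 1 i] by (simp add: p link_def)
  qed
qed simp

text \<open>With all other letters frozen \<open>rvec\<close> is a multiple of \<open>g i\<close>,
  from which it inherits centering and the Lipschitz bound. \<open>B0\<close> covers the tail and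
  its junction; the letters in \<open>us\<close> are then added by \<open>bnd_step\<close>.\<close>

lemma rvec_factor:
  assumes vs: "on_torus vs"
  defines "B0 \<equiv> (1 + 1 / norm \<zeta>) * (1 + bnd True + bnd False)"
  shows "on_torus us \<Longrightarrow> \<exists>Q. (\<forall>x. rvec (us @ (i, x) # vs) = g i x * Q) \<and>
      norm Q \<le> B0 * bnd (if us = [] then i else fst (hd us))"
proof (induction us)
  case Nil
  have b: "bnd True \<ge> 1" "bnd False \<ge> 1" using bnd_ge by auto
  have "norm (rvec vs) \<le> (if vs = [] then 1 else bnd (fst (hd vs)))" by (rule rvec_bound[OF vs])
  also have "\<dots> \<le> 1 + bnd True + bnd False" using b by (cases "fst (hd vs)") auto
  finally have "norm (link i vs * rvec vs) \<le> B0"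
    unfolding B0_def norm_mult by (intro mult_mono) (auto simp: link_def norm_divide)
  moreover have "B0 * 1 \<le> B0 * bnd i"
    using b unfolding B0_def by (intro mult_left_mono mult_nonneg_nonneg bnd_ge(1)) auto
  ultimately show ?case by (intro exI[of _ "link i vs * rvec vs"]) auto
next
  case (Cons p us)
  obtain k y where p: "p = (k, y)" by (cases p)
  have y: "y \<in> torus" "on_torus us" using Cons.prems p by simp_all
  from Cons.IH[OF y(2)] obtain Q where Q: "\<And>x. rvec (us @ (i, x) # vs) = g i x * Q"
    "norm Q \<le> B0 * bnd (if us = [] then i else fst (hd us))" by blast
  let ?h = "if us = [] then i else fst (hd us)"
  have B0: "B0 \<ge> 0"
    using bnd_ge(1)[of True] bnd_ge(1)[of False] unfolding B0_def by (intro mult_nonneg_nonneg) auto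
  have link: "link k (us @ (i, x) # vs) = (if ?h = k then 0 else if k then 1 else 1 / \<zeta>)" for x
    by (cases us) (auto simp: link_def)
  let ?Q = "g k y * (if ?h = k then 0 else if k then 1 else 1 / \<zeta>) * Q"
  have "norm ?Q \<le> B0 * bnd k"
  proof (cases "?h = k")
    case True
    then show ?thesis using B0 bnd_ge(1)[of k] by simp
  next
    case False
    then have h: "?h = (\<not> k)" by auto
    have "norm Q \<le> B0 * bnd (\<not> k)" using Q(2) unfolding h .
    from bnd_step[OF y(1) this B0] show ?thesis unfolding if_not_P[OF False] .
  qed
  moreover have "rvec ((p # us) @ (i, x) # vs) = g i x * ?Q" for x
    using Q(1)[of x] link[of x] by (simp add: p)
  ultimately show ?case by (intro exI[of _ ?Q]) (simp add: p)
qed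

lemma nice_rvec: "nice rvec"
  unfolding nice_def
proof (intro conjI allI impI)
  let ?B = "1 + bnd True + bnd False"
  let ?D = "(1 + 1 / norm \<zeta>) * ?B"
  have b1: "bnd i \<ge> 1" for i by (rule bnd_ge(1))
  have b2: "bnd i \<le> ?B" for i using b1[of True] b1[of False] by (cases i) auto
  note b = b1 b2
  have B0: "?D \<ge> 0" using b(1)[of True] b(1)[of False] by (intro mult_nonneg_nonneg) auto
  obtain K where K: "\<And>i. (K i)-lipschitz_on torus (g i)" using g_lipschitz by metis
  have K0: "K i \<ge> 0" for i using K by (rule lipschitz_on_nonneg)
  show "regular rvec"
  proof (rule regularI)
    show "fbounded rvec ?B"
      unfolding fbounded_def
    proof (intro allI impI)
      fix xs :: "(bool \<times> complex \<times> complex) list" assume "on_torus xs"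
      from rvec_bound[OF this] show "norm (rvec xs) \<le> ?B"
        using b[of "fst (hd xs)"] by (auto split: if_splits)
    qed
    show "flipschitz rvec (?D * ?B * (K True + K False))"
      unfolding flipschitz_def
    proof (intro allI impI)
      fix us vs :: "(bool \<times> complex \<times> complex) list" and i
      assume "on_torus us" "on_torus vs"
      from rvec_factor[OF this(2,1), of i] obtain Q where Q: "\<And>x. rvec (us @ (i, x) # vs) = g i x * Q"
        "norm Q \<le> ?D * bnd (if us = [] then i else fst (hd us))" by blast
      have "norm Q * K i \<le> (?D * ?B) * (K True + K False)"
      proof (rule mult_mono)
        show "norm Q \<le> ?D * ?B"
          using Q(2) by (rule order_trans) (intro mult_left_mono b B0)
      qed (use K0 B0 b(1)[of True] b(1)[of False] in \<open>cases i; auto\<close>)+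
      with lipschitz_on_const_times[OF K, of Q i]
      show "(?D * ?B * (K True + K False))-lipschitz_on torus (\<lambda>x. rvec (us @ (i, x) # vs))"
        unfolding Q(1) by (subst mult.commute) (rule lipschitz_on_mono, auto)
    qed
  qed
  show "centered rvec"
    unfolding centered_def
  proof (intro allI impI)
    fix us vs :: "(bool \<times> complex \<times> complex) list" and i
    assume "on_torus us" "on_torus vs"
    from rvec_factor[OF this(2,1), of i] obtain Q where "\<And>x. rvec (us @ (i, x) # vs) = g i x * Q"
      by blast
    then show "(LINT x|M i. rvec (us @ (i, x) # vs)) = 0" by (simp add: integral_g)
  qed
next
  fix xs :: "(bool \<times> complex \<times> complex) list"
  assume "\<not> distinct_adj (map fst xs)"
  then show "rvec xs = 0"
  proof (induction xs)
    case (Cons p ys)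
    then show ?case by (cases ys) (auto simp: link_def)
  qed simp
qed

text \<open>By \<open>times_one_plus_g\<close> the operator replaces \<open>k * (1 + g i)\<close> by
  \<open>k * (\<zeta> + g i) / c i\<close>; as \<open>g i\<close> is centered, the constant part is
  the mean.\<close>

lemma left_op_proportional:
  assumes "\<And>y. y \<in> torus \<Longrightarrow> h ((i, y) # ys) + h ys = k * (1 + g i y)" "\<not> starts_with i ys"
  shows "left_op M i a h ys = k * \<zeta> / c i"
    "x \<in> torus \<Longrightarrow> left_op M i a h ((i, x) # ys) = k * g i x / c i"
proof -
  have "(LINT y|M i. a y * (h ((i, y) # ys) + h ys)) = (LINT y|M i. k * (a y * (1 + g i y)))"
    by (intro integral_cong_torus) (simp add: assms)
  then have avg: "avg i a h ys = k * \<zeta> / c i"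
    using assms(2) by (simp add: avg_def integral_a_one_plus_g)
  then show "left_op M i a h ys = k * \<zeta> / c i"
    using assms(2) by (simp add: left_op_avg)
  assume x: "x \<in> torus"
  have "a x * (h ((i, x) # ys) + h ys) = k * (\<zeta> + g i x) / c i"
    using times_one_plus_g[OF x, of i] assms(1)[OF x] by (simp add: mult.left_commute)
  then show "left_op M i a h ((i, x) # ys) = k * g i x / c i"
    using avg assms(2) by (simp add: left_op_Cons algebra_simps add_divide_distrib)
qed

lemma rvec_rev_Cons:
  "rvec (rev ((i, x) # ys)) =
     (if ys = [] then 1 else if starts_with i ys then 0 else if i then 1 / \<zeta> else 1) * g i x * rvec (rev ys)"
  using rvec_snoc[of "rev ys" i x] by (auto simp: starts_with_def last_rev)

text \<open>\<open>rvec\<close> is \<open>1 - \<zeta>\<close> times the resolvent of \<open>v\<^sub>1v\<^sub>2\<close> applied to the vacuum.\<close>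

lemma rvec_resolvent:
  "rvec \<doteq> (\<lambda>xs. c True * c False / \<zeta> * (right_op M True a \<circ> right_op M False a) rvec xs
            + (1 - \<zeta>) * vacuum xs)"
proof -
  \<comment> \<open>On reversed words the two right operators become left operators, and
    \<open>?s\<close> below records the factor \<open>\<zeta>\<close> picked up by the mean
    parts.\<close>
  let ?Y = "\<lambda>xs. rvec (rev xs)"
  let ?s = "\<lambda>ys. if starts_with False ys then 1 else \<zeta>"
  have Z: "left_op M False a ?Y zs = ?Y zs * ?s zs / c False" if zs: "on_torus zs" for zs
  proof (cases "starts_with False zs")
    case False
    have "?Y ((False, y) # zs) + ?Y zs = ?Y zs * (1 + g False y)" for y
      unfolding rvec_rev_Cons using False by (simp add: algebra_simps)
    from left_op_proportional(1)[of ?Y False zs, OF this] show ?thesis using False by simp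
  next
    case True
    then obtain x ys where zs_eq: "zs = (False, x) # ys" by (cases zs) auto
    show ?thesis
    proof (cases "starts_with False ys")
      case False
      have "?Y ((False, y) # ys) + ?Y ys = ?Y ys * (1 + g False y)" for y
        unfolding rvec_rev_Cons using False by (simp add: algebra_simps)
      from left_op_proportional(2)[of ?Y False ys, OF this False, of x] show ?thesis
        using False zs unfolding zs_eq rvec_rev_Cons by simp
    next
      case True
      then show ?thesis
        unfolding zs_eq rvec_rev_Cons by (auto simp: left_op_Cons avg_def)
    qed
  qed
  let ?Z = "left_op M False a ?Y"
  \<comment> \<open>If \<open>ys\<close> starts with \<open>False\<close>, the factor
    \<open>\<zeta>\<close> of \<open>?Z\<close> at \<open>(True, y) # ys\<close> cancels the weight
    \<open>1 / \<zeta>\<close> of that junction. At the empty word there is no junction and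
    \<open>\<zeta>\<close> remains; this is what produces the vacuum term.\<close>
  let ?k = "\<lambda>ys. ?Y ys * (if ys = [] then \<zeta> else 1) / c False"
  have k: "?Z ((True, y) # ys) + ?Z ys = ?k ys * (1 + g True y)"
    if "on_torus ys" "y \<in> torus" "\<not> starts_with True ys" for y ys
  proof -
    have "ys = [] \<or> starts_with False ys" using that by (cases ys) auto
    then show ?thesis
      using that zeta_nz c_nz[of False] Z[of ys] Z[of "(True, y) # ys"]
      by (auto simp: rvec_rev_Cons field_simps simp del: rev.simps)
  qed
  have W: "c True * c False / \<zeta> * left_op M True a ?Z zs + (1 - \<zeta>) * vacuum zs = ?Y zs"
    if zs: "on_torus zs" for zs
  proof (cases "starts_with True zs")
    case False
    then show ?thesis
      using left_op_proportional(1)[of ?Z True zs "?k zs"] k[OF zs] zeta_nz c_nz[of True] c_nz[of False]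
      by (auto simp: vacuum_def)
  next
    case True
    then obtain x ys where zs_eq: "zs = (True, x) # ys" by (cases zs) auto
    have T: "x \<in> torus" "on_torus ys" using zs by (auto simp: zs_eq)
    show ?thesis
    proof (cases "starts_with True ys")
      case False
      then show ?thesis
        using left_op_proportional(2)[of ?Z True ys "?k ys" x] k[OF T(2)] T(1) zeta_nz
          c_nz[of True] c_nz[of False]
        unfolding zs_eq rvec_rev_Cons by (auto simp: vacuum_def)
    next
      case True
      then show ?thesis
        unfolding zs_eq rvec_rev_Cons by (auto simp: left_op_Cons avg_def vacuum_def)
    qed
  qed
  have V: "(right_op M True a \<circ> right_op M False a) rvec (rev zs) = left_op M True a ?Z zs" for zs
    by (simp add: right_op_eq)
  show ?thesis
    unfolding fequiv_def
  proof (intro allI impI)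
    fix xs :: "(bool \<times> complex \<times> complex) list" assume "on_torus xs"
    then show "rvec xs = c True * c False / \<zeta> * (right_op M True a \<circ> right_op M False a) rvec xs
            + (1 - \<zeta>) * vacuum xs"
      using W[of "rev xs"] V[of "rev xs"] by (simp add: vacuum_def)
  qed
qed

section \<open>Integrals against products of the functions \<open>g\<close> along alternating
  words\<close>

primrec iint :: "nat \<Rightarrow> bool \<Rightarrow> bool fpvec \<Rightarrow> complex" where
  "iint 0 i f = f []"
| "iint (Suc n) i f = (LINT x|M i. g i x * iint n (\<not> i) (\<lambda>ys. f ((i, x) # ys)))"

primrec gbd :: "nat \<Rightarrow> bool \<Rightarrow> real" where
  "gbd 0 i = 1"
| "gbd (Suc n) i = \<phi> i * gbd n (\<not> i)"

lemma gbd_nonneg: "gbd n i \<ge> 0"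
  by (induction n arbitrary: i) (auto simp: phi_nonneg)

lemma iint_bound: "fbounded f C \<Longrightarrow> norm (iint n i f) \<le> gbd n i * C"
proof (induction n arbitrary: i f)
  case 0
  then show ?case using fboundedD[of f C "[]"] by simp
next
  case (Suc n)
  have C: "C \<ge> 0" using Suc.prems by (rule fbounded_nonneg)
  show ?case
    unfolding iint.simps
  proof (rule norm_integral_le)
    fix x assume x: "x \<in> torus"
    show "norm (g i x * iint n (\<not> i) (\<lambda>ys. f ((i, x) # ys))) \<le> gbd (Suc n) i * C"
      using mult_mono[OF g_bound[OF x, of i] Suc.IH[OF fbounded_Cons[OF Suc.prems x], of "\<not> i" i] phi_nonneg]
      by (simp add: norm_mult mult.assoc)
  qed (simp add: C gbd_nonneg phi_nonneg del: gbd.simps)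
qed

lemma iint_cong:
  assumes "\<And>ys. on_torus ys \<Longrightarrow> length ys = n \<Longrightarrow> \<not> starts_with (\<not> i) ys \<Longrightarrow> f ys = h ys"
  shows "iint n i f = iint n i h"
  using assms
proof (induction n arbitrary: i f h)
  case (Suc n)
  have "iint n (\<not> i) (\<lambda>ys. f ((i, x) # ys)) = iint n (\<not> i) (\<lambda>ys. h ((i, x) # ys))"
    if "x \<in> torus" for x
    using that by (intro Suc.IH Suc.prems) auto
  then show ?case by (auto intro!: integral_cong_torus)
qed simp

text \<open>Linearity is a premise so that the lemma can be used inside the induction of
  \<open>iint_linear\<close>, where it is known for the shorter words only.\<close>

lemma iint_lipschitz_family:
  assumes linear: "\<And>f h \<alpha> \<beta>. regular f \<Longrightarrow> regular h \<Longrightarrow>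
      iint n j (\<lambda>ys. \<alpha> * f ys + \<beta> * h ys) = \<alpha> * iint n j f + \<beta> * iint n j h"
    and P: "\<And>x. x \<in> torus \<Longrightarrow> regular (P x)"
    and K: "\<And>ys. on_torus ys \<Longrightarrow> K-lipschitz_on torus (\<lambda>x. P x ys)"
  shows "(gbd n j * K)-lipschitz_on torus (\<lambda>x. iint n j (P x))"
proof (rule lipschitz_onI)
  fix x y assume x: "x \<in> torus" and y: "y \<in> torus"
  have "fbounded (\<lambda>ys. 1 * P x ys + (- 1) * P y ys) (K * dist x y)"
    unfolding fbounded_def using lipschitz_onD[OF K x y] by (simp add: dist_norm)
  from iint_bound[OF this, of n j] show "dist (iint n j (P x)) (iint n j (P y)) \<le> gbd n j * K * dist x y"
    unfolding linear[OF P[OF x] P[OF y]] by (simp add: dist_norm mult.assoc)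
qed (use gbd_nonneg lipschitz_on_nonneg[OF K[of "[]"]] in auto)

lemma iint_linear:
  assumes "regular f" "regular h"
  shows "iint n i (\<lambda>ys. \<alpha> * f ys + \<beta> * h ys) = \<alpha> * iint n i f + \<beta> * iint n i h"
  using assms
proof (induction n arbitrary: i f h \<alpha> \<beta>)
  case (Suc n)
  let ?I = "\<lambda>f x. iint n (\<not> i) (\<lambda>ys. f ((i, x) # ys))"
  have cont: "continuous_on torus (?I f)" if f: "regular f" for f
  proof -
    obtain K where K: "flipschitz f K" using f by (rule regularE)
    have "(gbd n (\<not> i) * K)-lipschitz_on torus (?I f)"
      by (intro iint_lipschitz_family Suc.IH regular_Cons f flipschitz_head[OF K]) auto
    then show ?thesis by (rule lipschitz_on_continuous_on)
  qed
  have "iint (Suc n) i (\<lambda>ys. \<alpha> * f ys + \<beta> * h ys) =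
      (LINT x|M i. \<alpha> * (g i x * ?I f x) + \<beta> * (g i x * ?I h x))"
    unfolding iint.simps
    by (intro integral_cong_torus, subst Suc.IH)
      (auto intro: regular_Cons Suc.prems simp: algebra_simps)
  also have "\<dots> = \<alpha> * iint (Suc n) i f + \<beta> * iint (Suc n) i h"
    using cont[OF Suc.prems(1)] cont[OF Suc.prems(2)] g_continuous[of i]
    by (simp add: Bochner_Integration.integral_add integrable_continuous continuous_intros)
  finally show ?case .
qed simp

lemma iint_lipschitz:
  assumes "\<And>x. x \<in> torus \<Longrightarrow> regular (P x)"
    and "\<And>ys. on_torus ys \<Longrightarrow> K-lipschitz_on torus (\<lambda>x. P x ys)"
  shows "(gbd n j * K)-lipschitz_on torus (\<lambda>x. iint n j (P x))"
  using assms by (intro iint_lipschitz_family iint_linear)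

lemma iint_continuous:
  assumes "regular f"
  shows "continuous_on torus (\<lambda>x. iint n j (\<lambda>ys. f ((i, x) # ys)))"
proof -
  obtain K where K: "flipschitz f K" using assms by (rule regularE)
  show ?thesis
    by (rule lipschitz_on_continuous_on, rule iint_lipschitz[where K = K])
      (auto intro: regular_Cons assms flipschitz_head[OF K])
qed

text \<open>Fubini, one letter at a time. The constants are explicit and uniform in \<open>x\<close>
  because the induction needs the same bounds for \<open>P x\<close> with its first letter
  fixed.\<close>

lemma integral_iint:
  assumes "\<And>x. x \<in> torus \<Longrightarrow> fbounded (P x) C" "\<And>x. x \<in> torus \<Longrightarrow> flipschitz (P x) K"
    and "\<And>ys. on_torus ys \<Longrightarrow> L-lipschitz_on torus (\<lambda>x. P x ys)"
  shows "(LINT x|M k. iint n j (P x)) = iint n j (\<lambda>ys. LINT x|M k. P x ys)"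
  using assms
proof (induction n arbitrary: j P)
  case (Suc n)
  let ?Q = "\<lambda>y x ys. P x ((j, y) # ys)"
  obtain G where G: "G-lipschitz_on torus (g j)" using g_lipschitz by blast
  have T: "(1, 1) \<in> torus" by (simp add: torus_def)
  have C: "C \<ge> 0" and K: "K \<ge> 0" and L: "L \<ge> 0"
    using fbounded_nonneg[OF Suc.prems(1)[OF T]] flipschitz_nonneg[OF Suc.prems(2)[OF T]]
      lipschitz_on_nonneg[OF Suc.prems(3)[of "[]"]] by auto
  have r: "regular (P x)" if "x \<in> torus" for x
    using Suc.prems(1,2)[OF that] by (rule regularI)
  have "(LINT x|M k. iint (Suc n) j (P x)) = (LINT x|M k. LINT y|M j. g j y * iint n (\<not> j) (?Q y x))"
    by simp
  also have "\<dots> = (LINT y|M j. LINT x|M k. g j y * iint n (\<not> j) (?Q y x))"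
  proof (rule fubini_lipschitz)
    fix y assume y: "y \<in> torus"
    have "(norm (g j y) * (gbd n (\<not> j) * L))-lipschitz_on torus (\<lambda>x. g j y * iint n (\<not> j) (?Q y x))"
      using y by (intro lipschitz_on_const_times iint_lipschitz Suc.prems(3) regular_Cons r) auto
    then show "(\<phi> j * (gbd n (\<not> j) * L))-lipschitz_on torus (\<lambda>x. g j y * iint n (\<not> j) (?Q y x))"
      by (rule lipschitz_on_mono) (use g_bound[OF y] L gbd_nonneg in \<open>auto intro!: mult_right_mono\<close>)
  next
    fix x assume x: "x \<in> torus"
    show "(\<phi> j * (gbd n (\<not> j) * K) + G * (gbd n (\<not> j) * C))-lipschitz_on torus
        (\<lambda>y. g j y * iint n (\<not> j) (?Q y x))"
      using x C
      by (intro lipschitz_on_times iint_lipschitz G g_bound iint_bound fbounded_Cons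
          flipschitz_head[OF Suc.prems(2)[OF x]] regular_Cons r[OF x] Suc.prems(1) phi_nonneg
          mult_nonneg_nonneg gbd_nonneg)
  qed
  also have "\<dots> = (LINT y|M j. g j y * iint n (\<not> j) (\<lambda>ys. LINT x|M k. ?Q y x ys))"
  proof (rule integral_cong_torus)
    fix y assume y: "y \<in> torus"
    have "(LINT x|M k. iint n (\<not> j) (?Q y x)) = iint n (\<not> j) (\<lambda>ys. LINT x|M k. ?Q y x ys)"
      using y by (intro Suc.IH fbounded_Cons flipschitz_Cons Suc.prems) auto
    then show "(LINT x|M k. g j y * iint n (\<not> j) (?Q y x)) =
        g j y * iint n (\<not> j) (\<lambda>ys. LINT x|M k. ?Q y x ys)" by simp
  qed
  finally show ?case by simp
qed simp

lemma iint_zero: "iint n i (\<lambda>ys. 0) = 0"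
  using iint_bound[of "\<lambda>ys. 0" 0 n i] by (simp add: fbounded_def)

text \<open>Multiplication by \<open>a\<close> in the first variable is absorbed by the weights \<open>g i\<close>, because
  \<open>a (1 + g i) = (\<zeta> + g i) / c i\<close>.\<close>

lemma iint_left_op:
  assumes k: "nice k"
  shows "iint n (\<not> i) (left_op M i a k) + iint (Suc n) i (left_op M i a k) =
    (\<zeta> * iint n (\<not> i) k + iint (Suc n) i k) / c i"
proof -
  let ?j = "\<not> i"
  let ?k = "\<lambda>x ys. k ((i, x) # ys)"
  let ?P = "\<lambda>x ys. a x * k ((i, x) # ys) + a x * k ys"
  let ?u = "left_op M i a k"
  let ?J = "\<lambda>x. iint n ?j (?k x)"
  have r: "regular k" using k by (rule nice_regular)
  obtain C K where C: "fbounded k C" and K: "flipschitz k K" using r by (rule regularE)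
  have C0: "C \<ge> 0" and K0: "K \<ge> 0" using fbounded_nonneg[OF C] flipschitz_nonneg[OF K] .
  note a1 = unimodularD[OF unimodular_a]
  have P_bounded: "fbounded (?P x) (2 * C)" if x: "x \<in> torus" for x
    unfolding fbounded_def
  proof (intro allI impI)
    fix ys :: "(bool \<times> complex \<times> complex) list" assume "on_torus ys"
    then have "norm (a x * k ((i, x) # ys)) + norm (a x * k ys) \<le> C + C"
      using x by (simp only: norm_mult a1(2) mult_1) (intro add_mono fboundedD[OF C], auto)
    then show "norm (?P x ys) \<le> 2 * C" by (intro order_trans[OF norm_triangle_ineq]) auto
  qed
  have P_lip: "flipschitz (?P x) (2 * K)" if x: "x \<in> torus" for x
    unfolding flipschitz_def
  proof (intro allI impI)
    fix us vs :: "(bool \<times> complex \<times> complex) list" and l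
    assume us: "on_torus us" "on_torus vs"
    have "(norm (a x) * K + norm (a x) * K)-lipschitz_on torus
        (\<lambda>xa. a x * k (((i, x) # us) @ (l, xa) # vs) + a x * k (us @ (l, xa) # vs))"
      using us x by (intro lipschitz_on_const_times lipschitz_on_add flipschitzD[OF K]) auto
    then show "(2 * K)-lipschitz_on torus
        (\<lambda>xa. a x * k ((i, x) # us @ (l, xa) # vs) + a x * k (us @ (l, xa) # vs))"
      using a1(2)[OF x] by simp
  qed
  have P_lip1: "((1 * K + 1 * C) + (1 * 0 + 1 * C))-lipschitz_on torus (\<lambda>x. ?P x ys)"
    if ys: "on_torus ys" for ys
    using ys C0 a1
    by (intro lipschitz_on_add lipschitz_on_times flipschitz_head[OF K] lipschitz_on_constant
        fboundedD[OF C]) auto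
  have P_iint: "iint n ?j (?P x) = a x * (?J x + iint n ?j k)" if "x \<in> torus" for x
    using iint_linear[OF regular_Cons[OF r that] r, of n ?j "a x" i "a x"] by (simp add: distrib_left)
  have cJ: "continuous_on torus ?J" by (rule iint_continuous[OF r])
  have 1: "iint n ?j ?u = (LINT x|M i. iint n ?j (?P x))"
  proof -
    have "iint n ?j ?u = iint n ?j (\<lambda>ys. LINT x|M i. ?P x ys)"
      by (rule iint_cong) (simp add: left_op_avg avg_def distrib_left)
    then show ?thesis using integral_iint[OF P_bounded P_lip P_lip1, of i n ?j] by simp
  qed
  have "iint (Suc n) i ?u = (LINT x|M i. g i x * iint n ?j (?P x) - g i x * iint n ?j (avg i a k))"
    unfolding iint.simps
  proof (rule integral_cong_torus)
    fix x assume x: "x \<in> torus"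
    have "iint n ?j (\<lambda>ys. ?u ((i, x) # ys)) = iint n ?j (\<lambda>ys. 1 * ?P x ys + (- 1) * avg i a k ys)"
      by (rule iint_cong) (simp add: left_op_Cons distrib_left)
    also have "\<dots> = 1 * iint n ?j (?P x) + (- 1) * iint n ?j (avg i a k)"
      by (rule iint_linear) (intro regularI[OF P_bounded P_lip] x, intro avg_regular unimodular_a r)
    finally have "iint n ?j (\<lambda>ys. ?u ((i, x) # ys)) = iint n ?j (?P x) - iint n ?j (avg i a k)"
      by simp
    then show "g i x * iint n ?j (\<lambda>ys. ?u ((i, x) # ys)) =
        g i x * iint n ?j (?P x) - g i x * iint n ?j (avg i a k)"
      by (simp only: right_diff_distrib)
  qed
  \<comment> \<open>The \<open>avg\<close> term is constant in \<open>x\<close> and disappears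
    because \<open>g i\<close> has mean zero.\<close>
  also have "\<dots> = (LINT x|M i. g i x * iint n ?j (?P x))"
  proof -
    have "continuous_on torus (\<lambda>x. iint n ?j (?P x))"
      by (rule lipschitz_on_continuous_on, rule iint_lipschitz[OF _ P_lip1])
        (rule regularI[OF P_bounded P_lip])
    then show ?thesis
      using g_continuous[of i]
      by (simp add: Bochner_Integration.integral_diff integrable_continuous continuous_intros integral_g)
  qed
  finally have 2: "iint (Suc n) i ?u = (LINT x|M i. g i x * iint n ?j (?P x))" .
  have cP: "continuous_on torus (\<lambda>x. iint n ?j (?P x))"
    by (rule lipschitz_on_continuous_on, rule iint_lipschitz[OF _ P_lip1])
      (rule regularI[OF P_bounded P_lip])
  have "iint n ?j ?u + iint (Suc n) i ?u =
      (LINT x|M i. iint n ?j (?P x) + g i x * iint n ?j (?P x))"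
    unfolding 1 2 using cP g_continuous[of i]
    by (simp add: Bochner_Integration.integral_add integrable_continuous continuous_intros)
  also have "\<dots> = (LINT x|M i. (\<zeta> * ?J x + \<zeta> * iint n ?j k + (g i x * ?J x + g i x * iint n ?j k)) / c i)"
  proof (rule integral_cong_torus)
    fix x assume x: "x \<in> torus"
    have "iint n ?j (?P x) + g i x * iint n ?j (?P x) = (a x * (1 + g i x)) * (?J x + iint n ?j k)"
      unfolding P_iint[OF x] by (simp add: algebra_simps)
    also have "\<dots> = (\<zeta> * ?J x + \<zeta> * iint n ?j k + (g i x * ?J x + g i x * iint n ?j k)) / c i"
      unfolding times_one_plus_g[OF x] by (simp add: algebra_simps add_divide_distrib)
    finally show "iint n ?j (?P x) + g i x * iint n ?j (?P x) =
      (\<zeta> * ?J x + \<zeta> * iint n ?j k + (g i x * ?J x + g i x * iint n ?j k)) / c i" .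
  qed
  also have "\<dots> = (\<zeta> * (LINT x|M i. ?J x) + \<zeta> * iint n ?j k + iint (Suc n) i k) / c i"
    using cJ g_continuous[of i]
    by (simp add: Bochner_Integration.integral_add integrable_continuous continuous_intros integral_g)
  \<comment> \<open>The integral in the first letter may be taken before all others, and there
    \<open>k\<close> is centered.\<close>
  also have "(LINT x|M i. ?J x) = 0"
  proof -
    have "(LINT x|M i. ?J x) = iint n ?j (\<lambda>ys. LINT x|M i. k ([] @ (i, x) # ys))"
      using integral_iint[where P = "?k" and k = i and n = n and j = ?j,
          OF fbounded_Cons[OF C] flipschitz_Cons[OF K] flipschitz_head[OF K]] by simp
    also have "\<dots> = iint n ?j (\<lambda>ys. 0)"
    proof (rule iint_cong)
      fix ys :: "(bool \<times> complex \<times> complex) list" assume "on_torus ys"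
      moreover have "centered k" using k by (simp add: nice_def)
      ultimately show "(LINT x|M i. k ([] @ (i, x) # ys)) = 0"
        unfolding centered_def by (metis on_torus_simps(1))
    qed
    finally show ?thesis by (simp add: iint_zero)
  qed
  finally show ?thesis by simp
qed

section \<open>Weighted sums over words and the dual resolvent equation\<close>

lemma gbd_le: "gbd n i \<le> (1 + \<phi> True + \<phi> False) * (norm \<zeta> / 4) ^ (n div 2)"
proof (induction n rule: induct_nat_012)
  case 0
  then show ?case using phi_nonneg[of True] phi_nonneg[of False] by simp
next
  case 1
  then show ?case using phi_nonneg[of True] phi_nonneg[of False] by (cases i) auto
next
  case (ge2 n)
  have "gbd (Suc (Suc n)) i = (\<phi> True * \<phi> False) * gbd n i" by (cases i) auto
  also have "\<dots> \<le> (norm \<zeta> / 4) * ((1 + \<phi> True + \<phi> False) * (norm \<zeta> / 4) ^ (n div 2))"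
    using phi_small ge2(1) gbd_nonneg by (intro mult_mono) auto
  finally show ?case by (simp add: mult_ac)
qed

text \<open>The exponent is the number of junctions \<open>False\<close>, \<open>True\<close> in an
  alternating word of length \<open>n\<close> starting with \<open>False\<close>, and also in one of
  length \<open>n + 1\<close> starting with \<open>True\<close>. These are the weights of
  \<open>rvec\<close>, so \<open>functional\<close> is the bilinear pairing with
  \<open>rvec\<close>.\<close>

definition wt :: "nat \<Rightarrow> complex" where
  "wt n = (1 / \<zeta>) ^ (n div 2)"

text \<open>One factor pays for a letter left unpaired in \<open>gbd_le\<close>, the other for the
  additional letter of the words in \<open>sumT\<close>.\<close>

definition Gam :: real where
  "Gam = (1 + \<phi> True + \<phi> False)\<^sup>2"

lemma Gam_nonneg: "Gam \<ge> 0"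
  by (simp add: Gam_def)

text \<open>A pair of letters contributes \<open>norm \<zeta> / 4\<close> and its weight
  \<open>1 / norm \<zeta>\<close>, so the terms decay by 1/4 per pair, that is 1/2 per letter; the
  factor 2 pays for odd \<open>n\<close>. The two alternatives serve \<open>sumF\<close> and
  \<open>sumT\<close>.\<close>

lemma wt_term_bound:
  assumes "norm s \<le> gbd n i * C \<or> norm s \<le> gbd (Suc n) i * C" and C: "C \<ge> 0"
  shows "norm (wt n * s) \<le> 2 * Gam * C * (1 / 2) ^ n"
proof -
  let ?G = "1 + \<phi> True + \<phi> False"
  have G: "?G \<ge> 1" "\<phi> i \<le> ?G" "\<phi> i \<ge> 0"
    using phi_nonneg[of True] phi_nonneg[of False] by (cases i; simp)+
  have z: "norm \<zeta> > 0" using zeta_nz by simp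
  have 1: "gbd n k \<le> Gam * (norm \<zeta> / 4) ^ (n div 2)" for k
  proof -
    have "?G * 1 \<le> ?G * ?G" using G by (intro mult_left_mono) auto
    then have "?G * (norm \<zeta> / 4) ^ (n div 2) \<le> Gam * (norm \<zeta> / 4) ^ (n div 2)"
      by (intro mult_right_mono) (auto simp: Gam_def power2_eq_square)
    with gbd_le[of n k] show ?thesis by linarith
  qed
  have 2: "gbd (Suc n) i \<le> Gam * (norm \<zeta> / 4) ^ (n div 2)"
  proof -
    have "gbd (Suc n) i \<le> ?G * (?G * (norm \<zeta> / 4) ^ (n div 2))"
      unfolding gbd.simps using G gbd_le[of n "\<not> i"] gbd_nonneg by (intro mult_mono) auto
    then show ?thesis by (simp add: Gam_def power2_eq_square mult.assoc)
  qed
  have "norm s \<le> Gam * (norm \<zeta> / 4) ^ (n div 2) * C"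
    using assms(1) mult_right_mono[OF 1 C, of i] mult_right_mono[OF 2 C] by linarith
  then have "norm (wt n * s) \<le> (1 / norm \<zeta>) ^ (n div 2) * (Gam * (norm \<zeta> / 4) ^ (n div 2) * C)"
    by (simp add: wt_def norm_mult norm_power norm_divide mult_left_mono)
  also have "\<dots> = Gam * C * ((1 / norm \<zeta>) * (norm \<zeta> / 4)) ^ (n div 2)"
    unfolding power_mult_distrib by (simp only: mult_ac)
  also have "(1 / norm \<zeta>) * (norm \<zeta> / 4) = (1 / 2)\<^sup>2" using z by (simp add: power2_eq_square)
  also have "Gam * C * ((1 / 2)\<^sup>2) ^ (n div 2) \<le> Gam * C * (2 * (1 / 2) ^ n)"
  proof (intro mult_left_mono)
    have "((1 / 2 :: real)\<^sup>2) ^ (n div 2) = (1 / 2) ^ (2 * (n div 2))" by (rule power_mult[symmetric])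
    also have "\<dots> = (1 / 2) ^ (n - n mod 2)" by (simp add: minus_mod_eq_mult_div)
    also have "\<dots> = 2 ^ (n mod 2) * (1 / 2) ^ n"
      by (simp add: power_diff power_divide)
    also have "\<dots> \<le> 2 ^ 1 * (1 / 2) ^ n"
      by (intro mult_right_mono power_increasing) auto
    finally show "((1 / 2)\<^sup>2) ^ (n div 2) \<le> 2 * (1 / 2 :: real) ^ n" by simp
  qed (use C Gam_nonneg in auto)
  finally show ?thesis by (simp add: mult_ac)
qed

definition sumF :: "bool fpvec \<Rightarrow> complex" where
  "sumF f = (\<Sum>n. wt n * iint n False f)"

definition sumT :: "bool fpvec \<Rightarrow> complex" where
  "sumT f = (\<Sum>n. wt n * iint (Suc n) True f)"

text \<open>The pairing with the vector adjoint to the resolvent of \<open>u\<^sub>1u\<^sub>2\<close>; the words beginning with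
  \<open>False\<close>, and the empty word, contribute \<open>sumF\<close>.\<close>

definition functional :: "bool fpvec \<Rightarrow> complex" where
  "functional f = sumF f + sumT f"

lemma summable_halves: "summable (\<lambda>n. A * (1 / 2 :: real) ^ n)"
  by (intro summable_mult summable_geometric) simp

lemma summableF: "fbounded f C \<Longrightarrow> summable (\<lambda>n. wt n * iint n i f)"
  by (rule summable_comparison_test'[OF summable_halves])
    (use fbounded_nonneg in \<open>auto intro!: wt_term_bound iint_bound\<close>)

lemma summableT: "fbounded f C \<Longrightarrow> summable (\<lambda>n. wt n * iint (Suc n) i f)"
  by (rule summable_comparison_test'[OF summable_halves], rule wt_term_bound[of _ _ i C])
    (use fbounded_nonneg in \<open>auto intro!: iint_bound simp del: iint.simps gbd.simps\<close>)

lemma functional_bound: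
  assumes f: "fbounded f C"
  shows "norm (functional f) \<le> 8 * Gam * C"
proof -
  have C: "C \<ge> 0" using f by (rule fbounded_nonneg)
  have s: "suminf (\<lambda>n. 2 * Gam * C * (1 / 2 :: real) ^ n) = 4 * Gam * C"
    by (simp add: suminf_mult suminf_geometric summable_geometric)
  have "norm (sumF f) \<le> 4 * Gam * C"
    unfolding sumF_def s[symmetric]
    by (intro norm_suminf_le summable_halves wt_term_bound[of _ _ False] C) (simp add: iint_bound[OF f])
  moreover have "norm (sumT f) \<le> 4 * Gam * C"
    unfolding sumT_def s[symmetric]
    by (intro norm_suminf_le summable_halves wt_term_bound[of _ _ True] C disjI2 iint_bound f)
  ultimately show ?thesis
    unfolding functional_def by (intro order_trans[OF norm_triangle_ineq]) linarith
qed

lemma functional_linear: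
  assumes "regular f" "regular h"
  shows "functional (\<lambda>ys. \<alpha> * f ys + \<beta> * h ys) = \<alpha> * functional f + \<beta> * functional h"
proof -
  obtain C D where C: "fbounded f C" and D: "fbounded h D"
    using assms by (auto elim!: regularE)
  have "sumF (\<lambda>ys. \<alpha> * f ys + \<beta> * h ys) = \<alpha> * sumF f + \<beta> * sumF h"
    unfolding sumF_def iint_linear[OF assms]
    using summableF[OF C] summableF[OF D]
    by (simp add: distrib_left mult.left_commute suminf_add[symmetric] suminf_mult summable_mult)
  moreover have "sumT (\<lambda>ys. \<alpha> * f ys + \<beta> * h ys) = \<alpha> * sumT f + \<beta> * sumT h"
    unfolding sumT_def iint_linear[OF assms]
    using summableT[OF C] summableT[OF D]
    by (simp add: distrib_left mult.left_commute suminf_add[symmetric] suminf_mult summable_mult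
        del: iint.simps)
  ultimately show ?thesis by (simp add: functional_def algebra_simps)
qed

lemma functional_cong: "f \<doteq> h \<Longrightarrow> functional f = functional h"
proof -
  assume "f \<doteq> h"
  then have "iint n i f = iint n i h" for n i
    by (intro iint_cong) (simp add: fequiv_def)
  then show ?thesis by (simp add: functional_def sumF_def sumT_def del: iint.simps)
qed

text \<open>Two letters cost exactly one factor \<open>1 / \<zeta>\<close>. The shift makes words
  starting with \<open>False\<close> comparable with the words starting with \<open>True\<close>
  that they contain after their first letter.\<close>

lemma suminf_wt_shift:
  assumes "summable (\<lambda>n. wt n * s n)"
  shows "summable (\<lambda>n. wt n * s (Suc (Suc n)))"
    "(\<Sum>n. wt n * s n) = s 0 + s 1 + (\<Sum>n. wt n * s (Suc (Suc n))) / \<zeta>"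
proof -
  have wt2: "wt (n + 2) = wt n / \<zeta>" for n by (simp add: wt_def)
  have 1: "summable (\<lambda>n. wt (n + 2) * s (n + 2))"
    using assms by (rule summable_ignore_initial_segment)
  then have "summable (\<lambda>n. \<zeta> * (wt (n + 2) * s (n + 2)))" by (rule summable_mult)
  then show sm: "summable (\<lambda>n. wt n * s (Suc (Suc n)))" using zeta_nz by (simp add: wt2 del: add_2_eq_Suc')
      (simp add: numeral_2_eq_2)
  have "(\<Sum>n. wt n * s n) = (\<Sum>n. wt (n + 2) * s (n + 2)) + (\<Sum>n<2. wt n * s n)"
    using assms by (rule suminf_split_initial_segment)
  also have "(\<lambda>n. wt (n + 2) * s (n + 2)) = (\<lambda>n. (wt n * s (Suc (Suc n))) / \<zeta>)"
    unfolding wt2 by simp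
  also have "(\<Sum>n. (wt n * s (Suc (Suc n))) / \<zeta>) = (\<Sum>n. wt n * s (Suc (Suc n))) / \<zeta>"
    using sm by (rule suminf_divide)
  finally show "(\<Sum>n. wt n * s n) = s 0 + s 1 + (\<Sum>n. wt n * s (Suc (Suc n))) / \<zeta>"
    by (simp add: numeral_2_eq_2 wt_def)
qed

text \<open>The operator with index \<open>True\<close> mixes a word starting with
  \<open>False\<close>, or the empty word, with the same word prefixed by \<open>True\<close>; both
  have the same weight, so \<open>iint_left_op\<close> applies term by term. For index
  \<open>False\<close> the prefixed word has its weight divided by \<open>\<zeta>\<close>, which the
  factor \<open>\<zeta>\<close> in front of \<open>sumF\<close> repairs after the shift. Only the
  empty word is left with a wrong coefficient, and it gives the right-hand side.\<close>

lemma functional_resolvent: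
  assumes f: "nice f"
  shows "functional f - c True * c False / \<zeta> * functional ((left_op M True a \<circ> left_op M False a) f)
    = (1 - \<zeta>) * f []"
proof -
  let ?k = "left_op M False a f"
  let ?h = "left_op M True a ?k"
  have k: "nice ?k" by (intro nice_left_op unimodular_a f)
  have h: "nice ?h" by (intro nice_left_op unimodular_a k)
  obtain C where C: "fbounded f C" using nice_regular[OF f] by (rule regularE)
  obtain D where D: "fbounded ?k D" using nice_regular[OF k] by (rule regularE)
  obtain E where E: "fbounded ?h E" using nice_regular[OF h] by (rule regularE)
  have "functional ?h = (\<Sum>n. wt n * (iint n False ?h + iint (Suc n) True ?h))"
    unfolding functional_def sumF_def sumT_def distrib_left
    by (intro suminf_add summableF[OF E] summableT[OF E])
  also have "\<dots> = (\<Sum>n. (\<zeta> * (wt n * iint n False ?k) + wt n * iint (Suc n) True ?k) / c True)"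
    using iint_left_op[OF k, of _ True] by (simp add: algebra_simps del: iint.simps)
  also have "\<dots> = (\<zeta> * sumF ?k + sumT ?k) / c True"
    using summableF[OF D] summableT[OF D] unfolding sumF_def sumT_def
    by (simp add: suminf_divide suminf_add[symmetric] suminf_mult summable_mult summable_add del: iint.simps)
  finally have 1: "functional ?h = (\<zeta> * sumF ?k + sumT ?k) / c True" .
  note sh = suminf_wt_shift[OF summableF[OF D, of False]]
  note shf = suminf_wt_shift[OF summableF[OF C, of False]]
  have "\<zeta> * sumF ?k + sumT ?k = \<zeta> * (iint 0 True ?k + iint 1 False ?k) +
      ((\<Sum>n. wt n * iint (Suc (Suc n)) False ?k) + (\<Sum>n. wt n * iint (Suc n) True ?k))"
    unfolding sumF_def sumT_def sh(2) using zeta_nz by (simp add: algebra_simps del: iint.simps(2))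
  also have "(\<Sum>n. wt n * iint (Suc (Suc n)) False ?k) + (\<Sum>n. wt n * iint (Suc n) True ?k) =
      (\<Sum>n. wt n * iint (Suc (Suc n)) False ?k + wt n * iint (Suc n) True ?k)"
    by (intro suminf_add sh(1) summableT[OF D])
  also have "\<dots> = (\<Sum>n. (\<zeta> * (wt n * iint (Suc n) True f) + wt n * iint (Suc (Suc n)) False f) / c False)"
    using iint_left_op[OF f, of "Suc _" False]
    by (intro suminf_cong) (simp add: algebra_simps flip: distrib_left del: iint.simps)
  also have "\<dots> = (\<zeta> * sumT f + (\<Sum>n. wt n * iint (Suc (Suc n)) False f)) / c False"
    using summableT[OF C, of True] shf(1) unfolding sumT_def
    by (simp add: suminf_divide suminf_add[symmetric] suminf_mult summable_mult summable_add del: iint.simps)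
  also have "(\<Sum>n. wt n * iint (Suc (Suc n)) False f) = \<zeta> * (sumF f - f [] - iint 1 False f)"
    unfolding sumF_def shf(2) using zeta_nz by simp
  also have "iint 0 True ?k + iint 1 False ?k = (\<zeta> * f [] + iint 1 False f) / c False"
    using iint_left_op[OF f, of 0 False] by simp
  finally have "\<zeta> * sumF ?k + sumT ?k = \<zeta> * (functional f - (1 - \<zeta>) * f []) / c False"
    unfolding functional_def
    by (simp add: algebra_simps add_divide_distrib diff_divide_distrib del: iint.simps)
  then show ?thesis
    using 1 zeta_nz c_nz[of True] c_nz[of False] by (simp add: field_simps)
qed

lemma functional_vacuum: "functional vacuum = 1"
proof -
  have 0: "iint (Suc n) i vacuum = 0" for n i
    by (simp add: vacuum_def iint_zero)
  have "sumF vacuum = (\<Sum>n\<in>{0}. wt n * iint n False vacuum)"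
    unfolding sumF_def
  proof (rule suminf_finite)
    show "wt n * iint n False vacuum = 0" if "n \<notin> {0}" for n
      using 0[of "n - 1" False] that by (cases n) (auto simp del: iint.simps)
  qed simp
  then show ?thesis
    unfolding functional_def sumT_def 0 by (simp add: wt_def vacuum_def)
qed

end

section \<open>Pairing the left functional with the right resolvent vector\<close>

locale resolvent_pair =
  l: resolvent M a \<zeta> c \<phi> + r: resolvent M b \<omega> d \<psi> for M a \<zeta> c \<phi> b \<omega> d \<psi>
begin

definition m :: "bool \<Rightarrow> complex" where
  "m i = (LINT x|M i. l.g i x * r.g i x)"

text \<open>The left weight and the right vector both factor at the first letter, which therefore
  integrates to \<open>m i\<close>. For \<open>n = 0\<close> there is no junction behind it.\<close>

lemma iint_rvec:
  "l.iint (Suc n) i r.rvec = m i * (if n = 0 \<or> i then 1 else 1 / \<omega>) * l.iint n (\<not> i) r.rvec"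
proof -
  let ?w = "if n = 0 \<or> i then 1 else 1 / \<omega>"
  have r1: "regular r.rvec" by (rule l.nice_regular[OF r.nice_rvec])
  have "l.iint n (\<not> i) (\<lambda>ys. r.rvec ((i, x) # ys)) = r.g i x * (?w * l.iint n (\<not> i) r.rvec)" for x
  proof -
    have "l.iint n (\<not> i) (\<lambda>ys. r.rvec ((i, x) # ys)) =
        l.iint n (\<not> i) (\<lambda>ys. r.g i x * ?w * r.rvec ys + 0 * r.rvec ys)"
      by (rule l.iint_cong) (auto simp: r.link_def starts_with_def)
    also have "\<dots> = r.g i x * (?w * l.iint n (\<not> i) r.rvec)"
      using l.iint_linear[OF r1 r1, of n "\<not> i" "r.g i x * ?w" 0] by (simp only: mult_zero_left add_0_right mult.assoc)
    finally show ?thesis .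
  qed
  then show ?thesis by (simp add: m_def flip: mult.assoc)
qed

text \<open>Removing two letters reproduces \<open>sumF\<close> up to the ratio \<open>?q\<close>.
  Since the series is already known to converge, this is a linear equation for its value, and no
  division by \<open>1 - ?q\<close> takes place.\<close>

lemma functional_rvec:
  "l.functional r.rvec * (1 - m True * m False / (\<zeta> * \<omega>)) = (1 + m True) * (1 + m False)"
proof -
  obtain C where C: "fbounded r.rvec C"
    using l.nice_regular[OF r.nice_rvec] by (rule regularE)
  let ?q = "m True * m False / (\<zeta> * \<omega>)"
  have T: "l.sumT r.rvec = m True * l.sumF r.rvec"
    unfolding l.sumT_def l.sumF_def iint_rvec
    by (subst suminf_mult[OF l.summableF[OF C, of False], symmetric]) (simp add: mult_ac)
  have F2: "l.iint (Suc (Suc n)) False r.rvec = (m True * m False / \<omega>) * l.iint n False r.rvec" for n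
    unfolding iint_rvec by simp
  have "l.sumF r.rvec = 1 + m False + (\<Sum>n. l.wt n * ((m True * m False / \<omega>) * l.iint n False r.rvec)) / \<zeta>"
    unfolding l.sumF_def l.suminf_wt_shift(2)[OF l.summableF[OF C, of False]] F2
    by (simp add: iint_rvec del: l.iint.simps(2))
  also have "(\<Sum>n. l.wt n * ((m True * m False / \<omega>) * l.iint n False r.rvec)) =
      (m True * m False / \<omega>) * l.sumF r.rvec"
    unfolding l.sumF_def
    by (subst suminf_mult[OF l.summableF[OF C, of False], symmetric]) (simp add: mult_ac)
  finally have E: "l.sumF r.rvec * (1 - ?q) = 1 + m False"
    using l.zeta_nz r.zeta_nz by (simp add: field_simps)
  have "l.functional r.rvec * (1 - ?q) = (1 + m True) * (l.sumF r.rvec * (1 - ?q))"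
    unfolding l.functional_def T by (simp only: distrib_right mult_1 mult.assoc)
  then show ?thesis unfolding E .
qed

end

section \<open>The transform of the convolution\<close>

lemma le_zero_if_le_geometric:
  fixes x C q :: real
  assumes "\<And>n. x \<le> C * q ^ n" "0 \<le> q" "q < 1"
  shows "x \<le> 0"
proof -
  have "(\<lambda>n. C * q ^ n) \<longlonglongrightarrow> C * 0"
    using assms by (intro tendsto_mult_left LIMSEQ_power_zero) auto
  then show ?thesis using assms(1) by (intro LIMSEQ_le_const) auto
qed

lemma measurable_powi:
  fixes \<sigma> :: "'a \<Rightarrow> complex"
  assumes "\<sigma> \<in> borel_measurable N"
  shows "(\<lambda>x. \<sigma> x powi k) \<in> borel_measurable N"
  using assms by (cases "k \<ge> 0") (simp_all add: power_int_def)

text \<open>\<open>k \<mapsto> \<integral> \<sigma>\<^sup>k h / (1 - z \<sigma>)\<close> solves the same recursion as \<open>A\<close>; the difference of the two solutions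
  is a geometric sequence of ratio \<open>1 / z\<close>, too large in one direction unless it vanishes.\<close>

lemma resolvent_integral:
  fixes \<sigma> h :: "'a \<Rightarrow> complex" and A :: "int \<Rightarrow> complex"
  assumes N: "prob_space N" and meas: "\<sigma> \<in> borel_measurable N" "h \<in> borel_measurable N"
    and \<sigma>: "\<And>x. x \<in> space N \<Longrightarrow> norm (\<sigma> x) = 1"
    and h: "\<And>x. x \<in> space N \<Longrightarrow> norm (h x) \<le> B"
    and A: "\<And>k. (LINT x|N. \<sigma> x powi k * h x) = A k - z * A (k + 1)"
    and A_bound: "\<And>k. norm (A k) \<le> C * K ^ nat \<bar>k\<bar>"
    and K: "K \<ge> 1" and z: "norm z < 1 / K \<or> norm z > K"
  shows "(LINT x|N. h x / (1 - z * \<sigma> x)) = A 0"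
proof -
  interpret prob_space N by fact
  have z1: "norm z \<noteq> 1" using z K by (auto simp: divide_simps)
  define \<delta> where "\<delta> = \<bar>1 - norm z\<bar>"
  have \<delta>: "\<delta> > 0" using z1 by (simp add: \<delta>_def)
  have lower: "norm (1 - z * \<sigma> x) \<ge> \<delta>" if "x \<in> space N" for x
    using norm_triangle_ineq3[of 1 "z * \<sigma> x"] \<sigma>[OF that] by (simp add: norm_mult \<delta>_def)
  have nz: "1 - z * \<sigma> x \<noteq> 0" if "x \<in> space N" for x
    using lower[OF that] \<delta> by auto
  obtain x0 where x0: "x0 \<in> space N" using not_empty by auto
  have B: "B \<ge> 0" using h[OF x0] by (rule order_trans[OF norm_ge_zero])
  have C: "C \<ge> 0" using A_bound[of 0] by (auto intro: order_trans[OF norm_ge_zero])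
  define f where "f k x = \<sigma> x powi k * (h x / (1 - z * \<sigma> x))" for k x
  have f_meas: "f k \<in> borel_measurable N" for k
    unfolding f_def using meas measurable_powi[OF meas(1), of k] by measurable
  have f_bound: "norm (f k x) \<le> B / \<delta>" if "x \<in> space N" for k x
    using h[OF that] lower[OF that] \<delta> B \<sigma>[OF that]
    by (simp add: f_def norm_mult norm_divide norm_power_int frac_le)
  have f_int: "integrable N (f k)" for k
    using f_meas f_bound by (intro integrable_const_bound[of _ "B / \<delta>"]) auto
  define D where "D k = (LINT x|N. f k x)" for k
  have D_bound: "norm (D k) \<le> B / \<delta>" for k
  proof -
    have "norm (D k) \<le> (LINT x|N. norm (f k x))" unfolding D_def by (rule integral_norm_bound)
    also have "\<dots> \<le> B / \<delta>"
      using f_int f_bound by (intro integral_le_const) auto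
    finally show ?thesis .
  qed
  define E where "E k = A k - D k" for k
  have E: "E k = z * E (k + 1)" for k
  proof -
    have "D k - z * D (k + 1) = (LINT x|N. f k x - z * f (k + 1) x)"
      using f_int by (simp add: D_def)
    also have "\<dots> = (LINT x|N. \<sigma> x powi k * h x)"
    proof (rule Bochner_Integration.integral_cong)
      fix x assume x: "x \<in> space N"
      have "\<sigma> x \<noteq> 0" using \<sigma>[OF x] by auto
      then have "\<sigma> x powi (k + 1) = \<sigma> x powi k * \<sigma> x" by (simp add: power_int_add)
      then have "f k x - z * f (k + 1) x =
          (\<sigma> x powi k * h x - z * (\<sigma> x powi k * \<sigma> x * h x)) / (1 - z * \<sigma> x)"
        by (simp add: f_def diff_divide_distrib)
      also have "\<sigma> x powi k * h x - z * (\<sigma> x powi k * \<sigma> x * h x) = \<sigma> x powi k * h x * (1 - z * \<sigma> x)"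
        by (simp add: algebra_simps)
      finally show "f k x - z * f (k + 1) x = \<sigma> x powi k * h x" using nz[OF x] by simp
    qed simp
    finally show ?thesis using A[of k] by (simp add: E_def algebra_simps)
  qed
  have E_bound: "norm (E k) \<le> (C + B / \<delta>) * K ^ nat \<bar>k\<bar>" for k
  proof -
    have "1 * (B / \<delta>) \<le> K ^ nat \<bar>k\<bar> * (B / \<delta>)"
      using K B \<delta> by (intro mult_right_mono one_le_power) auto
    moreover have "norm (E k) \<le> norm (A k) + norm (D k)" unfolding E_def by (rule norm_triangle_ineq4)
    ultimately show ?thesis using A_bound[of k] D_bound[of k] by (simp add: algebra_simps)
  qed
  have E_up: "E 0 = z ^ n * E (int n)" for n
  proof (induction n)
    case (Suc n)
    then show ?case using E[of "int n"] by (simp add: algebra_simps)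
  qed simp
  have E_down: "E (- int n) = z ^ n * E 0" for n
  proof (induction n)
    case (Suc n)
    then show ?case using E[of "- int (Suc n)"] by (simp add: algebra_simps)
  qed simp
  \<comment> \<open>For small \<open>z\<close> the growth bound is violated at positive indices, for
    large \<open>z\<close> at negative ones, unless \<open>E 0\<close> vanishes.\<close>
  have "norm (E 0) \<le> 0"
    using z
  proof
    assume z: "norm z < 1 / K"
    show ?thesis
    proof (rule le_zero_if_le_geometric)
      fix n
      have "norm (E 0) = norm z ^ n * norm (E (int n))"
        using arg_cong[OF E_up[of n], of norm] by (simp add: norm_mult norm_power)
      also have "\<dots> \<le> norm z ^ n * ((C + B / \<delta>) * K ^ n)"
        using E_bound[of "int n"] by (intro mult_left_mono) auto
      also have "\<dots> = (C + B / \<delta>) * (norm z * K) ^ n" by (simp add: power_mult_distrib)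
      finally show "norm (E 0) \<le> (C + B / \<delta>) * (norm z * K) ^ n" .
    qed (use z K in \<open>auto simp: field_simps\<close>)
  next
    assume z: "norm z > K"
    then have z0: "norm z > 0" using K by linarith
    show ?thesis
    proof (rule le_zero_if_le_geometric)
      fix n
      have "norm (E 0) = norm (E (- int n)) / norm z ^ n"
        using arg_cong[OF E_down[of n], of norm] z0 by (simp add: norm_mult norm_power)
      also have "\<dots> \<le> ((C + B / \<delta>) * K ^ n) / norm z ^ n"
        using E_bound[of "- int n"] by (intro divide_right_mono) auto
      also have "\<dots> = (C + B / \<delta>) * (K / norm z) ^ n" by (simp add: power_divide)
      finally show "norm (E 0) \<le> (C + B / \<delta>) * (K / norm z) ^ n" .
    qed (use z z0 K in \<open>auto simp: field_simps\<close>)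
  qed
  then have "A 0 = D 0" by (simp add: E_def)
  then show ?thesis by (simp add: D_def f_def)
qed

lemma torus_probsD:
  assumes "\<mu> \<in> torus_probs"
  shows "prob_space \<mu>" "space \<mu> = torus" "\<And>x. x \<in> space \<mu> \<Longrightarrow> norm (fst x) = 1 \<and> norm (snd x) = 1"
    "fst \<in> borel_measurable \<mu>" "snd \<in> borel_measurable \<mu>"
proof -
  interpret torus_family "\<lambda>_::unit. \<mu>" by unfold_locales fact
  show "prob_space \<mu>" "space \<mu> = torus" by (rule prob_space_M space_M)+
  then show "\<And>x. x \<in> space \<mu> \<Longrightarrow> norm (fst x) = 1 \<and> norm (snd x) = 1" using torus_norm by blast
  show "fst \<in> borel_measurable \<mu>" "snd \<in> borel_measurable \<mu>"
    by (intro measurable_continuous continuous_intros)+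
qed

section \<open>Resolvent integrals of the convolution\<close>

locale bifree_pair =
  resolvent_pair M fst \<zeta> c \<phi> snd \<omega> d \<psi> for M \<zeta> c \<phi> \<omega> d \<psi> +
  fixes \<mu> :: "(complex \<times> complex) measure"
  assumes convolution: "is_bifree_convolution (M True) (M False) \<mu>"
    and z_region: "norm (c True * c False / \<zeta>) < 1 / 16 \<or> norm (c True * c False / \<zeta>) > 16"
    and w_region: "norm (d True * d False / \<omega>) < 1 / 16 \<or> norm (d True * d False / \<omega>) > 16"
begin

definition U where "U = left_op M True fst \<circ> left_op M False fst"
definition U' where "U' = left_op M False (\<lambda>x. inverse (fst x)) \<circ> left_op M True (\<lambda>x. inverse (fst x))"
definition V where "V = right_op M True snd \<circ> right_op M False snd"
definition V' where "V' = right_op M False (\<lambda>x. inverse (snd x)) \<circ> right_op M True (\<lambda>x. inverse (snd x))"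

abbreviation "Up \<equiv> op_powi U U'"
abbreviation "Vp \<equiv> op_powi V V'"
abbreviation "z \<equiv> c True * c False / \<zeta>"
abbreviation "w \<equiv> d True * d False / \<omega>"

lemma moments: "(LINT x|\<mu>. fst x powi p * snd x powi q) = Up p (Vp q vacuum) []"
proof -
  have "case_bool (M True) (M False) = M" by (auto split: bool.split)
  then show ?thesis
    using convolution
    by (simp add: is_bifree_convolution_def bifree_moment_def fp_inner_vacuum U_def U'_def V_def V'_def Let_def)
qed

lemma mu_torus_probs: "\<mu> \<in> torus_probs"
  using convolution by (simp add: is_bifree_convolution_def)

lemma good_UV: "l.good_op 16 U" "l.good_op 16 U'" "l.good_op 16 V" "l.good_op 16 V'"
  using l.good_op_comp[OF l.good_op_left l.good_op_left, of fst fst True False]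
    l.good_op_comp[OF l.good_op_left l.good_op_left, of "\<lambda>x. inverse (fst x)" "\<lambda>x. inverse (fst x)" False True]
    l.good_op_comp[OF l.good_op_right l.good_op_right, of snd snd True False]
    l.good_op_comp[OF l.good_op_right l.good_op_right, of "\<lambda>x. inverse (snd x)" "\<lambda>x. inverse (snd x)" False True]
  by (simp_all add: U_def U'_def V_def V'_def unimodular_fst unimodular_snd unimodular_inverse)

lemma inverse_UV: "l.inverse_ops U U'" "l.inverse_ops V V'"
  unfolding U_def U'_def V_def V'_def
  by (rule l.inverse_ops_comp[where K = 4]; intro l.good_op_left l.good_op_right l.inverse_ops_left
      l.inverse_ops_right unimodular_fst unimodular_snd unimodular_inverse)+

lemma nice_powi: "l.nice f \<Longrightarrow> l.nice (Up k f)" "l.nice f \<Longrightarrow> l.nice (Vp k f)"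
  using l.good_opD(1)[OF l.good_op_powi[OF good_UV(1,2)]] l.good_opD(1)[OF l.good_op_powi[OF good_UV(3,4)]]
  by auto

lemma bounded_powi:
  "fbounded f C \<Longrightarrow> fbounded (Up k f) (16 ^ nat \<bar>k\<bar> * C)"
  "fbounded f C \<Longrightarrow> fbounded (Vp k f) (16 ^ nat \<bar>k\<bar> * C)"
  using l.good_opD(4)[OF l.good_op_powi[OF good_UV(1,2)]] l.good_opD(4)[OF l.good_op_powi[OF good_UV(3,4)]]
  by auto

text \<open>The moments have the powers of \<open>U\<close> outside those of \<open>V\<close>, so
  \<open>functional_resolvent\<close>, applied to \<open>Up p (Vp k vacuum)\<close>, is the
  recursion in \<open>p\<close> required by \<open>resolvent_integral\<close>. The exponent
  \<open>k\<close> stays free: \<open>H2_functional\<close> needs all of them.\<close>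

lemma integral_left:
  "(LINT x|\<mu>. (1 - \<zeta>) * snd x powi k / (1 - z * fst x)) = l.functional (Vp k vacuum)"
proof -
  note P = torus_probsD[OF mu_torus_probs]
  let ?f = "\<lambda>p. Up p (Vp k vacuum)"
  have nice: "l.nice (?f p)" for p by (intro nice_powi l.nice_vacuum)
  have "fbounded (vacuum :: bool fpvec) 1" by (simp add: fbounded_def vacuum_def)
  then have bounded: "fbounded (?f p) (16 ^ nat \<bar>p\<bar> * (16 ^ nat \<bar>k\<bar> * 1))" for p
    by (intro bounded_powi)
  have "(LINT x|\<mu>. (1 - \<zeta>) * snd x powi k / (1 - z * fst x)) = l.functional (?f 0)"
  proof (rule resolvent_integral[where A = "\<lambda>p. l.functional (?f p)" and K = 16
        and C = "8 * l.Gam * 16 ^ nat \<bar>k\<bar>" and B = "norm (1 - \<zeta>)"])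
    fix p
    have "(LINT x|\<mu>. fst x powi p * ((1 - \<zeta>) * snd x powi k)) =
        (LINT x|\<mu>. (1 - \<zeta>) * (fst x powi p * snd x powi k))" by (simp add: mult_ac)
    also have "\<dots> = (1 - \<zeta>) * ?f p []" by (simp add: moments)
    also have "\<dots> = l.functional (?f p) - z * l.functional (U (?f p))"
      using l.functional_resolvent[OF nice] by (simp add: U_def)
    also have "l.functional (U (?f p)) = l.functional (?f (p + 1))"
      by (rule l.functional_cong[OF l.op_powi_add1(1)[OF good_UV(1,2) inverse_UV(1)]])
        (intro nice_powi l.nice_vacuum)
    finally show "(LINT x|\<mu>. fst x powi p * ((1 - \<zeta>) * snd x powi k)) =
        l.functional (?f p) - z * l.functional (?f (p + 1))" .
    show "norm (l.functional (?f p)) \<le> 8 * l.Gam * 16 ^ nat \<bar>k\<bar> * 16 ^ nat \<bar>p\<bar>"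
      using l.functional_bound[OF bounded[of p]] by (simp add: mult_ac)
  qed (use P z_region measurable_powi[OF P(5)] in \<open>auto simp: norm_mult norm_power_int\<close>)
  then show ?thesis by (simp add: op_powi_def)
qed

lemma rvec_powi:
  "Vp k r.rvec \<doteq> (\<lambda>xs. w * Vp (k + 1) r.rvec xs + (1 - \<omega>) * Vp k vacuum xs)"
proof -
  note G = l.good_op_powi[OF good_UV(3,4), of k]
  have "Vp k r.rvec \<doteq> Vp k (\<lambda>xs. w * V r.rvec xs + (1 - \<omega>) * vacuum xs)"
    using r.rvec_resolvent by (intro l.good_opD(2)[OF G]) (simp add: V_def)
  also have "\<dots> \<doteq> (\<lambda>xs. w * Vp k (V r.rvec) xs + (1 - \<omega>) * Vp k vacuum xs)"
    by (intro l.good_opD(3)[OF G] l.good_opD(1)[OF good_UV(3)] r.nice_rvec l.nice_vacuum)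
  also have "\<dots> \<doteq> (\<lambda>xs. w * Vp (k + 1) r.rvec xs + (1 - \<omega>) * Vp k vacuum xs)"
    using l.op_powi_add1(2)[OF good_UV(3,4) inverse_UV(2) r.nice_rvec, of k] by (simp add: fequiv_def)
  finally show ?thesis .
qed

text \<open>The case \<open>k = 0\<close>, with \<open>functional vacuum = 1\<close>. By
  \<open>eta_eq_iff\<close> it makes \<open>z\<close> a preimage of \<open>\<zeta>\<close> under
  \<open>eta\<close> of the first marginal of \<open>\<mu>\<close>.\<close>

lemma psi_left: "(1 - \<zeta>) * (LINT x|\<mu>. 1 / (1 - z * fst x)) = 1"
proof -
  have "(1 - \<zeta>) * (LINT x|\<mu>. 1 / (1 - z * fst x)) = (LINT x|\<mu>. (1 - \<zeta>) * (1 / (1 - z * fst x)))"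
    by (rule integral_mult_right_zero[symmetric])
  also have "\<dots> = (LINT x|\<mu>. (1 - \<zeta>) * snd x powi 0 / (1 - z * fst x))" by simp
  also have "\<dots> = 1"
    unfolding integral_left by (simp add: op_powi_def l.functional_vacuum)
  finally show ?thesis .
qed

lemma psi_right: "(1 - \<omega>) * (LINT x|\<mu>. 1 / (1 - w * snd x)) = 1"
proof -
  note P = torus_probsD[OF mu_torus_probs]
  obtain C where C: "fbounded r.rvec C" using l.nice_regular[OF r.nice_rvec] by (rule regularE)
  have "(LINT x|\<mu>. (1 - \<omega>) / (1 - w * snd x)) = Vp 0 r.rvec []"
  proof (rule resolvent_integral[where A = "\<lambda>p. Vp p r.rvec []" and K = 16 and C = C
        and B = "norm (1 - \<omega>)"])
    fix p
    show "(LINT x|\<mu>. snd x powi p * (1 - \<omega>)) = Vp p r.rvec [] - w * Vp (p + 1) r.rvec []"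
      using rvec_powi[of p] moments[of 0 p] by (simp add: fequiv_def op_powi_def[of U])
    show "norm (Vp p r.rvec []) \<le> C * 16 ^ nat \<bar>p\<bar>"
      using fboundedD[OF bounded_powi(2)[OF C, of p], of "[]"] by (simp add: mult.commute)
  qed (use P w_region in auto)
  then show ?thesis by (simp add: op_powi_def flip: integral_mult_right_zero)
qed

text \<open>A second resolvent integral, now in the other coordinate, with the kernel in
  \<open>z\<close> as the bounded function; \<open>integral_left\<close> evaluates its moments and
  \<open>rvec_powi\<close> turns them into a recursion.\<close>

lemma H2_functional: "(1 - \<zeta>) * (1 - \<omega>) * H2 \<mu> z w = l.functional r.rvec"
proof -
  note P = torus_probsD[OF mu_torus_probs]
  obtain C where C: "fbounded r.rvec C" using l.nice_regular[OF r.nice_rvec] by (rule regularE)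
  have z1: "norm z \<noteq> 1" using z_region by auto
  let ?h = "\<lambda>x. (1 - \<zeta>) * (1 - \<omega>) / (1 - z * fst x)"
  have "(LINT x|\<mu>. ?h x / (1 - w * snd x)) = l.functional (Vp 0 r.rvec)"
  proof (rule resolvent_integral[where A = "\<lambda>p. l.functional (Vp p r.rvec)" and K = 16
        and C = "8 * l.Gam * C" and B = "norm ((1 - \<zeta>) * (1 - \<omega>)) / \<bar>1 - norm z\<bar>"])
    fix p
    have "(LINT x|\<mu>. snd x powi p * ?h x) =
        (LINT x|\<mu>. (1 - \<omega>) * ((1 - \<zeta>) * snd x powi p / (1 - z * fst x)))"
      by (simp add: mult_ac)
    also have "\<dots> = (1 - \<omega>) * l.functional (Vp p vacuum)"
      by (simp only: integral_mult_right_zero integral_left)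
    also have "\<dots> = l.functional (Vp p r.rvec) - w * l.functional (Vp (p + 1) r.rvec)"
      unfolding l.functional_cong[OF rvec_powi[of p]]
      by (subst l.functional_linear) (auto intro!: l.nice_regular nice_powi r.nice_rvec l.nice_vacuum)
    finally show "(LINT x|\<mu>. snd x powi p * ?h x) =
        l.functional (Vp p r.rvec) - w * l.functional (Vp (p + 1) r.rvec)" .
    show "norm (l.functional (Vp p r.rvec)) \<le> 8 * l.Gam * C * 16 ^ nat \<bar>p\<bar>"
      using l.functional_bound[OF bounded_powi(2)[OF C, of p]] by (simp add: mult_ac)
  next
    fix x assume x: "x \<in> space \<mu>"
    have "\<bar>1 - norm z\<bar> \<le> norm (1 - z * fst x)"
      using norm_triangle_ineq3[of 1 "z * fst x"] P(3)[OF x] by (simp add: norm_mult norm_divide)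
    then show "norm (?h x) \<le> norm ((1 - \<zeta>) * (1 - \<omega>)) / \<bar>1 - norm z\<bar>"
      using z1 unfolding norm_divide[of "(1 - \<zeta>) * (1 - \<omega>)"] by (intro frac_le) auto
  qed (use P w_region in auto)
  then show ?thesis
    by (simp add: op_powi_def H2_def mult_ac flip: integral_mult_right_zero)
qed

lemma m_eq: "1 + m i = (1 - \<zeta>) * (1 - \<omega>) * H2 (M i) (c i) (d i)"
proof -
  let ?G = "\<lambda>x. 1 + l.g i x" and ?F = "\<lambda>x. 1 + r.g i x"
  have cont: "continuous_on torus (l.g i)" "continuous_on torus (r.g i)"
    by (rule l.g_continuous r.g_continuous)+
  have "(1 - \<zeta>) * (1 - \<omega>) * H2 (M i) (c i) (d i) = (LINT x|M i. ?G x * ?F x)"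
    by (simp add: H2_def l.g_def r.g_def flip: integral_mult_right_zero)
  also have "\<dots> = (LINT x|M i. 1 + l.g i x + r.g i x + l.g i x * r.g i x)"
    by (simp add: algebra_simps)
  also have "\<dots> = 1 + m i"
    using cont by (simp add: m_def l.integrable_continuous continuous_intros l.integral_g r.integral_g)
  finally show ?thesis by simp
qed

lemma H2_product:
  "(1 - \<zeta>) * (1 - \<omega>) * H2 \<mu> z w * (1 - m True * m False / (\<zeta> * \<omega>)) = (1 + m True) * (1 + m False)"
  unfolding H2_functional by (rule functional_rvec)

end

section \<open>The inverses of \<open>eta\<close> near zero and infinity\<close>

lemma reciprocal_bounds:
  fixes y x :: complex
  assumes "norm x = 1" "norm y \<noteq> 1"
  shows "1 - y * x \<noteq> 0" "norm (1 / (1 - y * x)) \<le> 1 / \<bar>1 - norm y\<bar>"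
proof -
  have l: "\<bar>1 - norm y\<bar> \<le> norm (1 - y * x)"
    using norm_triangle_ineq3[of 1 "y * x"] assms by (simp add: norm_mult)
  then show nz: "1 - y * x \<noteq> 0" using assms by auto
  show "norm (1 / (1 - y * x)) \<le> 1 / \<bar>1 - norm y\<bar>"
    using l assms unfolding norm_divide by (intro frac_le) auto
qed

section \<open>The functions \<open>psi1\<close> and \<open>eta\<close> of a measure on the
  circle\<close>

locale circle_measure = prob_space \<nu> for \<nu> :: "complex measure" +
  assumes sets_circle: "sets \<nu> = sets circle_borel"
begin

lemma space_circle: "space \<nu> = sphere 0 1"
  using sets_eq_imp_space_eq[OF sets_circle] by (simp add: circle_borel_def space_restrict_space)

lemma norm_1: "x \<in> space \<nu> \<Longrightarrow> norm x = 1"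
  by (simp add: space_circle)

lemma id_measurable [measurable]: "(\<lambda>x. x) \<in> borel_measurable \<nu>"
proof -
  have "(\<lambda>x. x) \<in> borel_measurable (restrict_space borel (sphere (0::complex) 1))"
    by (rule measurable_restrict_space1) simp
  then show ?thesis
    using measurable_cong_sets[OF sets_circle refl, of "borel :: complex measure"] by (simp add: circle_borel_def)
qed

lemma integrable_reciprocal: "norm y \<noteq> 1 \<Longrightarrow> integrable \<nu> (\<lambda>x. 1 / (1 - y * x))"
  by (rule integrable_const_bound[of _ "1 / \<bar>1 - norm y\<bar>"], rule AE_I2,
      rule reciprocal_bounds(2)[OF norm_1]) measurable

lemma psi1_eq:
  assumes y: "norm y \<noteq> 1"
  shows "1 + psi1 \<nu> y = (LINT x|\<nu>. 1 / (1 - y * x))"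
proof -
  have "psi1 \<nu> y = (LINT x|\<nu>. 1 / (1 - y * x) - 1)"
    unfolding psi1_def
    using reciprocal_bounds(1)[OF norm_1 y]
    by (intro Bochner_Integration.integral_cong) (auto simp: field_simps)
  also have "\<dots> = (LINT x|\<nu>. 1 / (1 - y * x)) - 1"
    using integrable_reciprocal[OF y] by (simp add: prob_space)
  finally show ?thesis by simp
qed

text \<open>The condition \<open>\<zeta> \<noteq> 0\<close> keeps apart the default value that
  \<open>eta\<close> has where \<open>1 + psi1\<close> vanishes.\<close>

lemma eta_eq_iff:
  assumes y: "norm y \<noteq> 1" and \<zeta>: "\<zeta> \<noteq> 0"
  shows "eta \<nu> y = \<zeta> \<longleftrightarrow> (1 - \<zeta>) * (LINT x|\<nu>. 1 / (1 - y * x)) = 1"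
proof -
  have "psi1 \<nu> y / (1 + psi1 \<nu> y) = \<zeta> \<longleftrightarrow> (1 - \<zeta>) * (1 + psi1 \<nu> y) = 1"
  proof (cases "1 + psi1 \<nu> y = 0")
    case False
    then show ?thesis by (simp add: divide_eq_eq) (auto simp: algebra_simps)
  qed (use \<zeta> in auto)
  then show ?thesis by (simp add: eta_def psi1_eq[OF y])
qed

lemma eta_0 [simp]: "eta \<nu> 0 = 0"
  by (simp add: eta_def psi1_def)

lemma psi1_reflection:
  assumes y: "norm y \<noteq> 1" "y \<noteq> 0"
  shows "psi1 \<nu> (1 / cnj y) = - (1 + cnj (psi1 \<nu> y))"
proof -
  have "psi1 \<nu> (1 / cnj y) = (LINT x|\<nu>. - cnj (1 / (1 - y * x)))"
    unfolding psi1_def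
  proof (rule Bochner_Integration.integral_cong)
    fix x assume x: "x \<in> space \<nu>"
    have xx: "x * cnj x = 1" using norm_1[OF x] by (simp add: complex_norm_square[symmetric])
    have n: "1 - cnj y * cnj x \<noteq> 0"
      using reciprocal_bounds(1)[OF norm_1[OF x] y(1)] by (metis complex_cnj_diff complex_cnj_mult complex_cnj_one complex_cnj_zero_iff)
    have "1 - 1 / cnj y * x = - (x / cnj y) * (1 - cnj y * cnj x)"
      using y xx by (simp add: field_simps)
    moreover have "x \<noteq> 0" using xx by auto
    ultimately show "1 / cnj y * x / (1 - 1 / cnj y * x) = - cnj (1 / (1 - y * x))"
      using y n by simp
  qed simp
  also have "\<dots> = - cnj (1 + psi1 \<nu> y)"
    unfolding psi1_eq[OF y(1)] by (simp only: integral_minus Bochner_Integration.integral_cnj)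
  finally show ?thesis by simp
qed

text \<open>Reduces infinity to zero. At zeros and poles of \<open>eta\<close> both sides are 0 by
  the convention for division, so there are no exceptional points.\<close>

lemma eta_reflection:
  assumes "norm y \<noteq> 1" "y \<noteq> 0"
  shows "eta \<nu> (1 / cnj y) = 1 / cnj (eta \<nu> y)"
  unfolding eta_def psi1_reflection[OF assms] by (simp add: diff_divide_distrib add_divide_distrib)

text \<open>Quantitative injectivity from the derivative \<open>mean \<nu>\<close> at 0. The radius,
  a sixteenth of its modulus, keeps the kernel integral \<open>?I\<close> within half of the mean;
  the denominators contribute another factor 2.\<close>

lemma eta_expanding_near_0:
  assumes m: "mean \<nu> \<noteq> 0"
  obtains \<epsilon> c where "0 < \<epsilon>" "\<epsilon> \<le> 1 / 2" "0 < c"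
    "\<And>y y'. norm y < \<epsilon> \<Longrightarrow> norm y' < \<epsilon> \<Longrightarrow> c * norm (y - y') \<le> norm (eta \<nu> y - eta \<nu> y')"
proof
  let ?m = "norm (mean \<nu>)" and ?e = "norm (mean \<nu>) / 16"
  have m1: "?m \<le> 1" unfolding mean_def using norm_1 by (intro norm_integral_le) auto
  show "0 < ?e" "?e \<le> 1 / 2" "0 < ?m / 4" using m m1 by auto
  fix y y' :: complex assume y: "norm y < ?e" and y': "norm y' < ?e"
  have small: "norm y < 1 / 16" "norm y' < 1 / 16" using y y' m1 by auto
  have n1: "norm y \<noteq> 1" "norm y' \<noteq> 1" using small by auto
  let ?I = "LINT x|\<nu>. x / ((1 - y * x) * (1 - y' * x))"
  have lower: "norm (1 - u * x) \<ge> 15 / 16" if "x \<in> space \<nu>" "norm u < 1 / 16" for u x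
    using norm_triangle_ineq2[of 1 "u * x"] norm_1[OF that(1)] that(2) by (simp add: norm_mult)
  have int: "integrable \<nu> (\<lambda>x. x / ((1 - y * x) * (1 - y' * x)))"
  proof (rule integrable_const_bound[of _ 2])
    show "AE x in \<nu>. norm (x / ((1 - y * x) * (1 - y' * x))) \<le> 2"
    proof (rule AE_I2)
      fix x assume x: "x \<in> space \<nu>"
      have "15 / 16 * (15 / 16) \<le> norm (1 - y * x) * norm (1 - y' * x)"
        by (intro mult_mono lower x small) auto
      then have "norm x / (norm (1 - y * x) * norm (1 - y' * x)) \<le> 1 / (15 / 16 * (15 / 16))"
        using norm_1[OF x] by (intro frac_le) auto
      also have "\<dots> \<le> 2" by simp
      finally show "norm (x / ((1 - y * x) * (1 - y' * x))) \<le> 2"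
        unfolding norm_mult norm_divide .
    qed
  qed measurable
  have psi_diff: "psi1 \<nu> y - psi1 \<nu> y' = (y - y') * ?I"
  proof -
    have "(1 + psi1 \<nu> y) - (1 + psi1 \<nu> y') = (LINT x|\<nu>. 1 / (1 - y * x) - 1 / (1 - y' * x))"
      unfolding psi1_eq[OF n1(1)] psi1_eq[OF n1(2)] using integrable_reciprocal n1 by simp
    also have "\<dots> = (LINT x|\<nu>. (y - y') * (x / ((1 - y * x) * (1 - y' * x))))"
      using reciprocal_bounds(1)[OF norm_1 n1(1)] reciprocal_bounds(1)[OF norm_1 n1(2)]
      by (intro Bochner_Integration.integral_cong) (auto simp: field_simps)
    also have "\<dots> = (y - y') * ?I" by (rule integral_mult_right_zero)
    finally show ?thesis by simp
  qed
  have "norm (?I - mean \<nu>) \<le> ?m / 2"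
  proof -
    have "?I - mean \<nu> = (LINT x|\<nu>. x / ((1 - y * x) * (1 - y' * x)) - x)"
      unfolding mean_def using int norm_1
      by (subst Bochner_Integration.integral_diff) (auto intro!: integrable_const_bound[of _ 1])
    also have "norm \<dots> \<le> ?m / 2"
    proof (rule norm_integral_le)
      fix x assume x: "x \<in> space \<nu>"
      let ?d = "(1 - y * x) * (1 - y' * x)"
      have d: "norm ?d \<ge> 1 / 2"
      proof -
        have "15 / 16 * (15 / 16) \<le> norm (1 - y * x) * norm (1 - y' * x)"
          by (intro mult_mono lower x small) auto
        then show ?thesis by (simp add: norm_mult)
      qed
      then have "?d \<noteq> 0" by auto
      then have "x / ?d - x = x * (y * x + y' * x - (y * x) * (y' * x)) / ?d"
        by (simp add: field_simps)
      also have "norm \<dots> \<le> (norm y + norm y' + norm y * norm y') / (1 / 2)"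
        unfolding norm_divide norm_mult[of x] norm_1[OF x]
        using norm_triangle_ineq4[of "y * x + y' * x" "(y * x) * (y' * x)"]
          norm_triangle_ineq[of "y * x" "y' * x"] d norm_1[OF x]
        by (intro frac_le) (auto simp: norm_mult)
      also have "norm y * norm y' \<le> norm y * 1" using small by (intro mult_left_mono) auto
      finally have "norm (x / ?d - x) \<le> 4 * norm y + 2 * norm y'" by simp
      then show "norm (x / ?d - x) \<le> ?m / 2"
        using y y' norm_ge_zero[of "mean \<nu>"] by linarith
    qed simp
    finally show ?thesis .
  qed
  then have I: "norm ?I \<ge> ?m / 2"
    using norm_triangle_ineq3[of ?I "mean \<nu>"] by linarith
  have psi: "norm (psi1 \<nu> u) \<le> 1 / 8" if u: "norm u < 1 / 16" for u
    unfolding psi1_def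
  proof (rule norm_integral_le)
    fix x assume x: "x \<in> space \<nu>"
    have "norm (u * x / (1 - u * x)) \<le> (1 / 16) / (15 / 16)"
      unfolding norm_divide using u lower[OF x u] norm_1[OF x] by (intro frac_le) (auto simp: norm_mult)
    then show "norm (u * x / (1 - u * x)) \<le> 1 / 8" by simp
  qed simp
  let ?A = "1 + psi1 \<nu> y" and ?B = "1 + psi1 \<nu> y'"
  have A: "norm ?A \<le> 9 / 8" "norm ?A \<ge> 7 / 8" "norm ?B \<le> 9 / 8" "norm ?B \<ge> 7 / 8"
    using psi[OF small(1)] psi[OF small(2)] norm_triangle_ineq[of 1 "psi1 \<nu> y"] norm_triangle_ineq[of 1 "psi1 \<nu> y'"]
      norm_diff_ineq[of 1 "psi1 \<nu> y"] norm_diff_ineq[of 1 "psi1 \<nu> y'"] by auto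
  then have nz: "?A \<noteq> 0" "?B \<noteq> 0" by auto
  then have "eta \<nu> y - eta \<nu> y' = (psi1 \<nu> y - psi1 \<nu> y') / (?A * ?B)"
    unfolding eta_def by (simp add: field_simps)
  then have eq: "norm (eta \<nu> y - eta \<nu> y') = norm (y - y') * norm ?I / (norm ?A * norm ?B)"
    unfolding psi_diff by (simp add: norm_mult norm_divide)
  have "norm ?A * norm ?B \<le> 9 / 8 * (9 / 8)" using A by (intro mult_mono) auto
  then have "norm ?A * norm ?B \<le> 2" by simp
  then have "norm (y - y') * (?m / 2) / 2 \<le> norm (y - y') * norm ?I / (norm ?A * norm ?B)"
    using I nz by (intro frac_le mult_left_mono) (auto intro!: mult_pos_pos)
  then show "?m / 4 * norm (y - y') \<le> norm (eta \<nu> y - eta \<nu> y')" unfolding eq by (simp add: mult_ac)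
qed

end

section \<open>The identity theorem on discs and exteriors\<close>

lemma open_Delta: "open (Delta r)"
  unfolding Delta_def by (intro open_Collect_less continuous_intros)

lemma open_DDelta: "open (DDelta r)"
  unfolding DDelta_def by (intro open_Un open_ball open_Delta)

lemma connected_Delta: "connected (Delta r)"
proof -
  have "Delta r = - cball 0 (1 / r)" by (auto simp: Delta_def)
  then show ?thesis by (simp add: connected_complement_bounded_convex)
qed

lemma DDelta_mono:
  assumes "0 < \<delta>" "\<delta> \<le> r"
  shows "DDelta \<delta> \<subseteq> DDelta r"
proof -
  have "1 / r \<le> 1 / \<delta>" using assms by (intro divide_left_mono) auto
  then show ?thesis using assms by (auto simp: DDelta_def Delta_def)
qed

text \<open>The disc and the exterior are handled separately, each being connected. Equality is
  asked away from 0 only, because on the axes \<open>bifree_Sigma\<close> is a limit and not a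
  quotient.\<close>

lemma continuation_DDelta:
  assumes r: "0 < \<delta>" "\<delta> \<le> r" and f: "f holomorphic_on DDelta r" and h: "h holomorphic_on DDelta r"
    and eq: "\<And>z. z \<in> DDelta \<delta> \<Longrightarrow> z \<noteq> 0 \<Longrightarrow> f z = h z" and z: "z \<in> DDelta r"
  shows "f z = h z"
proof -
  have sub: "DDelta \<delta> \<subseteq> DDelta r" using r by (rule DDelta_mono)
  have holo: "f holomorphic_on S" "h holomorphic_on S" if "S \<subseteq> DDelta r" for S
    using f h that holomorphic_on_subset by blast+
  consider "z \<in> ball 0 r" | "z \<in> Delta r" using z by (auto simp: DDelta_def)
  then show ?thesis
  proof cases
    case 1
    have "of_real (\<delta> / 2) \<in> ball (0::complex) \<delta> - {0}" using r by simp
    then have ne: "ball (0::complex) \<delta> - {0} \<noteq> {}" by blast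
    show ?thesis
      by (rule analytic_continuation_open[of "ball 0 \<delta> - {0}" "ball 0 r" f h])
        (use ne r 1 in \<open>auto intro!: holo eq simp: DDelta_def\<close>)
  next
    case 2
    have "1 / r > 0" using r by simp
    have "norm (of_real (1 / \<delta> + 1) :: complex) = 1 / \<delta> + 1"
      unfolding norm_of_real using r by simp
    then have "of_real (1 / \<delta> + 1) \<in> Delta \<delta>" unfolding Delta_def by simp
    then have ne: "Delta \<delta> \<noteq> {}" by blast
    have D: "Delta \<delta> \<subseteq> Delta r"
      using divide_left_mono[of \<delta> r 1] r by (auto simp: Delta_def)
    have "0 \<notin> Delta \<delta>" using r by (auto simp: Delta_def)
    then have e: "f y = h y" if "y \<in> Delta \<delta>" for y
      using that by (intro eq) (auto simp: DDelta_def)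
    have "Delta r \<subseteq> DDelta r" by (simp add: DDelta_def)
    from analytic_continuation_open[OF open_Delta open_Delta ne connected_Delta D holo[OF this] e 2]
    show ?thesis .
  qed
qed

section \<open>Uniqueness and local behaviour of the inverse\<close>

context circle_measure
begin

text \<open>In the disc, preimages close to 0 are unique by the expansion estimate. Near infinity
  the pole makes \<open>g (1 / cnj \<zeta>)\<close> so large that its reflection falls into the disc
  of injectivity, where it has to be \<open>g \<zeta>\<close>.\<close>

lemma eta_inverse_local:
  assumes m: "mean \<nu> \<noteq> 0" and r: "0 < r" and g: "is_eta_inverse \<nu> r g"
  obtains \<delta> C where "0 < \<delta>" "\<delta> \<le> r" "0 < C"
    "\<And>\<zeta> y. norm \<zeta> < \<delta> \<Longrightarrow> norm y < \<delta> \<Longrightarrow> eta \<nu> y = \<zeta> \<Longrightarrow> g \<zeta> = y"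
    "\<And>\<zeta>. norm \<zeta> < \<delta> \<Longrightarrow> norm (g \<zeta>) \<le> C * norm \<zeta>"
    "\<And>\<zeta>. 0 < norm \<zeta> \<Longrightarrow> norm \<zeta> < \<delta> \<Longrightarrow> g (1 / cnj \<zeta>) = 1 / cnj (g \<zeta>)"
proof -
  obtain \<epsilon> c where \<epsilon>: "0 < \<epsilon>" "\<epsilon> \<le> 1 / 2" "0 < c"
    and expand: "\<And>y y'. norm y < \<epsilon> \<Longrightarrow> norm y' < \<epsilon> \<Longrightarrow> c * norm (y - y') \<le> norm (eta \<nu> y - eta \<nu> y')"
    using m by (rule eta_expanding_near_0) blast
  have g0: "g 0 = 0" and inv: "\<And>z. z \<in> DDelta r \<Longrightarrow> eta \<nu> (g z) = z"
    and pole: "is_pole (\<lambda>\<zeta>. g (1 / \<zeta>)) 0" and holo: "g holomorphic_on DDelta r"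
    using g by (auto simp: is_eta_inverse_def)
  have inj: "y = y'" if "norm y < \<epsilon>" "norm y' < \<epsilon>" "eta \<nu> y = eta \<nu> y'" for y y'
  proof -
    have "c * norm (y - y') \<le> 0" using expand[OF that(1,2)] that(3) by simp
    then show ?thesis using \<epsilon>(3) by (simp add: mult_le_0_iff)
  qed
  have "isCont g 0"
    using holomorphic_on_imp_continuous_on[OF holo] open_DDelta r
    by (subst (asm) continuous_on_eq_continuous_at) (auto simp: DDelta_def)
  then obtain \<delta>1 where \<delta>1: "\<delta>1 > 0" "\<And>\<zeta>. norm \<zeta> < \<delta>1 \<Longrightarrow> norm (g \<zeta>) < \<epsilon>"
    using \<epsilon>(1) g0 unfolding continuous_at_eps_delta by auto
  have "eventually (\<lambda>\<zeta>. norm (g (1 / \<zeta>)) \<ge> 1 / \<epsilon> + 1) (at 0)"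
    using pole \<epsilon>(1) unfolding is_pole_def filterlim_at_infinity[OF order.refl]
    by (meson add_pos_pos zero_less_divide_1_iff zero_less_one)
  then obtain \<delta>2 where \<delta>2: "\<delta>2 > 0" "\<And>\<zeta>. \<zeta> \<noteq> 0 \<Longrightarrow> norm \<zeta> < \<delta>2 \<Longrightarrow> norm (g (1 / \<zeta>)) \<ge> 1 / \<epsilon> + 1"
    unfolding eventually_at by (auto simp: dist_norm)
  let ?\<delta> = "Min {\<delta>1, \<delta>2, r, \<epsilon>}"
  show thesis
  proof (rule that[of ?\<delta> "1 / c"])
    show "0 < ?\<delta>" "?\<delta> \<le> r" "0 < 1 / c" using \<delta>1(1) \<delta>2(1) r \<epsilon> by auto
    fix \<zeta> :: complex assume z: "norm \<zeta> < ?\<delta>"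
    then have zr: "\<zeta> \<in> DDelta r" by (auto simp: DDelta_def)
    have ge: "norm (g \<zeta>) < \<epsilon>" using z by (intro \<delta>1(2)) simp
    show "g \<zeta> = y" if "norm y < ?\<delta>" "eta \<nu> y = \<zeta>" for y
      by (rule inj) (use ge that inv[OF zr] in auto)
    have "c * norm (g \<zeta> - 0) \<le> norm (eta \<nu> (g \<zeta>) - eta \<nu> 0)"
      using ge \<epsilon>(1) by (intro expand) auto
    then show "norm (g \<zeta>) \<le> 1 / c * norm \<zeta>"
      using \<epsilon>(3) inv[OF zr] by (simp add: field_simps)
    assume z0: "0 < norm \<zeta>"
    let ?G = "g (1 / cnj \<zeta>)"
    have "norm ?G \<ge> 1 / \<epsilon> + 1"
      using z z0 by (intro \<delta>2(2)) auto
    moreover have "1 / \<epsilon> \<ge> 2" using \<epsilon> by (simp add: field_simps)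
    ultimately have G: "norm ?G > 1 / \<epsilon>" "norm ?G > 1" by auto
    have "1 / cnj \<zeta> \<in> DDelta r"
      using z z0 r by (auto simp: DDelta_def Delta_def norm_divide intro!: divide_strict_left_mono)
    then have e1: "eta \<nu> (1 / cnj ?G) = \<zeta>"
      using G by (subst eta_reflection) (auto simp: inv)
    have e2: "norm (1 / cnj ?G) < \<epsilon>"
    proof -
      have "0 < norm ?G" using G by linarith
      with G(1) \<epsilon>(1) show ?thesis by (simp add: norm_divide field_simps)
    qed
    have h: "1 / cnj ?G = g \<zeta>"
      by (rule inj[OF e2 ge]) (simp only: e1 inv[OF zr])
    show "?G = 1 / cnj (g \<zeta>)" unfolding h[symmetric] by simp
  qed
qed

text \<open>Makes the \<open>THE\<close> in \<open>eta_inv\<close> meaningful: near 0 both inverses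
  pick the small preimage, reflection gives agreement near infinity, and continuation does the
  rest.\<close>

lemma eta_inverse_unique:
  assumes m: "mean \<nu> \<noteq> 0" and r: "0 < r" "r \<le> 1" "0 < r'" "r' \<le> 1"
    and g: "is_eta_inverse \<nu> r g" and g': "is_eta_inverse \<nu> r' g'"
    and z: "z \<in> DDelta r" "z \<in> DDelta r'"
  shows "g z = g' z"
proof -
  obtain \<delta> C where \<delta>: "0 < \<delta>" "\<delta> \<le> r" "0 < C"
    "\<And>\<zeta> y. norm \<zeta> < \<delta> \<Longrightarrow> norm y < \<delta> \<Longrightarrow> eta \<nu> y = \<zeta> \<Longrightarrow> g \<zeta> = y"
    "\<And>\<zeta>. norm \<zeta> < \<delta> \<Longrightarrow> norm (g \<zeta>) \<le> C * norm \<zeta>"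
    "\<And>\<zeta>. 0 < norm \<zeta> \<Longrightarrow> norm \<zeta> < \<delta> \<Longrightarrow> g (1 / cnj \<zeta>) = 1 / cnj (g \<zeta>)"
    using m r(1) g by (rule eta_inverse_local) blast
  obtain \<delta>' C' where \<delta>': "0 < \<delta>'" "\<delta>' \<le> r'" "0 < C'"
    "\<And>\<zeta> y. norm \<zeta> < \<delta>' \<Longrightarrow> norm y < \<delta>' \<Longrightarrow> eta \<nu> y = \<zeta> \<Longrightarrow> g' \<zeta> = y"
    "\<And>\<zeta>. norm \<zeta> < \<delta>' \<Longrightarrow> norm (g' \<zeta>) \<le> C' * norm \<zeta>"
    "\<And>\<zeta>. 0 < norm \<zeta> \<Longrightarrow> norm \<zeta> < \<delta>' \<Longrightarrow> g' (1 / cnj \<zeta>) = 1 / cnj (g' \<zeta>)"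
    using m r(3) g' by (rule eta_inverse_local) blast
  \<comment> \<open>The last entry puts \<open>g' \<zeta>\<close> into the disc in which
    \<open>g \<zeta>\<close> is the only preimage.\<close>
  let ?\<delta> = "Min {\<delta>, \<delta>', \<delta> / C'}"
  let ?r = "min r r'"
  have d: "0 < ?\<delta>" "?\<delta> \<le> ?r" using \<delta> \<delta>' by (auto simp: min_def)
  have zr: "z \<in> DDelta ?r"
  proof -
    have "1 / r \<ge> 1" "1 / r' \<ge> 1" using r by auto
    then show ?thesis using z r by (auto simp: DDelta_def Delta_def min_def)
  qed
  have eq: "g \<zeta> = g' \<zeta>" if "norm \<zeta> < ?\<delta>" for \<zeta>
  proof (rule \<delta>(4))
    have "norm (g' \<zeta>) \<le> C' * norm \<zeta>" using that by (intro \<delta>'(5)) simp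
    also have "\<dots> < \<delta>" using that \<delta>'(3) by (simp add: field_simps)
    finally show "norm (g' \<zeta>) < \<delta>" .
    have "\<zeta> \<in> DDelta r'" using that \<delta>'(2) by (auto simp: DDelta_def)
    then show "eta \<nu> (g' \<zeta>) = \<zeta>" using g' by (simp add: is_eta_inverse_def)
  qed (use that in simp)
  have sub: "DDelta ?r \<subseteq> DDelta r" "DDelta ?r \<subseteq> DDelta r'"
    using r by (intro DDelta_mono; simp)+
  show ?thesis
  proof (rule continuation_DDelta[OF d, of g g'])
    show "g holomorphic_on DDelta ?r" "g' holomorphic_on DDelta ?r"
      using g g' sub unfolding is_eta_inverse_def by (meson holomorphic_on_subset)+
    fix \<zeta> assume z: "\<zeta> \<in> DDelta ?\<delta>" "\<zeta> \<noteq> 0"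
    show "g \<zeta> = g' \<zeta>"
    proof (cases "norm \<zeta> < ?\<delta>")
      case True
      then show ?thesis by (rule eq)
    next
      case False
      then have "norm \<zeta> > 1 / ?\<delta>" using z by (auto simp: DDelta_def Delta_def)
      then have w: "norm (1 / cnj \<zeta>) < ?\<delta>" "0 < norm (1 / cnj \<zeta>)"
        using d(1) z(2) by (auto simp: norm_divide field_simps simp del: Min_less_iff Min_gr_iff Min.insert)
      have "g (1 / cnj (1 / cnj \<zeta>)) = 1 / cnj (g (1 / cnj \<zeta>))"
        "g' (1 / cnj (1 / cnj \<zeta>)) = 1 / cnj (g' (1 / cnj \<zeta>))"
        by (rule \<delta>(6) \<delta>'(6), use w in simp, use w in simp)+
      then show ?thesis unfolding eq[OF w(1)] by simp
    qed
  qed (rule zr)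
qed

lemma eta_inv_eq:
  assumes m: "mean \<nu> \<noteq> 0" and r: "0 < r" "r \<le> 1" and g: "is_eta_inverse \<nu> r g" and z: "z \<in> DDelta r"
  shows "eta_inv \<nu> z = g z"
  unfolding eta_inv_def
proof (rule the_equality)
  show "\<exists>r ga. 0 < r \<and> r \<le> 1 \<and> is_eta_inverse \<nu> r ga \<and> z \<in> DDelta r \<and> g z = ga z"
    using assms by blast
  fix y assume "\<exists>r ga. 0 < r \<and> r \<le> 1 \<and> is_eta_inverse \<nu> r ga \<and> z \<in> DDelta r \<and> y = ga z"
  then obtain r' g' where g': "0 < r'" "r' \<le> 1" "is_eta_inverse \<nu> r' g'" "z \<in> DDelta r'" "y = g' z"
    by blast
  show "y = g z"
    unfolding g'(5) using eta_inverse_unique[OF m g'(1,2) r g'(3) g g'(4) z] .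
qed

lemma eta_inv_local:
  assumes m: "mean \<nu> \<noteq> 0" and r: "0 < r" "r \<le> 1" and g: "is_eta_inverse \<nu> r g"
  obtains \<delta> C where "0 < \<delta>" "\<delta> \<le> r" "0 < C"
    "\<And>\<zeta> y. norm \<zeta> < \<delta> \<Longrightarrow> norm y < \<delta> \<Longrightarrow> eta \<nu> y = \<zeta> \<Longrightarrow> eta_inv \<nu> \<zeta> = y"
    "\<And>\<zeta>. norm \<zeta> < \<delta> \<Longrightarrow> norm (eta_inv \<nu> \<zeta>) \<le> C * norm \<zeta>"
    "\<And>\<zeta>. norm \<zeta> < \<delta> \<Longrightarrow> eta \<nu> (eta_inv \<nu> \<zeta>) = \<zeta>"
    "\<And>\<zeta>. 0 < norm \<zeta> \<Longrightarrow> norm \<zeta> < \<delta> \<Longrightarrow> eta_inv \<nu> (1 / cnj \<zeta>) = 1 / cnj (eta_inv \<nu> \<zeta>)"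
proof -
  obtain \<delta> C where \<delta>: "0 < \<delta>" "\<delta> \<le> r" "0 < C"
    "\<And>\<zeta> y. norm \<zeta> < \<delta> \<Longrightarrow> norm y < \<delta> \<Longrightarrow> eta \<nu> y = \<zeta> \<Longrightarrow> g \<zeta> = y"
    "\<And>\<zeta>. norm \<zeta> < \<delta> \<Longrightarrow> norm (g \<zeta>) \<le> C * norm \<zeta>"
    "\<And>\<zeta>. 0 < norm \<zeta> \<Longrightarrow> norm \<zeta> < \<delta> \<Longrightarrow> g (1 / cnj \<zeta>) = 1 / cnj (g \<zeta>)"
    using m r(1) g by (rule eta_inverse_local) blast
  have D: "\<zeta> \<in> DDelta r" if "norm \<zeta> < \<delta>" for \<zeta> using that \<delta>(2) by (auto simp: DDelta_def)
  have D': "1 / cnj \<zeta> \<in> DDelta r" if "0 < norm \<zeta>" "norm \<zeta> < \<delta>" for \<zeta>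
    using that \<delta>(2) r(1) by (auto simp: DDelta_def Delta_def norm_divide intro!: divide_strict_left_mono)
  have E: "eta_inv \<nu> \<zeta> = g \<zeta>" if "\<zeta> \<in> DDelta r" for \<zeta>
    using that by (rule eta_inv_eq[OF m r g])
  show thesis
    by (rule that[OF \<delta>(1-3)])
      (use \<delta>(4-) D D' E g in \<open>auto simp: is_eta_inverse_def\<close>)
qed

end

section \<open>Multiplicativity\<close>

text \<open>\<open>16\<close> bounds the growth of the sup norm under \<open>u\<^sub>1u\<^sub>2\<close> and \<open>v\<^sub>1v\<^sub>2\<close>; the bound by
  \<open>norm \<zeta> / 4\<close> makes the sums over alternating words converge.\<close>

definition local_data :: "(bool \<Rightarrow> complex measure) \<Rightarrow> complex \<Rightarrow> (bool \<Rightarrow> complex) \<Rightarrow> bool" where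
  "local_data \<nu> \<zeta> c \<longleftrightarrow> \<zeta> \<noteq> 0 \<and> (\<forall>i. c i \<noteq> 0 \<and> norm (c i) \<noteq> 1 \<and> eta (\<nu> i) (c i) = \<zeta>) \<and>
     (\<exists>\<phi>. (\<forall>i s. norm s = 1 \<longrightarrow> norm ((1 - \<zeta>) / (1 - c i * s) - 1) \<le> \<phi> i) \<and>
          \<phi> True * \<phi> False \<le> norm \<zeta> / 4) \<and>
     (norm (c True * c False / \<zeta>) < 1 / 16 \<or> norm (c True * c False / \<zeta>) > 16)"

lemma norm_inverse_cnj: "norm (1 / cnj x) = 1 / norm x"
  by (simp add: norm_divide)

text \<open>At the reflected data the centered function becomes the conjugate of the old one divided
  by \<open>cnj \<zeta>\<close>. The product of the two bounds is divided by the square of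
  \<open>norm \<zeta>\<close>, so it is again a quarter of the modulus of the parameter.\<close>

lemma local_data_reflection:
  assumes \<nu>: "\<And>i. circle_measure (\<nu> i)" and l: "local_data \<nu> \<zeta> c"
  shows "local_data \<nu> (1 / cnj \<zeta>) (\<lambda>i. 1 / cnj (c i))"
proof -
  have nz: "\<zeta> \<noteq> 0" "\<And>i. c i \<noteq> 0" "\<And>i. norm (c i) \<noteq> 1" "\<And>i. eta (\<nu> i) (c i) = \<zeta>"
    and z: "norm (c True * c False / \<zeta>) < 1 / 16 \<or> norm (c True * c False / \<zeta>) > 16"
    using l by (auto simp: local_data_def)
  obtain \<phi> where \<phi>: "\<And>i s. norm s = 1 \<Longrightarrow> norm ((1 - \<zeta>) / (1 - c i * s) - 1) \<le> \<phi> i"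
    "\<phi> True * \<phi> False \<le> norm \<zeta> / 4"
    using l by (auto simp: local_data_def)
  have "norm ((1 - 1 / cnj \<zeta>) / (1 - 1 / cnj (c i) * s) - 1) \<le> \<phi> i / norm \<zeta>" if s: "norm s = 1" for i s
  proof -
    have ss: "s * cnj s = 1" using s by (simp add: complex_norm_square[symmetric])
    have 1: "1 - c i * s \<noteq> 0" using reciprocal_bounds(1)[OF s nz(3)] .
    have e: "1 - 1 / cnj (c i) * s = - (s / cnj (c i)) * cnj (1 - c i * s)"
      using nz(2) ss by (simp add: field_simps)
    have s0: "s \<noteq> 0" using s by auto
    have cn: "cnj (1 - c i * s) \<noteq> 0" using 1 by (simp only: complex_cnj_zero_iff not_False_eq_True)
    have "(1 - 1 / cnj \<zeta>) / (1 - 1 / cnj (c i) * s) - 1 =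
        (1 / cnj (c i) * s - 1 / cnj \<zeta>) / (1 - 1 / cnj (c i) * s)"
    proof -
      have D: "1 - 1 / cnj (c i) * s \<noteq> 0" unfolding e using cn s0 nz(2)[of i] by (simp del: complex_cnj_diff complex_cnj_mult)
      have eq: "1 / cnj (c i) * s - 1 / cnj \<zeta> = (1 - 1 / cnj \<zeta>) - (1 - 1 / cnj (c i) * s)" by simp
      show ?thesis
        unfolding eq diff_divide_distrib[of "1 - 1 / cnj \<zeta>" "1 - 1 / cnj (c i) * s"] divide_self[OF D] ..
    qed
    also have "1 / cnj (c i) * s - 1 / cnj \<zeta> = - (s / cnj (c i)) * (cnj (c i * s - \<zeta>) / cnj \<zeta>)"
      using nz(1) nz(2)[of i] ss by (simp add: field_simps)
    also have "\<dots> / (1 - 1 / cnj (c i) * s) = cnj ((c i * s - \<zeta>) / (1 - c i * s)) / cnj \<zeta>"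
      unfolding e using s0 nz(2)[of i] by simp
    also have "(c i * s - \<zeta>) / (1 - c i * s) = (1 - \<zeta>) / (1 - c i * s) - 1"
      using 1 by (simp add: divide_simps)
    finally have "norm ((1 - 1 / cnj \<zeta>) / (1 - 1 / cnj (c i) * s) - 1) =
        norm ((1 - \<zeta>) / (1 - c i * s) - 1) / norm \<zeta>"
      by (simp only: norm_divide complex_mod_cnj)
    then show ?thesis using \<phi>(1)[OF s, of i] by (simp add: divide_right_mono)
  qed
  moreover have "\<phi> True / norm \<zeta> * (\<phi> False / norm \<zeta>) \<le> norm (1 / cnj \<zeta>) / 4"
    using divide_right_mono[OF \<phi>(2), of "norm \<zeta> * norm \<zeta>"] nz(1)
    by (simp add: norm_inverse_cnj)
  moreover have "norm (1 / cnj (c True) * (1 / cnj (c False)) / (1 / cnj \<zeta>)) = 1 / norm (c True * c False / \<zeta>)"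
    by (simp add: norm_mult norm_divide)
  moreover have "1 / x < 1 / 16 \<or> 1 / x > 16" if "x < 1 / 16 \<or> x > 16" "x > 0" for x :: real
    using that by (auto simp: field_simps)
  moreover have "eta (\<nu> i) (1 / cnj (c i)) = 1 / cnj \<zeta>" for i
    using circle_measure.eta_reflection[OF \<nu>[of i] nz(3)[of i] nz(2)[of i]] nz(4)[of i] by simp
  ultimately show ?thesis
    unfolding local_data_def using nz z
    by (intro conjI allI exI[of _ "\<lambda>i. \<phi> i / norm \<zeta>"] impI) (auto simp: norm_inverse_cnj)
qed

lemma small_resolvent_bound:
  fixes a s \<zeta> :: complex
  assumes "norm s = 1" "norm a \<le> C * norm \<zeta>" "C * norm \<zeta> \<le> 1 / 2"
  shows "norm ((1 - \<zeta>) / (1 - a * s) - 1) \<le> 2 * (C + 1) * norm \<zeta>"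
proof -
  have C: "C * norm \<zeta> \<ge> 0" using assms(2) norm_ge_zero[of a] by linarith
  have d: "norm (1 - a * s) \<ge> 1 / 2"
    using norm_triangle_ineq2[of 1 "a * s"] assms by (simp add: norm_mult)
  then have "1 - a * s \<noteq> 0" by auto
  then have "(1 - \<zeta>) / (1 - a * s) - 1 = (a * s - \<zeta>) / (1 - a * s)" by (simp add: divide_simps)
  also have "norm \<dots> \<le> (C * norm \<zeta> + norm \<zeta>) / (1 / 2)"
    unfolding norm_divide using C d assms norm_triangle_ineq4[of "a * s" \<zeta>]
    by (intro frac_le) (auto simp: norm_mult)
  finally show ?thesis by (simp add: algebra_simps)
qed

text \<open>\<open>\<kappa>\<close> will be a marginal of the convolution. That \<open>z\<close> is
  a preimage of \<open>\<zeta>\<close> follows only from the moments, so it is a premise here; the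
  estimates show that such a preimage is the one chosen by \<open>eta_inv\<close>.\<close>

lemma local_data_near:
  assumes \<nu>: "\<And>i. circle_measure (\<nu> i)" "\<And>i. mean (\<nu> i) \<noteq> 0" "\<And>i. \<exists>g. is_eta_inverse (\<nu> i) r g"
    and \<kappa>: "circle_measure \<kappa>" "mean \<kappa> \<noteq> 0" "\<exists>g. is_eta_inverse \<kappa> r g"
    and r: "0 < r" "r \<le> 1"
  shows "\<exists>\<delta>. 0 < \<delta> \<and> \<delta> \<le> r \<and> (\<forall>\<zeta>\<in>DDelta \<delta> - {0}.
      let c = (\<lambda>i. eta_inv (\<nu> i) \<zeta>); z = c True * c False / \<zeta>
      in local_data \<nu> \<zeta> c \<and> (eta \<kappa> z = \<zeta> \<longrightarrow> eta_inv \<kappa> \<zeta> = z))"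
proof -
  have ex: "\<exists>\<delta> C. 0 < \<delta> \<and> \<delta> \<le> r \<and> 0 < C \<and>
      (\<forall>\<zeta> y. norm \<zeta> < \<delta> \<longrightarrow> norm y < \<delta> \<longrightarrow> eta \<nu>' y = \<zeta> \<longrightarrow> eta_inv \<nu>' \<zeta> = y) \<and>
      (\<forall>\<zeta>. norm \<zeta> < \<delta> \<longrightarrow> norm (eta_inv \<nu>' \<zeta>) \<le> C * norm \<zeta>) \<and>
      (\<forall>\<zeta>. norm \<zeta> < \<delta> \<longrightarrow> eta \<nu>' (eta_inv \<nu>' \<zeta>) = \<zeta>) \<and>
      (\<forall>\<zeta>. 0 < norm \<zeta> \<longrightarrow> norm \<zeta> < \<delta> \<longrightarrow> eta_inv \<nu>' (1 / cnj \<zeta>) = 1 / cnj (eta_inv \<nu>' \<zeta>))"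
    if h: "circle_measure \<nu>'" "mean \<nu>' \<noteq> 0" "\<exists>g. is_eta_inverse \<nu>' r g" for \<nu>'
  proof -
    obtain g where g: "is_eta_inverse \<nu>' r g" using h(3) by blast
    show ?thesis
      by (rule circle_measure.eta_inv_local[OF h(1,2) r g], rule exI, rule exI) blast
  qed
  obtain \<delta>' C' where \<delta>': "\<And>i. 0 < \<delta>' i" "\<And>i. \<delta>' i \<le> r" "\<And>i. 0 < C' i"
    "\<And>i \<zeta>. norm \<zeta> < \<delta>' i \<Longrightarrow> norm (eta_inv (\<nu> i) \<zeta>) \<le> C' i * norm \<zeta>"
    "\<And>i \<zeta>. norm \<zeta> < \<delta>' i \<Longrightarrow> eta (\<nu> i) (eta_inv (\<nu> i) \<zeta>) = \<zeta>"
    "\<And>i \<zeta>. 0 < norm \<zeta> \<Longrightarrow> norm \<zeta> < \<delta>' i \<Longrightarrow> eta_inv (\<nu> i) (1 / cnj \<zeta>) = 1 / cnj (eta_inv (\<nu> i) \<zeta>)"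
    using ex[OF \<nu>] by metis
  obtain \<delta>k where \<delta>k: "0 < \<delta>k"
    "\<And>\<zeta> y. norm \<zeta> < \<delta>k \<Longrightarrow> norm y < \<delta>k \<Longrightarrow> eta \<kappa> y = \<zeta> \<Longrightarrow> eta_inv \<kappa> \<zeta> = y"
    "\<And>\<zeta>. 0 < norm \<zeta> \<Longrightarrow> norm \<zeta> < \<delta>k \<Longrightarrow> eta_inv \<kappa> (1 / cnj \<zeta>) = 1 / cnj (eta_inv \<kappa> \<zeta>)"
    using ex[OF \<kappa>] by metis
  define K where "K = C' True + C' False + 1"
  have K: "K \<ge> 1" "C' i + 1 \<le> K" for i
    using \<delta>'(3)[of True] \<delta>'(3)[of False] by (cases i; simp add: K_def)+
  \<comment> \<open>With \<open>norm (c i)\<close> at most \<open>K * norm \<zeta>\<close> and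
    \<open>norm z\<close> at most \<open>K\<^sup>2 * norm \<zeta>\<close>, the fourth entry yields
    both the bound 1/16 for \<open>z\<close> and the product bound \<open>norm \<zeta> / 4\<close>;
    the fifth puts \<open>z\<close> into the disc of unique preimages for
    \<open>\<kappa>\<close>.\<close>
  define \<delta> where "\<delta> = Min {\<delta>' True, \<delta>' False, \<delta>k, 1 / (16 * K\<^sup>2), \<delta>k / K\<^sup>2}"
  have K2: "K\<^sup>2 > 0" using K(1) by (intro zero_less_power) simp
  have \<delta>: "0 < \<delta>" "\<delta> \<le> \<delta>' True" "\<delta> \<le> \<delta>' False" "\<delta> \<le> \<delta>k" "\<delta> \<le> 1 / (16 * K\<^sup>2)" "\<delta> \<le> \<delta>k / K\<^sup>2"
    using \<delta>'(1) \<delta>k(1) K2 by (auto simp: \<delta>_def)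
  have \<delta>i: "\<delta> \<le> \<delta>' i" for i using \<delta>(2,3) by (cases i) auto
  let ?c = "\<lambda>\<zeta> i. eta_inv (\<nu> i) \<zeta>"
  let ?z = "\<lambda>\<zeta>. ?c \<zeta> True * ?c \<zeta> False / \<zeta>"
  have near: "local_data \<nu> \<zeta> (?c \<zeta>)" "eta \<kappa> (?z \<zeta>) = \<zeta> \<Longrightarrow> eta_inv \<kappa> \<zeta> = ?z \<zeta>"
    if z: "0 < norm \<zeta>" "norm \<zeta> < \<delta>" for \<zeta>
  proof -
    have zi: "norm \<zeta> < \<delta>' i" for i using z(2) \<delta>i[of i] by linarith
    have "K\<^sup>2 * \<delta> \<le> 1 / 16" "K\<^sup>2 * \<delta> \<le> \<delta>k"
      using \<delta>(5,6) K2 by (simp_all add: field_simps)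
    then have Kz: "K\<^sup>2 * norm \<zeta> < 1 / 16" "K\<^sup>2 * norm \<zeta> < \<delta>k"
      using mult_strict_left_mono[OF z(2) K2] by linarith+
    have "K * 1 \<le> K * K" using K by (intro mult_left_mono) auto
    then have "K * norm \<zeta> \<le> K\<^sup>2 * norm \<zeta>" by (intro mult_right_mono) (auto simp: power2_eq_square)
    then have K1: "K * norm \<zeta> < 1 / 16" using Kz(1) by linarith
    have c_le: "norm (?c \<zeta> i) \<le> (K - 1) * norm \<zeta>" for i
    proof -
      have "C' i * norm \<zeta> \<le> (K - 1) * norm \<zeta>" using K(2)[of i] by (intro mult_right_mono) auto
      then show ?thesis using \<delta>'(4)[OF zi, of i] by linarith
    qed
    have c_K: "norm (?c \<zeta> i) \<le> K * norm \<zeta>" for i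
      using c_le[of i] z(1) unfolding left_diff_distrib by linarith
    have eta: "eta (\<nu> i) (?c \<zeta> i) = \<zeta>" for i by (rule \<delta>'(5)[OF zi])
    have c0: "?c \<zeta> i \<noteq> 0" for i
      using eta[of i] circle_measure.eta_0[OF \<nu>(1)[of i]] z(1) by fastforce
    have c1: "norm (?c \<zeta> i) \<noteq> 1" for i using c_K[of i] K1 by linarith
    have "norm (?z \<zeta>) = norm (?c \<zeta> True) * norm (?c \<zeta> False) / norm \<zeta>" by (simp add: norm_mult norm_divide)
    also have "\<dots> \<le> (K * norm \<zeta>) * (K * norm \<zeta>) / norm \<zeta>"
      using c_K K(1) by (intro divide_right_mono mult_mono) auto
    also have "\<dots> = K\<^sup>2 * norm \<zeta>" using z(1) by (simp add: power2_eq_square)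
    finally have zz: "norm (?z \<zeta>) \<le> K\<^sup>2 * norm \<zeta>" .
    have b: "norm ((1 - \<zeta>) / (1 - ?c \<zeta> i * s) - 1) \<le> 2 * K * norm \<zeta>" if "norm s = 1" for i s
    proof -
      have "(K - 1) * norm \<zeta> \<le> 1 / 2" using K1 z(1) unfolding left_diff_distrib by linarith
      from small_resolvent_bound[OF that c_le[of i] this] show ?thesis by simp
    qed
    have "(2 * K * norm \<zeta>) * (2 * K * norm \<zeta>) = 4 * (K\<^sup>2 * norm \<zeta>) * norm \<zeta>"
      by (simp add: power2_eq_square)
    also have "\<dots> \<le> 4 * (1 / 16) * norm \<zeta>" using Kz by (intro mult_right_mono mult_left_mono) auto
    finally have p: "(2 * K * norm \<zeta>) * (2 * K * norm \<zeta>) \<le> norm \<zeta> / 4" by simp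
    have "norm (?z \<zeta>) < 1 / 16" using zz Kz(1) by linarith
    then show "local_data \<nu> \<zeta> (?c \<zeta>)"
      unfolding local_data_def using z(1) c0 c1 eta b p
      by (intro conjI allI exI[of _ "\<lambda>_. 2 * K * norm \<zeta>"] impI) auto
    show "eta_inv \<kappa> \<zeta> = ?z \<zeta>" if "eta \<kappa> (?z \<zeta>) = \<zeta>"
      using that zz Kz(2) z(2) \<delta>(4) by (intro \<delta>k(2)) linarith+
  qed
  have "local_data \<nu> \<zeta> (?c \<zeta>) \<and> (eta \<kappa> (?z \<zeta>) = \<zeta> \<longrightarrow> eta_inv \<kappa> \<zeta> = ?z \<zeta>)"
    if z: "\<zeta> \<in> DDelta \<delta>" "\<zeta> \<noteq> 0" for \<zeta>
  proof (cases "norm \<zeta> < \<delta>")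
    case True
    then show ?thesis using near[of \<zeta>] z by auto
  next
    case False
    then have big: "norm \<zeta> > 1 / \<delta>" using z by (auto simp: DDelta_def Delta_def)
    define u where "u = 1 / cnj \<zeta>"
    have \<zeta>u: "\<zeta> = 1 / cnj u" by (simp add: u_def)
    have u: "0 < norm u" "norm u < \<delta>"
      using big z(2) \<delta>(1) by (auto simp: u_def norm_divide field_simps)
    have l: "local_data \<nu> u (?c u)" by (rule near(1)[OF u])
    have c: "?c \<zeta> i = 1 / cnj (?c u i)" for i
      unfolding \<zeta>u using u \<delta>i[of i] by (intro \<delta>'(6)) auto
    have zz: "?z \<zeta> = 1 / cnj (?z u)" unfolding c by (simp add: \<zeta>u)
    have "eta_inv \<kappa> \<zeta> = ?z \<zeta>" if e: "eta \<kappa> (?z \<zeta>) = \<zeta>"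
    proof -
      have nz: "norm (?z u) \<noteq> 1" "?z u \<noteq> 0" using l by (auto simp: local_data_def)
      have "1 / cnj (eta \<kappa> (?z u)) = eta \<kappa> (?z \<zeta>)"
        unfolding zz by (rule circle_measure.eta_reflection[OF \<kappa>(1) nz, symmetric])
      also have "\<dots> = 1 / cnj u" unfolding e by (rule \<zeta>u)
      finally have "1 / cnj (1 / cnj (eta \<kappa> (?z u))) = 1 / cnj (1 / cnj u)" by (simp only:)
      then have "eta \<kappa> (?z u) = u" by simp
      from near(2)[OF u this] have "eta_inv \<kappa> u = ?z u" .
      moreover have "eta_inv \<kappa> \<zeta> = 1 / cnj (eta_inv \<kappa> u)"
        unfolding \<zeta>u using u \<delta>(4) by (intro \<delta>k(3)) auto
      ultimately show ?thesis unfolding zz by (simp only:)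
    qed
    then show ?thesis
      using local_data_reflection[OF \<nu>(1) l] unfolding c[symmetric] \<zeta>u[symmetric] by simp
  qed
  moreover have "\<delta> \<le> r" using \<delta>i[of True] \<delta>'(2)[of True] by linarith
  ultimately show ?thesis using \<delta>(1) unfolding Let_def by blast
qed

section \<open>Marginals, means and the product formula off the axes\<close>

lemma circle_borel_measurable_id: "(\<lambda>x. x) \<in> borel_measurable circle_borel"
  unfolding circle_borel_def by (rule measurable_restrict_space1) simp

lemma marginals:
  assumes \<mu>: "\<mu> \<in> torus_probs"
  shows "circle_measure (marginal1 \<mu>)" "circle_measure (marginal2 \<mu>)"
    "mean (marginal1 \<mu>) = (LINT x|\<mu>. fst x)" "mean (marginal2 \<mu>) = (LINT x|\<mu>. snd x)"
    "(LINT x|marginal1 \<mu>. 1 / (1 - y * x)) = (LINT x|\<mu>. 1 / (1 - y * fst x))"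
    "(LINT x|marginal2 \<mu>. 1 / (1 - y * x)) = (LINT x|\<mu>. 1 / (1 - y * snd x))"
proof -
  note P = torus_probsD[OF \<mu>]
  interpret prob_space \<mu> by (rule P(1))
  have m: "fst \<in> \<mu> \<rightarrow>\<^sub>M circle_borel" "snd \<in> \<mu> \<rightarrow>\<^sub>M circle_borel"
    unfolding circle_borel_def using P by (auto intro!: measurable_restrict_space2)
  have f: "(\<lambda>x. 1 / (1 - y * x)) \<in> borel_measurable circle_borel"
    using circle_borel_measurable_id by measurable
  show "circle_measure (marginal1 \<mu>)" "circle_measure (marginal2 \<mu>)"
    unfolding circle_measure_def circle_measure_axioms_def marginal1_def marginal2_def
    by (auto intro: prob_space_distr m)
  show "mean (marginal1 \<mu>) = (LINT x|\<mu>. fst x)" "mean (marginal2 \<mu>) = (LINT x|\<mu>. snd x)"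
    unfolding mean_def marginal1_def marginal2_def
    by (rule integral_distr[OF m(1) circle_borel_measurable_id] integral_distr[OF m(2) circle_borel_measurable_id])+
  show "(LINT x|marginal1 \<mu>. 1 / (1 - y * x)) = (LINT x|\<mu>. 1 / (1 - y * fst x))"
    "(LINT x|marginal2 \<mu>. 1 / (1 - y * x)) = (LINT x|\<mu>. 1 / (1 - y * snd x))"
    unfolding marginal1_def marginal2_def
    by (rule integral_distr[OF m(1) f] integral_distr[OF m(2) f])+
qed

text \<open>Nonzero means of the factors thus give nonzero means for the marginals of
  \<open>\<mu>\<close>, on which uniqueness of their inverses rests. Two first moments, computed
  directly on the vacuum, suffice.\<close>

lemma means_convolution:
  assumes M: "\<mu>1 \<in> torus_probs" "\<mu>2 \<in> torus_probs" and conv: "is_bifree_convolution \<mu>1 \<mu>2 \<mu>"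
  shows "mean (marginal1 \<mu>) = mean (marginal1 \<mu>1) * mean (marginal1 \<mu>2)"
    "mean (marginal2 \<mu>) = mean (marginal2 \<mu>1) * mean (marginal2 \<mu>2)"
proof -
  have \<mu>: "\<mu> \<in> torus_probs" and
    mom: "\<And>p q. (LINT x|\<mu>. fst x powi p * snd x powi q) = bifree_moment \<mu>1 \<mu>2 p q"
    using conv by (auto simp: is_bifree_convolution_def)
  have "(LINT x|\<mu>. fst x) = bifree_moment \<mu>1 \<mu>2 1 0" using mom[of 1 0] by simp
  also have "\<dots> = (LINT x|\<mu>1. fst x) * (LINT x|\<mu>2. fst x)"
    by (simp add: bifree_moment_def fp_inner_vacuum op_powi_def left_op_def left_V_def left_V_inv_def
        vacuum_def Let_def)
  finally show "mean (marginal1 \<mu>) = mean (marginal1 \<mu>1) * mean (marginal1 \<mu>2)"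
    by (simp add: marginals \<mu> M)
  have "(LINT x|\<mu>. snd x) = bifree_moment \<mu>1 \<mu>2 0 1" using mom[of 0 1] by simp
  also have "\<dots> = (LINT x|\<mu>1. snd x) * (LINT x|\<mu>2. snd x)"
    by (simp add: bifree_moment_def fp_inner_vacuum op_powi_def right_op_def right_W_def right_W_inv_def
        vacuum_def Let_def)
  finally show "mean (marginal2 \<mu>) = mean (marginal2 \<mu>1) * mean (marginal2 \<mu>2)"
    by (simp add: marginals \<mu> M)
qed

text \<open>Each factor of \<open>psi2\<close> is a resolvent kernel minus 1, and the premises
  evaluate the integrals of the single kernels.\<close>

lemma psi2_H2:
  assumes \<mu>: "\<mu> \<in> torus_probs" and ab: "norm a \<noteq> 1" "norm b \<noteq> 1"
    and 1: "(1 - \<zeta>) * (LINT x|\<mu>. 1 / (1 - a * fst x)) = 1"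
    and 2: "(1 - \<omega>) * (LINT x|\<mu>. 1 / (1 - b * snd x)) = 1"
  shows "(1 - \<zeta>) * (1 - \<omega>) * psi2 \<mu> a b = (1 - \<zeta>) * (1 - \<omega>) * H2 \<mu> a b - 1 + \<zeta> * \<omega>"
proof -
  note P = torus_probsD[OF \<mu>]
  interpret prob_space \<mu> by (rule P(1))
  let ?A = "\<lambda>x. 1 / (1 - a * fst x)" and ?B = "\<lambda>x. 1 / (1 - b * snd x)"
  have bd: "norm (?A x) \<le> 1 / \<bar>1 - norm a\<bar>" "norm (?B x) \<le> 1 / \<bar>1 - norm b\<bar>"
    "1 - a * fst x \<noteq> 0" "1 - b * snd x \<noteq> 0" if "x \<in> space \<mu>" for x
    using P(3)[OF that] ab reciprocal_bounds by blast+
  have meas: "?A \<in> borel_measurable \<mu>" "?B \<in> borel_measurable \<mu>" using P(4,5) by measurable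
  have iA: "integrable \<mu> ?A"
    by (rule integrable_const_bound[OF AE_I2 meas(1)]) (rule bd)
  have iB: "integrable \<mu> ?B"
    by (rule integrable_const_bound[OF AE_I2 meas(2)]) (rule bd)
  have iAB: "integrable \<mu> (\<lambda>x. ?A x * ?B x)"
  proof (rule integrable_const_bound[OF AE_I2])
    show "norm (?A x * ?B x) \<le> 1 / \<bar>1 - norm a\<bar> * (1 / \<bar>1 - norm b\<bar>)" if "x \<in> space \<mu>" for x
      unfolding norm_mult using bd(1,2)[OF that] by (intro mult_mono) auto
  qed (use meas in measurable)
  have "psi2 \<mu> a b = (LINT x|\<mu>. ?A x * ?B x - ?A x - ?B x + 1)"
    unfolding psi2_def
  proof (rule Bochner_Integration.integral_cong)
    fix x assume x: "x \<in> space \<mu>"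
    have "a * fst x / (1 - a * fst x) = ?A x - 1" "b * snd x / (1 - b * snd x) = ?B x - 1"
      using bd(3,4)[OF x] by (simp_all add: divide_simps)
    then show "a * fst x / (1 - a * fst x) * (b * snd x / (1 - b * snd x)) = ?A x * ?B x - ?A x - ?B x + 1"
      by (simp only:) (simp add: algebra_simps)
  qed simp
  also have "\<dots> = H2 \<mu> a b - (LINT x|\<mu>. ?A x) - (LINT x|\<mu>. ?B x) + 1"
    using iA iB iAB by (simp add: H2_def prob_space)
  finally have E: "psi2 \<mu> a b = H2 \<mu> a b - (LINT x|\<mu>. ?A x) - (LINT x|\<mu>. ?B x) + 1" .
  have "(1 - \<zeta>) * (1 - \<omega>) * psi2 \<mu> a b = (1 - \<zeta>) * (1 - \<omega>) * H2 \<mu> a b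
      - (1 - \<omega>) * ((1 - \<zeta>) * (LINT x|\<mu>. ?A x)) - (1 - \<zeta>) * ((1 - \<omega>) * (LINT x|\<mu>. ?B x))
      + (1 - \<zeta>) * (1 - \<omega>)"
    unfolding E by (simp add: algebra_simps)
  then show ?thesis unfolding 1 2 by (simp add: algebra_simps)
qed

text \<open>Here \<open>p\<close> stands for \<open>\<zeta> * \<omega>\<close>, and
  \<open>h\<close>, \<open>h1\<close>, \<open>h2\<close> for the values of \<open>H2\<close>
  multiplied by \<open>(1 - \<zeta>) * (1 - \<omega>)\<close>; the last premise is then
  \<open>H2_product\<close>.\<close>

lemma quotient_multiplicative:
  fixes p h h1 h2 :: complex
  assumes "p \<noteq> 0" "h \<noteq> 0" "h1 \<noteq> 0" "h2 \<noteq> 0"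
    and "h * (1 - (h1 - 1) * (h2 - 1) / p) = h1 * h2"
  shows "(h - 1 + p) / (p * h) = (h1 - 1 + p) / (p * h1) * ((h2 - 1 + p) / (p * h2))"
proof -
  have 1: "h * (p - (h1 - 1) * (h2 - 1)) = p * h1 * h2"
    using assms(1,5) by (simp add: field_simps)
  have "h * ((h1 - 1 + p) * (h2 - 1 + p)) =
      h * (p * h1 * h2) - (1 - p) * (h * (p - (h1 - 1) * (h2 - 1)))"
    by (simp add: algebra_simps)
  also have "\<dots> = (h - 1 + p) * (p * h1 * h2)" unfolding 1 by (simp add: algebra_simps)
  finally have "(h - 1 + p) * (p * h1 * h2) = h * ((h1 - 1 + p) * (h2 - 1 + p))" by simp
  then show ?thesis using assms(1-4) by (simp add: frac_eq_eq mult_ac)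
qed

lemma bifree_Sigma_raw_product:
  assumes M: "\<And>i. M i \<in> torus_probs" and conv: "is_bifree_convolution (M True) (M False) \<mu>"
    and l: "local_data (\<lambda>i. marginal1 (M i)) \<zeta> (\<lambda>i. eta_inv (marginal1 (M i)) \<zeta>)"
    and r: "local_data (\<lambda>i. marginal2 (M i)) \<omega> (\<lambda>i. eta_inv (marginal2 (M i)) \<omega>)"
    and inv1: "\<And>z. z = eta_inv (marginal1 (M True)) \<zeta> * eta_inv (marginal1 (M False)) \<zeta> / \<zeta> \<Longrightarrow>
        eta (marginal1 \<mu>) z = \<zeta> \<Longrightarrow> eta_inv (marginal1 \<mu>) \<zeta> = z"
    and inv2: "\<And>z. z = eta_inv (marginal2 (M True)) \<omega> * eta_inv (marginal2 (M False)) \<omega> / \<omega> \<Longrightarrow>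
        eta (marginal2 \<mu>) z = \<omega> \<Longrightarrow> eta_inv (marginal2 \<mu>) \<omega> = z"
    and H: "\<And>i. H2 (M i) (eta_inv (marginal1 (M i)) \<zeta>) (eta_inv (marginal2 (M i)) \<omega>) \<noteq> 0"
      "H2 \<mu> (eta_inv (marginal1 \<mu>) \<zeta>) (eta_inv (marginal2 \<mu>) \<omega>) \<noteq> 0"
  shows "bifree_Sigma_raw \<mu> (\<zeta>, \<omega>) = bifree_Sigma_raw (M True) (\<zeta>, \<omega>) * bifree_Sigma_raw (M False) (\<zeta>, \<omega>)"
proof -
  define c where "c i = eta_inv (marginal1 (M i)) \<zeta>" for i
  define d where "d i = eta_inv (marginal2 (M i)) \<omega>" for i
  let ?z = "c True * c False / \<zeta>" and ?w = "d True * d False / \<omega>"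
  have \<mu>: "\<mu> \<in> torus_probs" using conv by (simp add: is_bifree_convolution_def)
  have L: "\<zeta> \<noteq> 0" "c i \<noteq> 0" "norm (c i) \<noteq> 1" "eta (marginal1 (M i)) (c i) = \<zeta>"
    "norm ?z < 1 / 16 \<or> norm ?z > 16" for i
    using l by (auto simp: local_data_def c_def)
  have R: "\<omega> \<noteq> 0" "d i \<noteq> 0" "norm (d i) \<noteq> 1" "eta (marginal2 (M i)) (d i) = \<omega>"
    "norm ?w < 1 / 16 \<or> norm ?w > 16" for i
    using r by (auto simp: local_data_def d_def)
  obtain \<phi> where \<phi>: "\<And>i s. norm s = 1 \<Longrightarrow> norm ((1 - \<zeta>) / (1 - c i * s) - 1) \<le> \<phi> i"
    "\<phi> True * \<phi> False \<le> norm \<zeta> / 4"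
    using l by (auto simp: local_data_def c_def)
  obtain \<psi> where \<psi>: "\<And>i s. norm s = 1 \<Longrightarrow> norm ((1 - \<omega>) / (1 - d i * s) - 1) \<le> \<psi> i"
    "\<psi> True * \<psi> False \<le> norm \<omega> / 4"
    using r by (auto simp: local_data_def d_def)
  have I1: "(1 - \<zeta>) * (LINT x|M i. 1 / (1 - c i * fst x)) = 1" for i
    using circle_measure.eta_eq_iff[OF marginals(1)[OF M[of i]] L(3)[of i] L(1)] L(4)[of i]
    by (simp add: marginals[OF M[of i]])
  have I2: "(1 - \<omega>) * (LINT x|M i. 1 / (1 - d i * snd x)) = 1" for i
    using circle_measure.eta_eq_iff[OF marginals(2)[OF M[of i]] R(3)[of i] R(1)] R(4)[of i]
    by (simp add: marginals[OF M[of i]])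
  interpret bifree_pair M \<zeta> c \<phi> \<omega> d \<psi> \<mu>
  proof unfold_locales
    show "(LINT x|M i. (1 - \<zeta>) / (1 - c i * fst x)) = 1" for i
      using I1[of i] by (simp flip: integral_mult_right_zero)
    show "(LINT x|M i. (1 - \<omega>) / (1 - d i * snd x)) = 1" for i
      using I2[of i] by (simp flip: integral_mult_right_zero)
  qed (use M conv L R \<phi> \<psi> in \<open>auto simp: unimodular_fst unimodular_snd torus_norm\<close>)
  have z1: "norm ?z \<noteq> 1" "norm ?w \<noteq> 1" using L(5) R(5) by auto
  have "eta (marginal1 \<mu>) ?z = \<zeta>"
    by (rule iffD2[OF circle_measure.eta_eq_iff[OF marginals(1)[OF \<mu>] z1(1) L(1)],
          unfolded marginals(5)[OF \<mu>], OF psi_left])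
  then have ez: "eta_inv (marginal1 \<mu>) \<zeta> = ?z" by (intro inv1) (simp add: c_def)
  have "eta (marginal2 \<mu>) ?w = \<omega>"
    by (rule iffD2[OF circle_measure.eta_eq_iff[OF marginals(2)[OF \<mu>] z1(2) R(1)],
          unfolded marginals(6)[OF \<mu>], OF psi_right])
  then have ew: "eta_inv (marginal2 \<mu>) \<omega> = ?w" by (intro inv2) (simp add: d_def)
  let ?s = "(1 - \<zeta>) * (1 - \<omega>)"
  have s: "?s \<noteq> 0" using I1[of True] I2[of True] by auto
  have Sigma: "psi2 \<mu>' a b / (\<zeta> * \<omega> * H2 \<mu>' a b) = (?s * H2 \<mu>' a b - 1 + \<zeta> * \<omega>) / (\<zeta> * \<omega> * (?s * H2 \<mu>' a b))"
    if "?s * psi2 \<mu>' a b = ?s * H2 \<mu>' a b - 1 + \<zeta> * \<omega>" for \<mu>' a b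
    unfolding that[symmetric] using s by simp
  have "bifree_Sigma_raw (M i) (\<zeta>, \<omega>) = (1 + m i - 1 + \<zeta> * \<omega>) / (\<zeta> * \<omega> * (1 + m i))" for i
    unfolding m_eq bifree_Sigma_raw_def prod.case c_def[symmetric] d_def[symmetric]
    by (intro Sigma psi2_H2 M L R I1 I2)
  moreover have "bifree_Sigma_raw \<mu> (\<zeta>, \<omega>) = (?s * H2 \<mu> ?z ?w - 1 + \<zeta> * \<omega>) / (\<zeta> * \<omega> * (?s * H2 \<mu> ?z ?w))"
    unfolding bifree_Sigma_raw_def prod.case ez ew
    by (intro Sigma psi2_H2 \<mu> z1 psi_left psi_right)
  moreover have "\<dots> = (1 + m True - 1 + \<zeta> * \<omega>) / (\<zeta> * \<omega> * (1 + m True)) *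
      ((1 + m False - 1 + \<zeta> * \<omega>) / (\<zeta> * \<omega> * (1 + m False)))"
  proof (rule quotient_multiplicative)
    show "?s * H2 \<mu> ?z ?w \<noteq> 0" using H(2) s unfolding ez ew by simp
    show "1 + m True \<noteq> 0" "1 + m False \<noteq> 0"
      unfolding m_eq using H(1)[of True] H(1)[of False] s by (simp_all add: c_def d_def)
    show "?s * H2 \<mu> ?z ?w * (1 - (1 + m True - 1) * (1 + m False - 1) / (\<zeta> * \<omega>)) = (1 + m True) * (1 + m False)"
      using H2_product by simp
  qed (use L(1) R(1) in simp)
  ultimately show ?thesis by simp
qed

section \<open>Continuation to the whole domain\<close>

lemma holomorphic2_on_slices:
  assumes F: "holomorphic2_on F (Omega r)"
  shows "w \<in> DDelta r \<Longrightarrow> (\<lambda>z. F (z, w)) holomorphic_on DDelta r"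
    "z \<in> DDelta r \<Longrightarrow> (\<lambda>w. F (z, w)) holomorphic_on DDelta r"
proof -
  have D: "\<exists>a b. (F has_derivative (\<lambda>h. a * fst h + b * snd h)) (at (z, w))"
    if "z \<in> DDelta r" "w \<in> DDelta r" for z w
    using F that by (auto simp: holomorphic2_on_def Omega_def)
  show "(\<lambda>z. F (z, w)) holomorphic_on DDelta r" if w: "w \<in> DDelta r"
  proof (rule holomorphic_onI)
    fix z assume "z \<in> DDelta r"
    from D[OF this w] obtain a b where
      F: "(F has_derivative (\<lambda>h. a * fst h + b * snd h)) (at (z, w))" by blast
    have "((\<lambda>z. (z, w)) has_derivative (\<lambda>h. (h, 0))) (at z)"
      by (intro derivative_eq_intros) auto
    from has_derivative_compose[OF this F] have "((\<lambda>z. F (z, w)) has_field_derivative a) (at z)"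
      by (simp add: has_field_derivative_def)
    then show "(\<lambda>z. F (z, w)) field_differentiable (at z within DDelta r)"
      using field_differentiable_at_within field_differentiable_def by blast
  qed
  show "(\<lambda>w. F (z, w)) holomorphic_on DDelta r" if z: "z \<in> DDelta r"
  proof (rule holomorphic_onI)
    fix w assume "w \<in> DDelta r"
    from D[OF z this] obtain a b where
      F: "(F has_derivative (\<lambda>h. a * fst h + b * snd h)) (at (z, w))" by blast
    have "((\<lambda>w. (z, w)) has_derivative (\<lambda>h. (0, h))) (at w)"
      by (intro derivative_eq_intros) auto
    from has_derivative_compose[OF this F] have "((\<lambda>w. F (z, w)) has_field_derivative b) (at w)"
      by (simp add: has_field_derivative_def)
    then show "(\<lambda>w. F (z, w)) field_differentiable (at w within DDelta r)"
      using field_differentiable_at_within field_differentiable_def by blast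
  qed
qed

theorem corollary2p9:
  fixes \<mu>1 \<mu>2 \<mu> :: "(complex \<times> complex) measure" and r :: real
  assumes "\<mu>1 \<in> torus_probs_nz" and "\<mu>2 \<in> torus_probs_nz"
    and "is_bifree_convolution \<mu>1 \<mu>2 \<mu>"
    and "Sigma_domain \<mu>1 r" and "Sigma_domain \<mu>2 r" and "Sigma_domain \<mu> r"
  shows "\<forall>(z, w) \<in> Omega r. bifree_Sigma \<mu> (z, w) = bifree_Sigma \<mu>1 (z, w) * bifree_Sigma \<mu>2 (z, w)"
proof -
  define M where "M = case_bool \<mu>1 \<mu>2"
  have M_simps: "M True = \<mu>1" "M False = \<mu>2" by (simp_all add: M_def)
  have nz: "M i \<in> torus_probs_nz" and dom: "Sigma_domain (M i) r" for i
    using assms by (cases i; simp add: M_simps)+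
  have M: "M i \<in> torus_probs" "mean (marginal1 (M i)) \<noteq> 0" "mean (marginal2 (M i)) \<noteq> 0" for i
    using nz[of i] by (auto simp: torus_probs_nz_def)
  have \<mu>: "\<mu> \<in> torus_probs" using assms(3) by (simp add: is_bifree_convolution_def)
  have mean: "mean (marginal1 \<mu>) \<noteq> 0" "mean (marginal2 \<mu>) \<noteq> 0"
    using means_convolution[OF M(1)[of True, unfolded M_simps] M(1)[of False, unfolded M_simps] assms(3)]
      M(2,3)[of True] M(2,3)[of False] by (simp_all add: M_simps)
  have r: "0 < r" "r < 1" using assms(4) by (simp_all add: Sigma_domain_def)
  then have r1: "r \<le> 1" by simp
  have inv: "\<exists>g. is_eta_inverse (marginal1 (M i)) r g" "\<exists>g. is_eta_inverse (marginal2 (M i)) r g"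
    "\<exists>g. is_eta_inverse (marginal1 \<mu>) r g" "\<exists>g. is_eta_inverse (marginal2 \<mu>) r g" for i
    using dom[of i] assms(6) by (simp_all add: Sigma_domain_def)
  have H: "H2 (M i) (eta_inv (marginal1 (M i)) z) (eta_inv (marginal2 (M i)) w) \<noteq> 0"
    "H2 \<mu> (eta_inv (marginal1 \<mu>) z) (eta_inv (marginal2 \<mu>) w) \<noteq> 0"
    if "z \<in> DDelta r" "w \<in> DDelta r" "z \<noteq> 0" "w \<noteq> 0" for i z w
    using that dom[of i] assms(6) by (auto simp: Sigma_domain_def Omega_def)
  obtain \<delta>1 where \<delta>1: "0 < \<delta>1" "\<delta>1 \<le> r" and
    near1: "\<And>\<zeta>. \<zeta> \<in> DDelta \<delta>1 \<Longrightarrow> \<zeta> \<noteq> 0 \<Longrightarrow>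
      local_data (\<lambda>i. marginal1 (M i)) \<zeta> (\<lambda>i. eta_inv (marginal1 (M i)) \<zeta>)"
      "\<And>\<zeta> z. \<zeta> \<in> DDelta \<delta>1 \<Longrightarrow> \<zeta> \<noteq> 0 \<Longrightarrow>
        z = eta_inv (marginal1 (M True)) \<zeta> * eta_inv (marginal1 (M False)) \<zeta> / \<zeta> \<Longrightarrow>
        eta (marginal1 \<mu>) z = \<zeta> \<Longrightarrow> eta_inv (marginal1 \<mu>) \<zeta> = z"
    using local_data_near[of "\<lambda>i. marginal1 (M i)" r "marginal1 \<mu>"] marginals(1)[OF M(1)] M(2) inv(1)
      marginals(1)[OF \<mu>] mean(1) inv(3) r(1) r1 unfolding Let_def by auto
  obtain \<delta>2 where \<delta>2: "0 < \<delta>2" "\<delta>2 \<le> r" and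
    near2: "\<And>\<zeta>. \<zeta> \<in> DDelta \<delta>2 \<Longrightarrow> \<zeta> \<noteq> 0 \<Longrightarrow>
      local_data (\<lambda>i. marginal2 (M i)) \<zeta> (\<lambda>i. eta_inv (marginal2 (M i)) \<zeta>)"
      "\<And>\<zeta> z. \<zeta> \<in> DDelta \<delta>2 \<Longrightarrow> \<zeta> \<noteq> 0 \<Longrightarrow>
        z = eta_inv (marginal2 (M True)) \<zeta> * eta_inv (marginal2 (M False)) \<zeta> / \<zeta> \<Longrightarrow>
        eta (marginal2 \<mu>) z = \<zeta> \<Longrightarrow> eta_inv (marginal2 \<mu>) \<zeta> = z"
    using local_data_near[of "\<lambda>i. marginal2 (M i)" r "marginal2 \<mu>"] marginals(2)[OF M(1)] M(3) inv(2)
      marginals(2)[OF \<mu>] mean(2) inv(4) r(1) r1 unfolding Let_def by auto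
  let ?F = "bifree_Sigma \<mu>" and ?G = "\<lambda>p. bifree_Sigma \<mu>1 p * bifree_Sigma \<mu>2 p"
  have holo: "(\<lambda>z. ?F (z, w)) holomorphic_on DDelta r" "(\<lambda>z. ?G (z, w)) holomorphic_on DDelta r"
    "(\<lambda>z. ?F (w, z)) holomorphic_on DDelta r" "(\<lambda>z. ?G (w, z)) holomorphic_on DDelta r"
    if w: "w \<in> DDelta r" for w
  proof -
    have F: "holomorphic2_on (bifree_Sigma \<mu>') (Omega r)" if "Sigma_domain \<mu>' r" for \<mu>'
      using that by (simp add: Sigma_domain_def)
    note slices = holomorphic2_on_slices[OF F[OF assms(4)]] holomorphic2_on_slices[OF F[OF assms(5)]]
      holomorphic2_on_slices[OF F[OF assms(6)]]
    show "(\<lambda>z. ?F (z, w)) holomorphic_on DDelta r" "(\<lambda>z. ?F (w, z)) holomorphic_on DDelta r"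
      "(\<lambda>z. ?G (z, w)) holomorphic_on DDelta r" "(\<lambda>z. ?G (w, z)) holomorphic_on DDelta r"
      by (intro holomorphic_on_mult slices w)+
  qed
  have near: "?F (z, w) = ?G (z, w)"
    if z: "z \<in> DDelta \<delta>1" "z \<noteq> 0" and w: "w \<in> DDelta \<delta>2" "w \<noteq> 0" for z w
  proof -
    have "z \<in> DDelta r" "w \<in> DDelta r"
      using z w DDelta_mono[OF \<delta>1] DDelta_mono[OF \<delta>2] by auto
    then have "bifree_Sigma_raw \<mu> (z, w) = bifree_Sigma_raw (M True) (z, w) * bifree_Sigma_raw (M False) (z, w)"
      using z w assms(3)
      by (intro bifree_Sigma_raw_product M near1 near2 H) (simp_all add: M_simps)
    then show ?thesis using z w by (simp add: bifree_Sigma_def M_simps)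
  qed
  \<comment> \<open>Continuation in \<open>z\<close> for fixed nonzero \<open>w\<close>, then in
    \<open>w\<close> for arbitrary \<open>z\<close>. The axes are reached by holomorphy of the
    extended transforms, so no limit has to be computed.\<close>
  have step: "?F (z, w) = ?G (z, w)" if "z \<in> DDelta r" "w \<in> DDelta \<delta>2" "w \<noteq> 0" for z w
  proof -
    have "w \<in> DDelta r" using that(2) DDelta_mono[OF \<delta>2] by blast
    from continuation_DDelta[OF \<delta>1 holo(1,2)[OF this] near[OF _ _ that(2,3)] that(1)] show ?thesis .
  qed
  have "?F (z, w) = ?G (z, w)" if "z \<in> DDelta r" "w \<in> DDelta r" for z w
    using continuation_DDelta[OF \<delta>2 holo(3,4)[OF that(1)] step[OF that(1)] that(2)] .
  then show ?thesis by (auto simp: Omega_def)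
qed

end
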